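(* Let $d\ge 2$ and let $\mathcal{H}$ be a connected four-cycle free graph. Then the hom-shift $X_{\mathcal{H}}$ is entropy minimal, i.e. for every shift space $Y\subsetneq X_{\mathcal{H}}$ one has $h_{top}(Y)<h_{top}(X_{\mathcal{H}})$.
   Context: Fix $d\ge 2$. $\mathbb{Z}^d$ is also regarded as a graph, with $\vec i\sim\vec j$ iff $\|\vec i-\vec j\|_1=1$. All graphs $\mathcal{H}$ are undirected, without multiple edges and without isolated vertices; the vertex set is also denoted $\mathcal{H}$ and adjacency $\sim_{\mathcal{H}}$. A graph is four-cycle free if it is finite, has no self-loops, and does not contain the 4-cycle $C_4$ as a subgraph (not necessarily induced). For a finite alphabet $\mathcal{A}$ (discrete topology), $\mathcal{A}^{\mathbb{Z}^d}$ has the product topology and shift maps $(\sigma^{\vec i}(x))_{\vec j}=x_{\vec i+\vec j}$. A shift space is a closed subset of $\mathcal{A}^{\mathbb{Z}^d}$ invariant under all shift maps. The hom-shift of a finite graph $\mathcal{H}$ is $X_{\mathcal{H}}=\{x\in\mathcal{H}^{\mathbb{Z}^d} : x_{\vec i}\sim_{\mathcal{H}}x_{\vec j}\text{ for all }\vec i\sim\vec j\}$. For a shift space $X$ and $A\subset\mathbb{Z}^d$, $\mathcal{L}_A(X)=\{x|_A : x\in X\}$. With $B_n=\{\vec i\in\mathbb{Z}^d:\|\vec i\|_\infty\le n\}$, the topological entropy is $h_{top}(X)=\lim_{n\to\infty}\frac{\log|\mathcal{L}_{B_n}(X)|}{|B_n|}$ (with $\log 0=-\infty$, so the empty shift space has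 entropy $-\infty$). *)

theory Defs
  imports
    "Graph_Theory.Pair_Digraph"
    "Graph_Theory.Digraph_Component"
    "HOL-Analysis.Analysis"
begin

text \<open>
  A point of \<open>\<int>\<^sup>d\<close> is a vector of type \<open>int ^ 'd\<close>, where \<open>d = CARD('d)\<close>.
\<close>

definition lattice_adj :: "int ^ 'd \<Rightarrow> int ^ 'd \<Rightarrow> bool" where
  "lattice_adj i j \<longleftrightarrow> (\<Sum>k\<in>UNIV. \<bar>i $ k - j $ k\<bar>) = 1"

definition lattice_box :: "nat \<Rightarrow> (int ^ 'd) set" where
  "lattice_box n = {i. \<forall>k. \<bar>i $ k\<bar> \<le> int n}"

text \<open>
  An undirected graph without multiple edges is a pair digraph with a symmetric arc set, in which
  an edge \<open>{u, v}\<close> is represented by both \<open>(u, v)\<close> and \<open>(v, u)\<close>, and a self-loop by \<open>(v, v)\<close>.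
  A vertex whose only neighbour is itself does not count as isolated.
\<close>

definition undirected_graph :: "'a pair_pre_digraph \<Rightarrow> bool" where
  "undirected_graph H \<longleftrightarrow>
     pair_sym_digraph H \<and> (\<forall>u\<in>pverts H. \<exists>v\<in>pverts H. u \<rightarrow>\<^bsub>H\<^esub> v)"

text \<open>
  The cycle below need not be induced: nothing is required of the pairs \<open>a, c\<close> and \<open>b, d\<close>.
\<close>

definition contains_C4 :: "'a pair_pre_digraph \<Rightarrow> bool" where
  "contains_C4 H \<longleftrightarrow>
     (\<exists>a b c d. distinct [a, b, c, d] \<and>
        a \<rightarrow>\<^bsub>H\<^esub> b \<and> b \<rightarrow>\<^bsub>H\<^esub> c \<and> c \<rightarrow>\<^bsub>H\<^esub> d \<and> d \<rightarrow>\<^bsub>H\<^esub> a)"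

definition four_cycle_free :: "'a pair_pre_digraph \<Rightarrow> bool" where
  "four_cycle_free H \<longleftrightarrow>
     finite (pverts H) \<and> (\<forall>v\<in>pverts H. \<not> v \<rightarrow>\<^bsub>H\<^esub> v) \<and> \<not> contains_C4 H"

definition shift :: "int ^ 'd \<Rightarrow> (int ^ 'd \<Rightarrow> 'a) \<Rightarrow> (int ^ 'd \<Rightarrow> 'a)" where
  "shift i x = (\<lambda>j. x (i + j))"

definition full_shift_topology :: "'a set \<Rightarrow> (int ^ 'd \<Rightarrow> 'a) topology" where
  "full_shift_topology A = product_topology (\<lambda>_. discrete_topology A) UNIV"

definition shift_space :: "'a set \<Rightarrow> (int ^ 'd \<Rightarrow> 'a) set \<Rightarrow> bool" where
  "shift_space A X \<longleftrightarrow>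
     finite A \<and> closedin (full_shift_topology A) X \<and> (\<forall>i. shift i ` X \<subseteq> X)"

definition hom_shift :: "'a pair_pre_digraph \<Rightarrow> (int ^ 'd \<Rightarrow> 'a) set" where
  "hom_shift H =
     {x. (\<forall>i. x i \<in> pverts H) \<and> (\<forall>i j. lattice_adj i j \<longrightarrow> x i \<rightarrow>\<^bsub>H\<^esub> x j)}"

definition language :: "(int ^ 'd) set \<Rightarrow> (int ^ 'd \<Rightarrow> 'a) set \<Rightarrow> (int ^ 'd \<Rightarrow> 'a) set" where
  "language A X = (\<lambda>x. restrict x A) ` X"

definition log_nat :: "nat \<Rightarrow> ereal" where
  "log_nat n = (if n = 0 then - \<infinity> else ereal (ln (real n)))"

text \<open>
  The limit below exists for every shift space (over a finite alphabet), by subadditivity of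
  \<open>log_nat (card (language A X))\<close> in \<open>A\<close> and shift invariance.
\<close>

definition topological_entropy :: "(int ^ 'd \<Rightarrow> 'a) set \<Rightarrow> ereal" where
  "topological_entropy X =
     lim (\<lambda>n. log_nat (card (language (lattice_box n) X)) /
              ereal (real (card (lattice_box n :: (int ^ 'd) set))))"

definition entropy_minimal :: "'a set \<Rightarrow> (int ^ 'd \<Rightarrow> 'a) set \<Rightarrow> bool" where
  "entropy_minimal A X \<longleftrightarrow>
     (\<forall>Y. shift_space A Y \<and> Y \<subset> X \<longrightarrow> topological_entropy Y < topological_entropy X)"

end

theory Submission
  imports Defs
begin

text \<open>
  Let \<open>Y\<close> be a proper subshift; it avoids the restriction of some \<open>z \<in> X\<^sub>H\<close> to a ball. Since every
  4-cycle of \<open>H\<close> is degenerate, a configuration lifts to the universal cover of \<open>H\<close>, a tree. Around a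
  site \<open>c\<close> there are two cases. If, for some base point, the lift on the sphere of radius \<open>M\<close> has depth
  at most \<open>M\<close> minus a constant, then the configuration can be contracted to the base point inside the
  ball and \<open>z\<close> can be inserted at \<open>c\<close> (\<open>c\<close> is replaceable). Otherwise the lift moves away from the base
  point at almost maximal speed along some coordinate direction (\<open>c\<close> is frozen), and so it does on
  the neighbouring parallel lines. Adjacent frozen rows almost determine each other, so there are at
  most \<open>exp (\<eta> V)\<close> configurations on a box of volume \<open>V\<close> with few replaceable sites, for any given
  \<open>\<eta> > 0\<close>. If there is a positive density of replaceable sites, inserting \<open>z\<close> at arbitrary subsets
  of a sparse set of them produces exponentially more configurations in \<open>X\<^sub>H\<close>, because the subset
  can be read off from the occurrences of the pattern. As the entropy of \<open>X\<^sub>H\<close> is positive unless every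
  vertex has a unique neighbour, the entropy of \<open>Y\<close> is smaller.
\<close>

section \<open>The lattice\<close>

text \<open>Parity is the recurrent obstacle: \<open>H\<close> may be bipartite, and then walks from
  \<open>z 0\<close> to a given vertex have lengths of one parity only. So the inserted pattern is
  taken from \<open>z\<close> or from a unit translate of \<open>z\<close>, and the avoided ball is
  large enough for \<open>Y\<close> to avoid both. The order of the constants is forced. A row at
  offset less than \<open>R\<close> from a frozen site has at most \<open>D\<close> backtracks over
  length \<open>L\<close>, where \<open>D\<close> grows linearly with \<open>R\<close>; with blocks
  of \<open>L\<close> times \<open>R\<close> sites the exceptional sites have density of order
  \<open>1 / R + D / L\<close>. So \<open>R\<close> is fixed before \<open>L\<close>, and
  \<open>M\<close> after both: some coordinate of a point on the sphere must have absolute value at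
  least \<open>L\<close>, whence \<open>M\<close> is at least \<open>CARD('d) * L\<close>. Adjacent
  parallel rows need a second axis, which is where dimension two enters. An insertion forgets the
  values in a ball, so many configurations may be mapped to one. Weighting each insertion by the
  inverse of the number of fillings of a ball compensates for this and still leaves an exponential
  gain.\<close>

definition l1norm :: "int ^ 'd \<Rightarrow> nat" where
  "l1norm i = nat (\<Sum>k\<in>UNIV. \<bar>i $ k\<bar>)"

lemma int_l1norm: "int (l1norm i) = (\<Sum>k\<in>UNIV. \<bar>i $ k\<bar>)"
  unfolding l1norm_def by (simp add: sum_nonneg)

lemma lattice_adj_iff: "lattice_adj i j \<longleftrightarrow> l1norm (i - j) = 1"
proof -
  have "lattice_adj i j \<longleftrightarrow> int (l1norm (i - j)) = 1"
    by (simp add: int_l1norm lattice_adj_def)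
  then show ?thesis by simp
qed

lemma l1norm_0 [simp]: "l1norm 0 = 0"
  by (simp add: l1norm_def)

lemma l1norm_eq_0 [simp]: "l1norm i = 0 \<longleftrightarrow> i = 0"
proof -
  have "l1norm i = 0 \<longleftrightarrow> (\<Sum>k\<in>UNIV. \<bar>i $ k\<bar>) = 0"
    by (metis int_l1norm of_nat_0_eq_iff)
  then show ?thesis by (simp add: sum_nonneg_eq_0_iff vec_eq_iff)
qed

lemma l1norm_minus [simp]: "l1norm (- i) = l1norm i"
  by (simp add: l1norm_def)

lemma l1norm_minus_commute: "l1norm (i - j) = l1norm (j - i)"
  by (simp add: l1norm_def abs_minus_commute)

lemma l1norm_triangle: "l1norm (i + j) \<le> l1norm i + l1norm j"
proof -
  have "int (l1norm (i + j)) \<le> int (l1norm i) + int (l1norm j)"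
    unfolding int_l1norm sum.distrib[symmetric] by (rule sum_mono) simp
  then show ?thesis by simp
qed

lemma l1norm_add_axis: "int (l1norm (i + axis k a)) = int (l1norm i) - \<bar>i $ k\<bar> + \<bar>i $ k + a\<bar>"
proof -
  have "(\<Sum>m\<in>UNIV. \<bar>(i + axis k a) $ m\<bar>) =
        \<bar>i $ k + a\<bar> + (\<Sum>m\<in>UNIV - {k}. \<bar>(i + axis k a) $ m\<bar>)"
    by (subst sum.remove[of _ k]) (auto simp: axis_def)
  also have "(\<Sum>m\<in>UNIV - {k}. \<bar>(i + axis k a) $ m\<bar>) = (\<Sum>m\<in>UNIV - {k}. \<bar>i $ m\<bar>)"
    by (rule sum.cong) (auto simp: axis_def)
  also have "\<dots> = (\<Sum>m\<in>UNIV. \<bar>i $ m\<bar>) - \<bar>i $ k\<bar>"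
    by (subst (2) sum.remove[of _ k]) auto
  finally show ?thesis by (simp add: int_l1norm)
qed

lemma l1norm_axis [simp]: "l1norm (axis k a) = nat \<bar>a\<bar>"
  using l1norm_add_axis[of 0 k a] by simp

lemma lattice_adj_sym: "lattice_adj i j \<longleftrightarrow> lattice_adj j i"
  by (simp add: lattice_adj_iff l1norm_minus_commute)

lemma lattice_adj_add_axis [intro]: "\<bar>s\<bar> = 1 \<Longrightarrow> lattice_adj i (i + axis k s)"
  by (simp add: lattice_adj_iff)

lemma lattice_adj_diff [simp]: "lattice_adj (i - c) (j - c) \<longleftrightarrow> lattice_adj i j"
  by (simp add: lattice_adj_def)

lemma lattice_adj_add [simp]: "lattice_adj (c + i) (c + j) \<longleftrightarrow> lattice_adj i j"
  by (simp add: lattice_adj_def)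

lemma lattice_adjE:
  assumes "lattice_adj i j"
  obtains k s where "\<bar>s\<bar> = 1" "j = i + axis k s"
proof -
  have "(\<Sum>k\<in>UNIV. \<bar>(j - i) $ k\<bar>) = 1"
    using assms by (simp add: lattice_adj_def abs_minus_commute)
  then have "int (\<Sum>k\<in>UNIV. nat \<bar>(j - i) $ k\<bar>) = int 1"
    by simp
  then have "(\<Sum>k\<in>UNIV. nat \<bar>(j - i) $ k\<bar>) = 1"
    by (simp only: of_nat_eq_iff)
  then have "\<exists>k. nat \<bar>(j - i) $ k\<bar> = 1 \<and> (\<forall>m. k \<noteq> m \<longrightarrow> nat \<bar>(j - i) $ m\<bar> = 0)"
    by (subst (asm) sum_eq_1_iff) auto
  then obtain k where k: "nat \<bar>(j - i) $ k\<bar> = 1" "\<And>m. m \<noteq> k \<Longrightarrow> nat \<bar>(j - i) $ m\<bar> = 0"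
    by metis
  have "j = i + axis k ((j - i) $ k)"
    using k(2) by (auto simp: vec_eq_iff axis_def)
  moreover have "\<bar>(j - i) $ k\<bar> = 1" using k(1) by linarith
  ultimately show ?thesis using that by blast
qed

text \<open>A unit step changes one coordinate by one, so the distance to the origin never stays the
  same: the lattice is bipartite.\<close>

lemma lattice_adj_l1norm:
  assumes "lattice_adj i j"
  shows "l1norm j = Suc (l1norm i) \<or> l1norm i = Suc (l1norm j)"
proof -
  obtain k s where "\<bar>s\<bar> = 1" "j = i + axis k s" using assms by (rule lattice_adjE)
  moreover from this have "s = 1 \<or> s = -1" by linarith
  ultimately show ?thesis using l1norm_add_axis[of i k s] by (auto simp: abs_if split: if_splits)
qed

lemma lattice_adj_l1norm_diff:
  "lattice_adj i j \<Longrightarrow> l1norm (j - c) = Suc (l1norm (i - c)) \<or> l1norm (i - c) = Suc (l1norm (j - c))"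
  using lattice_adj_l1norm[of "i - c" "j - c"] by simp

text \<open>Any nonzero coordinate of \<open>i - c\<close> can be moved one unit towards zero. This
  is the induction step of the arguments on the distance to a site.\<close>

lemma closer_neighbour:
  assumes "l1norm (i - c) = Suc n"
  obtains j where "lattice_adj i j" "l1norm (j - c) = n"
proof -
  have "i - c \<noteq> 0" using assms by (metis l1norm_0 nat.distinct(1))
  then obtain k where k: "(i - c) $ k \<noteq> 0" by (auto simp: vec_eq_iff)
  define s where "s = - sgn ((i - c) $ k)"
  have s: "\<bar>s\<bar> = 1" using k by (simp add: s_def abs_sgn_eq)
  have "int (l1norm (i + axis k s - c)) = int n"
    using l1norm_add_axis[of "i - c" k s] assms k unfolding s_def
    by (auto simp: sgn_if algebra_simps split: if_splits)
  then show ?thesis using that[of "i + axis k s"] s by auto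
qed

lemma lattice_lipschitz:
  fixes \<rho> :: "int ^ 'd \<Rightarrow> int"
  assumes "\<And>i j. lattice_adj i j \<Longrightarrow> \<bar>\<rho> i - \<rho> j\<bar> \<le> 1"
  shows "\<bar>\<rho> i - \<rho> j\<bar> \<le> int (l1norm (i - j))"
proof (induction "l1norm (i - j)" arbitrary: i)
  case 0
  then show ?case by simp
next
  case (Suc n)
  obtain i' where i': "lattice_adj i i'" "l1norm (i' - j) = n"
    using closer_neighbour[OF Suc.hyps(2)[symmetric]] by blast
  have "\<bar>\<rho> i' - \<rho> j\<bar> \<le> int n" using Suc.hyps(1)[of i'] i'(2) by simp
  then show ?case using assms[OF i'(1)] Suc.hyps(2) by linarith
qed

lemma abs_component_le_l1norm: "\<bar>i $ k\<bar> \<le> int (l1norm i)"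
  unfolding int_l1norm by (rule member_le_sum) auto

lemma l1norm_le_CARD:
  assumes "\<And>k. \<bar>i $ k\<bar> \<le> int m"
  shows "l1norm (i :: int ^ 'd) \<le> CARD('d) * m"
proof -
  have "int (l1norm i) \<le> (\<Sum>k\<in>(UNIV :: 'd set). int m)"
    unfolding int_l1norm using assms by (intro sum_mono) simp
  then have "int (l1norm i) \<le> int (CARD('d) * m)" by simp
  then show ?thesis by (simp only: of_nat_le_iff)
qed

section \<open>Boxes and cubes of lattice points\<close>

definition vec_box :: "('d \<Rightarrow> int set) \<Rightarrow> (int ^ 'd) set" where
  "vec_box F = {i. \<forall>k. i $ k \<in> F k}"

lemma vec_box_eq_image: "vec_box F = (\<lambda>f. \<chi> k. f k) ` PiE UNIV F"
proof (intro equalityI subsetI)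
  fix i assume "i \<in> vec_box F"
  then have "(\<lambda>k. i $ k) \<in> PiE UNIV F" by (auto simp: vec_box_def)
  moreover have "i = (\<chi> k. i $ k)" by (simp add: vec_eq_iff)
  ultimately show "i \<in> (\<lambda>f. \<chi> k. f k) ` PiE UNIV F" by blast
qed (auto simp: vec_box_def)

lemma card_vec_box: "card (vec_box F) = (\<Prod>k\<in>UNIV. card (F k))"
proof -
  have "inj_on (\<lambda>f. \<chi> k. f k) (PiE UNIV F)"
    by (auto intro!: inj_onI simp: vec_eq_iff)
  then show ?thesis unfolding vec_box_eq_image by (simp add: card_image card_PiE)
qed

lemma finite_vec_box: "(\<And>k. finite (F k)) \<Longrightarrow> finite (vec_box F)"
  unfolding vec_box_eq_image by (intro finite_imageI finite_PiE) auto

lemma finite_l1norm_le: "finite {i :: int ^ 'd. l1norm (i - c) \<le> n}"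
proof (rule finite_subset)
  show "{i. l1norm (i - c) \<le> n} \<subseteq> vec_box (\<lambda>k. {c $ k - int n .. c $ k + int n})"
  proof
    fix i :: "int ^ 'd" assume "i \<in> {i. l1norm (i - c) \<le> n}"
    then have *: "int (l1norm (i - c)) \<le> int n" by simp
    have "i $ k \<in> {c $ k - int n .. c $ k + int n}" for k
      using abs_component_le_l1norm[of "i - c" k] * unfolding vector_minus_component atLeastAtMost_iff
      by linarith
    then show "i \<in> vec_box (\<lambda>k. {c $ k - int n .. c $ k + int n})"
      by (simp add: vec_box_def)
  qed
qed (auto intro: finite_vec_box)

definition cube :: "nat \<Rightarrow> (int ^ 'd) set" where
  "cube m = vec_box (\<lambda>_. {0..<int m})"

lemma card_cube: "card (cube m :: (int ^ 'd) set) = m ^ CARD('d)"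
  by (simp add: cube_def card_vec_box)

lemma finite_cube [simp]: "finite (cube m)"
  by (simp add: cube_def finite_vec_box)

lemma mem_cube: "i \<in> cube m \<longleftrightarrow> (\<forall>k. 0 \<le> i $ k \<and> i $ k < int m)"
  by (simp add: cube_def vec_box_def)

section \<open>Lifts to the universal cover\<close>

text \<open>
  A vertex of the universal cover is a non-backtracking walk, stored with its current vertex first
  and its base point last; removing the head is the step towards the root of the tree,
  and the depth is the length minus one.
\<close>

locale hom_graph =
  fixes E :: "'a \<Rightarrow> 'a \<Rightarrow> bool"
  assumes sym: "E a b \<Longrightarrow> E b a"
    and square: "\<lbrakk>E a b; E b c; E c d; E d a\<rbrakk> \<Longrightarrow> a = c \<or> b = d"
begin

definition homs :: "(int ^ 'd \<Rightarrow> 'a) set" where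
  "homs = {x. \<forall>i j. lattice_adj i j \<longrightarrow> E (x i) (x j)}"

lemma homsD: "x \<in> homs \<Longrightarrow> lattice_adj i j \<Longrightarrow> E (x i) (x j)"
  by (auto simp: homs_def)

definition reduced_walk :: "'a list \<Rightarrow> bool" where
  "reduced_walk w \<longleftrightarrow> w \<noteq> [] \<and> (\<forall>n. Suc n < length w \<longrightarrow> E (w ! n) (w ! Suc n)) \<and>
     (\<forall>n. Suc (Suc n) < length w \<longrightarrow> w ! n \<noteq> w ! Suc (Suc n))"

lemma reduced_walk_singleton [simp]: "reduced_walk [v]"
  by (simp add: reduced_walk_def)

lemma reduced_walk_Cons:
  assumes "reduced_walk w" "E v (hd w)" "tl w \<noteq> [] \<Longrightarrow> hd (tl w) \<noteq> v"
  shows "reduced_walk (v # w)"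
proof -
  have "w \<noteq> []" using assms by (simp add: reduced_walk_def)
  have "E ((v # w) ! n) ((v # w) ! Suc n)" if "Suc n < length (v # w)" for n
    using assms that \<open>w \<noteq> []\<close> by (cases n) (auto simp: reduced_walk_def hd_conv_nth)
  moreover have "(v # w) ! n \<noteq> (v # w) ! Suc (Suc n)" if "Suc (Suc n) < length (v # w)" for n
  proof (cases n)
    case 0
    then have "tl w \<noteq> []" using that by (cases w) auto
    have "1 < length w" using that 0 by simp
    then have "hd (tl w) = w ! 1" using \<open>tl w \<noteq> []\<close> by (simp add: hd_conv_nth nth_tl)
    then show ?thesis using assms(3)[OF \<open>tl w \<noteq> []\<close>] 0 by simp
  qed (use assms that in \<open>auto simp: reduced_walk_def\<close>)
  ultimately show ?thesis by (simp add: reduced_walk_def)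
qed

lemma reduced_walk_tl:
  assumes "reduced_walk w" "tl w \<noteq> []"
  shows "reduced_walk (tl w)"
  using assms unfolding reduced_walk_def by (auto simp: nth_tl)

text \<open>The move in the tree over the edge from \<open>hd w\<close> to \<open>v\<close>; the
  cancellation keeps walks reduced, so that each vertex of the tree has a single name.\<close>

definition step :: "'a \<Rightarrow> 'a list \<Rightarrow> 'a list" where
  "step v w = (if tl w \<noteq> [] \<and> hd (tl w) = v then tl w else v # w)"

lemma reduced_walk_step:
  assumes "reduced_walk w" "E v (hd w)"
  shows "reduced_walk (step v w)" "hd (step v w) = v" "last (step v w) = last w"
proof -
  have "w \<noteq> []" using assms by (simp add: reduced_walk_def)
  then show "hd (step v w) = v" "last (step v w) = last w"
    by (auto simp: step_def last_tl)
  show "reduced_walk (step v w)"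
    using assms by (auto simp: step_def intro: reduced_walk_Cons reduced_walk_tl)
qed

text \<open>Moves in the tree are reversible. After a cancellation, returning to \<open>hd w\<close>
  prolongs the walk again, since a second cancellation would mean that \<open>w\<close>
  backtracks.\<close>

lemma step_back:
  assumes "reduced_walk w"
  shows "step (hd w) (step v w) = w"
proof -
  have "w \<noteq> []" using assms by (simp add: reduced_walk_def)
  have "hd (tl (tl w)) \<noteq> hd w" if ne: "tl (tl w) \<noteq> []"
  proof -
    obtain a b c r where "w = a # b # c # r"
      using ne by (cases w; cases "tl w"; cases "tl (tl w)") auto
    then show ?thesis using assms unfolding reduced_walk_def
      by (auto dest!: spec[of _ 0])
  qed
  then show ?thesis using \<open>w \<noteq> []\<close> by (auto simp: step_def)
qed

text \<open>Two vertices of the tree are adjacent iff one walk is the tail of the other, so this is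
  a homomorphism into the tree that \<open>hd\<close> projects to \<open>x\<close>. The base point
  \<open>u\<close> need not be a value of \<open>x\<close>.\<close>

definition is_lift :: "(int ^ 'd \<Rightarrow> 'a) \<Rightarrow> 'a \<Rightarrow> (int ^ 'd \<Rightarrow> 'a list) \<Rightarrow> bool" where
  "is_lift x u f \<longleftrightarrow>
     (\<forall>j. reduced_walk (f j) \<and> hd (f j) = x j \<and> last (f j) = u) \<and>
     (\<forall>i j. lattice_adj i j \<longrightarrow> tl (f i) = f j \<or> tl (f j) = f i)"

fun lift_aux :: "(int ^ 'd \<Rightarrow> 'a) \<Rightarrow> nat \<Rightarrow> int ^ 'd \<Rightarrow> 'a list" where
  "lift_aux x 0 j = [x j]"
| "lift_aux x (Suc n) j = step (x j) (lift_aux x n (SOME i. lattice_adj j i \<and> l1norm i = n))"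

text \<open>On one axis only one direction decreases the distance, so \<open>i\<close> and
  \<open>i'\<close> arise from \<open>j\<close> by steps along different axes. Taking both steps
  leads to the fourth corner \<open>p\<close> of a square.\<close>

lemma common_closer_neighbour:
  assumes "lattice_adj j i" "lattice_adj j i'" "i \<noteq> i'"
    and "l1norm i = Suc n" "l1norm i' = Suc n" "l1norm j = Suc (Suc n)"
  obtains p where "lattice_adj i p" "lattice_adj i' p" "l1norm p = n"
proof -
  obtain k s where ks: "\<bar>s\<bar> = 1" "i = j + axis k s" using assms(1) by (rule lattice_adjE)
  obtain k' s' where ks': "\<bar>s'\<bar> = 1" "i' = j + axis k' s'" using assms(2) by (rule lattice_adjE)
  have 1: "\<bar>j $ k + s\<bar> = \<bar>j $ k\<bar> - 1" using l1norm_add_axis[of j k s] assms(4,6) ks(2) by simp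
  have 2: "\<bar>j $ k' + s'\<bar> = \<bar>j $ k'\<bar> - 1" using l1norm_add_axis[of j k' s'] assms(5,6) ks'(2) by simp
  have "k \<noteq> k'"
  proof
    assume "k = k'"
    with 1 2 ks(1) ks'(1) have "s = s'" by (auto simp: abs_if split: if_splits)
    then show False using \<open>k = k'\<close> assms(3) ks ks' by simp
  qed
  then have "i $ k' = j $ k'" by (simp add: ks axis_def)
  then have "int (l1norm (i + axis k' s')) = int n"
    using l1norm_add_axis[of i k' s'] 2 assms(4) by simp
  moreover have "i + axis k' s' = i' + axis k s" by (simp add: ks ks')
  ultimately show ?thesis
    using that[of "i + axis k' s'"] ks(1) ks'(1) by (metis lattice_adj_add_axis of_nat_eq_iff)
qed

text \<open>The lift is well defined: the neighbour picked by \<open>SOME\<close> does not matter.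
  Two choices \<open>i\<close>, \<open>i'\<close> form a square with \<open>j\<close> and a site
  \<open>p\<close> still closer to the origin, and by \<open>square\<close> either
  \<open>x j = x p\<close>, so both candidates fold back to the lift at \<open>p\<close>, or
  \<open>x i = x i'\<close>, so they come from the same walk.\<close>

lemma lift_aux:
  assumes "x \<in> homs" "l1norm j = n"
  shows "reduced_walk (lift_aux x n j) \<and> hd (lift_aux x n j) = x j \<and> last (lift_aux x n j) = x 0 \<and>
    (\<forall>i m. n = Suc m \<longrightarrow> lattice_adj j i \<longrightarrow> l1norm i = m \<longrightarrow>
       lift_aux x n j = step (x j) (lift_aux x m i))"
  using assms(2)
proof (induction n arbitrary: j rule: less_induct)
  case (less n)
  show ?case
  proof (cases n)
    case 0
    then show ?thesis using less.prems by simp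
  next
    case (Suc m)
    define i where "i = (SOME i. lattice_adj j i \<and> l1norm i = m)"
    have "\<exists>i. lattice_adj j i \<and> l1norm i = m"
      using closer_neighbour[of j 0 m] less.prems Suc by auto
    then have i: "lattice_adj j i" "l1norm i = m"
      unfolding i_def by (metis (mono_tags, lifting) someI_ex)+
    have eq: "lift_aux x n j = step (x j) (lift_aux x m i)"
      by (simp add: i_def Suc)
    have IH: "reduced_walk (lift_aux x m i)" "hd (lift_aux x m i) = x i"
      "last (lift_aux x m i) = x 0"
      using less.IH[OF _ i(2)] Suc by auto
    have "E (x j) (x i)" using homsD[OF assms(1) i(1)] .
    moreover have "step (x j) (lift_aux x m i) = step (x j) (lift_aux x m i')"
      if i': "lattice_adj j i'" "l1norm i' = m" for i'
    proof (cases "i = i'")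
      case False
      have "m \<noteq> 0" using False i(2) i'(2) l1norm_eq_0 by metis
      then obtain q where q: "m = Suc q" by (cases m) auto
      obtain p where p: "lattice_adj i p" "lattice_adj i' p" "l1norm p = q"
        using common_closer_neighbour[OF i(1) i'(1) False, of q] i(2) i'(2) less.prems q Suc by auto
      have w: "lift_aux x m i = step (x i) (lift_aux x q p)"
        "lift_aux x m i' = step (x i') (lift_aux x q p)"
        using less.IH[OF _ i(2)] less.IH[OF _ i'(2)] p q Suc by blast+
      have "hd (lift_aux x q p) = x p" "reduced_walk (lift_aux x q p)"
        using less.IH[OF _ p(3)] q Suc by auto
      moreover have "x j = x p \<or> x i = x i'"
        using square[of "x j" "x i" "x p" "x i'"] homsD[OF assms(1)] i(1) i'(1) p(1,2) sym
        by metis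
      ultimately show ?thesis unfolding w by (metis step_back)
    qed simp
    ultimately show ?thesis
      unfolding eq using IH reduced_walk_step[of "lift_aux x m i" "x j"] Suc by auto
  qed
qed

lemma ex_lift:
  assumes "x \<in> homs"
  obtains f where "is_lift x (x 0) f" "f 0 = [x 0]"
proof -
  define f where "f j = lift_aux x (l1norm j) j" for j
  have further: "f j = step (x j) (f i)" if "lattice_adj i j" "l1norm j = Suc (l1norm i)" for i j
    using lift_aux[OF assms that(2)] that unfolding f_def by (metis lattice_adj_sym)
  have step_tl: "tl (step v w) = w \<or> tl w = step v w" for v w
    by (auto simp: step_def)
  have "tl (f i) = f j \<or> tl (f j) = f i" if "lattice_adj i j" for i j
    using lattice_adj_l1norm[OF that] further[of i j] further[of j i] that step_tl
    by (metis lattice_adj_sym)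
  then have "is_lift x (x 0) f"
    using lift_aux[OF assms] by (auto simp: is_lift_def f_def)
  then show ?thesis using that[of f] by (simp add: f_def)
qed

section \<open>Change of the base point, at the far end of the walk\<close>

definition reroot :: "'a \<Rightarrow> 'a list \<Rightarrow> 'a list" where
  "reroot v w = (if 2 \<le> length w \<and> w ! (length w - 2) = v then butlast w else w @ [v])"

lemma reduced_walk_reroot:
  assumes "reduced_walk w" "E (last w) v"
  shows "reduced_walk (reroot v w)" "hd (reroot v w) = hd w" "last (reroot v w) = v"
proof -
  have "w \<noteq> []" using assms by (simp add: reduced_walk_def)
  show "hd (reroot v w) = hd w"
    using \<open>w \<noteq> []\<close> by (cases w; cases "tl w") (auto simp: reroot_def)
  show "last (reroot v w) = v"
  proof (cases "2 \<le> length w \<and> w ! (length w - 2) = v")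
    case True
    then have "butlast w \<noteq> []" by (cases w; cases "tl w") auto
    then have "last (butlast w) = butlast w ! (length w - 2)"
      by (simp add: last_conv_nth numeral_2_eq_2)
    also have "\<dots> = w ! (length w - 2)"
      using True by (intro nth_butlast) auto
    finally have "last (butlast w) = v" using True by simp
    then show ?thesis using True by (simp add: reroot_def)
  qed (auto simp: reroot_def)
  show "reduced_walk (reroot v w)"
  proof (cases "2 \<le> length w \<and> w ! (length w - 2) = v")
    case True
    then have "butlast w \<noteq> []" by (cases w; cases "tl w") auto
    then show ?thesis
      using True assms by (auto simp: reduced_walk_def reroot_def nth_butlast)
  next
    case False
    have "E ((w @ [v]) ! n) ((w @ [v]) ! Suc n)" if "Suc n < length (w @ [v])" for n
    proof (cases "Suc n < length w")
      case True
      then show ?thesis using assms(1) by (simp add: reduced_walk_def nth_append)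
    next
      case False
      then have "n = length w - 1" using that by simp
      then show ?thesis using assms(2) \<open>w \<noteq> []\<close> by (simp add: nth_append last_conv_nth)
    qed
    moreover have "(w @ [v]) ! n \<noteq> (w @ [v]) ! Suc (Suc n)" if "Suc (Suc n) < length (w @ [v])" for n
    proof (cases "Suc (Suc n) < length w")
      case True
      then show ?thesis using assms(1) by (simp add: reduced_walk_def nth_append)
    next
      case c: False
      then have n: "Suc (Suc n) = length w" "n = length w - 2" using that by simp_all
      then have "(w @ [v]) ! n = w ! (length w - 2)" "(w @ [v]) ! Suc (Suc n) = v" "2 \<le> length w"
        by (simp_all add: nth_append)
      then show ?thesis using False by metis
    qed
    ultimately have "reduced_walk (w @ [v])" by (simp add: reduced_walk_def)
    moreover have "reroot v w = w @ [v]" unfolding reroot_def using False by (rule if_not_P)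
    ultimately show ?thesis by simp
  qed
qed

lemma is_liftD:
  assumes "is_lift x u f"
  shows "reduced_walk (f j)" "hd (f j) = x j" "last (f j) = u" "f j \<noteq> []"
    "lattice_adj i j \<Longrightarrow> tl (f i) = f j \<or> tl (f j) = f i"
  using assms by (auto simp: is_lift_def reduced_walk_def)

text \<open>Rerooting preserves adjacency in the tree. Only the edge between the old and the new
  base point changes its orientation towards the root, hence the disjunction.\<close>

lemma tl_reroot:
  assumes "tl w' = w" "w \<noteq> []" "last w = u"
  shows "tl (reroot v w') = reroot v w \<or> tl (reroot v w) = reroot v w'"
proof (cases "length w \<ge> 2")
  case True
  obtain a where w': "w' = a # w" using assms by (cases w') auto
  have "(a # w) ! (length (a # w) - 2) = w ! (length w - 2)"
    using True by (cases "length w") (auto simp: nth_Cons')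
  then show ?thesis using True w' by (auto simp: reroot_def)
next
  case False
  then have "w = [u]" using assms(2,3) by (cases w) (auto simp: not_le less_Suc_eq)
  then obtain a where "w' = [a, u]" using assms by (cases w') auto
  then show ?thesis using \<open>w = [u]\<close> by (auto simp: reroot_def)
qed

lemma is_lift_reroot:
  fixes x :: "int ^ 'd \<Rightarrow> 'a"
  assumes "is_lift x u f" "E u v"
  shows "is_lift x v (\<lambda>j. reroot v (f j))"
proof -
  have "reduced_walk (reroot v (f j)) \<and> hd (reroot v (f j)) = x j \<and> last (reroot v (f j)) = v" for j
    using reduced_walk_reroot[of "f j" v] is_liftD(1-3)[OF assms(1), of j] assms(2) by simp
  moreover have "tl (reroot v (f i)) = reroot v (f j) \<or> tl (reroot v (f j)) = reroot v (f i)"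
    if "lattice_adj i j" for i j
    using is_liftD(5)[OF assms(1) that]
  proof
    assume "tl (f i) = f j"
    from tl_reroot[OF this is_liftD(4)[OF assms(1)] is_liftD(3)[OF assms(1)]]
    show ?thesis by metis
  next
    assume "tl (f j) = f i"
    from tl_reroot[OF this is_liftD(4)[OF assms(1)] is_liftD(3)[OF assms(1)]]
    show ?thesis by metis
  qed
  ultimately show ?thesis by (simp add: is_lift_def)
qed

section \<open>Depth of a lift and branches at the root\<close>

lemma is_lift_length_adj:
  assumes "is_lift x u f" "lattice_adj i j"
  shows "length (f i) = Suc (length (f j)) \<or> length (f j) = Suc (length (f i))"
proof -
  have "tl (f i) = f j \<or> tl (f j) = f i" using is_liftD(5)[OF assms] .
  moreover have "f i \<noteq> []" "f j \<noteq> []" using is_liftD(4)[OF assms(1)] by auto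
  ultimately show ?thesis by (cases "f i"; cases "f j") auto
qed

lemma is_lift_lipschitz:
  assumes "is_lift x u f"
  shows "\<bar>int (length (f i)) - int (length (f j))\<bar> \<le> int (l1norm (i - j))"
  using is_lift_length_adj[OF assms]
  by (intro lattice_lipschitz[of "\<lambda>i. int (length (f i))"]) fastforce

text \<open>Depth and distance to \<open>c\<close> both change by exactly one along an edge. In
  particular, depths on a sphere around \<open>c\<close> all have the same parity.\<close>

lemma is_lift_parity:
  assumes "is_lift x u f"
  shows "even (length (f i) + l1norm (i - c)) = even (length (f j) + l1norm (j - c))"
proof -
  have step: "even (length (f i) + l1norm (i - c)) = even (length (f j) + l1norm (j - c))"
    if "lattice_adj i j" for i j
    using is_lift_length_adj[OF assms that] lattice_adj_l1norm_diff[OF that, of c] by auto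
  have "even (length (f i) + l1norm (i - c)) = even (length (f c) + l1norm (c - c))" for i
  proof (induction "l1norm (i - c)" arbitrary: i)
    case 0
    then show ?case by simp
  next
    case (Suc n)
    obtain i' where "lattice_adj i i'" "l1norm (i' - c) = n"
      using closer_neighbour[OF Suc.hyps(2)[symmetric]] by blast
    then show ?case using Suc.hyps(1)[of i'] step by metis
  qed
  then show ?thesis by metis
qed

text \<open>The entry before the base point names the branch at the root; it can change only when
  the lift passes through the root, where the walk has length one.\<close>

lemma is_lift_branch:
  assumes "is_lift x u f" "lattice_adj i j" "2 \<le> length (f i)" "2 \<le> length (f j)"
  shows "f i ! (length (f i) - 2) = f j ! (length (f j) - 2)"
proof -
  have *: "w' ! (length w' - 2) = w ! (length w - 2)" if w: "tl w' = w" "2 \<le> length w" for w w' :: "'a list"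
  proof -
    obtain a where "w' = a # w" using w by (cases w') auto
    then show ?thesis using w(2) by (cases "length w") (auto simp: nth_Cons')
  qed
  from is_liftD(5)[OF assms(1,2)] show ?thesis
    by (elim disjE) (use * assms(3,4) in \<open>simp_all add: *\<close>)
qed

text \<open>A path between two different branches at the root passes through the root.\<close>

lemma is_lift_separation:
  assumes "is_lift x u f" "2 \<le> length (f j)" "2 \<le> length (f i)"
    and "f i ! (length (f i) - 2) \<noteq> f j ! (length (f j) - 2)"
  shows "length (f i) + length (f j) \<le> l1norm (i - j) + 2"
  using assms(3,4)
proof (induction "l1norm (i - j)" arbitrary: i)
  case 0
  then show ?case by simp
next
  case (Suc n)
  obtain i' where i': "lattice_adj i i'" "l1norm (i' - j) = n"
    using closer_neighbour[OF Suc.hyps(2)[symmetric]] by blast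
  have len: "length (f i) \<le> Suc (length (f i'))" using is_lift_length_adj[OF assms(1) i'(1)] by auto
  show ?case
  proof (cases "2 \<le> length (f i')")
    case True
    then have "length (f i') + length (f j) \<le> l1norm (i' - j) + 2"
      using Suc.hyps(1)[of i'] i' Suc.prems is_lift_branch[OF assms(1) i'(1)] by metis
    then show ?thesis using len i' Suc.hyps(2) by simp
  next
    case False
    moreover have "0 < length (f i')" using is_liftD(4)[OF assms(1)] by simp
    ultimately have "length (f i') = 1" by linarith
    then show ?thesis using is_lift_lipschitz[OF assms(1), of i' j] len i' Suc.hyps(2) by simp
  qed
qed

text \<open>Indices are counted from the base point: the entry at depth \<open>n\<close> is taken,
  and natural subtraction yields the head if the walk is shallower. Both lists are thus cut to
  prescribed depths, which is how a lift is contracted.\<close>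

lemma truncation_adj:
  assumes w: "reduced_walk w'" "tl w' = w" "w \<noteq> []"
    and n: "n' = Suc n \<or> n = Suc n'" "even (length w - 1) = even n"
  shows "E (w' ! (length w' - 1 - n')) (w ! (length w - 1 - n))"
proof -
  obtain a where w': "w' = a # w" using w by (cases w') auto
  have len: "length w' = Suc (length w)" by (simp add: w')
  have nth: "w ! m = w' ! Suc m" for m by (simp add: w')
  have adj: "E (w' ! m) (w' ! Suc m)" "E (w' ! Suc m) (w' ! m)" if "Suc m < length w'" for m
    using w(1) that sym by (auto simp: reduced_walk_def)
  obtain l where l: "length w = Suc l" using w(3) by (cases w) auto
  \<comment> \<open>The missing case \<open>n = Suc l\<close> with \<open>n = Suc n'\<close> is
    excluded by parity; there both truncations would be the head of \<open>w\<close>.\<close>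
  consider "n' = Suc n" | "n = Suc n'" "n \<le> l" | "n = Suc n'" "n > Suc l"
    using n l by (metis Suc_lessI diff_Suc_1 even_Suc not_less)
  then show ?thesis
  proof cases
    case 1
    then show ?thesis using adj(1)[of "l - n"] len l by (simp add: nth)
  next
    case 2
    then have "Suc l - n' = Suc (Suc (l - n))" by simp
    then show ?thesis using adj(2)[of "Suc (l - n)"] 2 len l by (simp add: nth)
  next
    case 3
    then show ?thesis using adj(1)[of 0] len l by (simp add: nth)
  qed
qed

lemma is_lift_truncation_adj:
  assumes "is_lift x u f" "lattice_adj i j" "n' = Suc n \<or> n = Suc n'"
    and "even (length (f i) - 1) = even n"
  shows "E (f i ! (length (f i) - 1 - n)) (f j ! (length (f j) - 1 - n'))"
proof -
  have par: "even (length (f j) - 1) = even n'"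
    using is_lift_length_adj[OF assms(1,2)] is_liftD(4)[OF assms(1)] assms(3,4)
    by (metis One_nat_def Suc_diff_1 diff_Suc_1 even_Suc length_greater_0_conv)
  from is_liftD(5)[OF assms(1,2)] consider "tl (f i) = f j" | "tl (f j) = f i" by blast
  then show ?thesis
  proof cases
    case 1
    then show ?thesis
      using truncation_adj[OF is_liftD(1)[OF assms(1)] 1 is_liftD(4)[OF assms(1)], of n n']
        assms(3) par by blast
  next
    case 2
    then show ?thesis
      using truncation_adj[OF is_liftD(1)[OF assms(1)] 2 is_liftD(4)[OF assms(1)], of n' n]
        assms(3,4) sym by blast
  qed
qed

text \<open>Every step towards the root costs two in the final length compared with full speed, so
  there are at most \<open>D / 2\<close> of them. Two consecutive steps away from the root have
  different heads at their ends, so a backtrack at \<open>t\<close> has a step towards the root at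
  \<open>t\<close> or \<open>Suc t\<close>.\<close>

lemma card_backtracks:
  fixes g :: "nat \<Rightarrow> 'a list"
  assumes "\<And>t. t < L \<Longrightarrow> tl (g t) = g (Suc t) \<or> tl (g (Suc t)) = g t"
    and red: "\<And>t. t \<le> L \<Longrightarrow> reduced_walk (g t)"
    and grow: "length (g 0) + L \<le> length (g L) + D"
  shows "card {t. Suc t < L \<and> hd (g t) = hd (g (Suc (Suc t)))} \<le> D"
proof -
  define down where "down m = {t. t < m \<and> tl (g t) = g (Suc t)}" for m
  have ne: "g t \<noteq> []" if "t \<le> L" for t using red[OF that] by (simp add: reduced_walk_def)
  have fin: "finite (down m)" for m by (simp add: down_def)
  have "length (g m) + 2 * card (down m) = length (g 0) + m" if "m \<le> L" for m
    using that
  proof (induction m)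
    case 0
    then show ?case by (simp add: down_def)
  next
    case (Suc m)
    have IH: "length (g m) + 2 * card (down m) = length (g 0) + m" using Suc by simp
    show ?case
    proof (cases "tl (g m) = g (Suc m)")
      case True
      then have "down (Suc m) = insert m (down m)" by (auto simp: down_def less_Suc_eq)
      moreover have "m \<notin> down m" by (simp add: down_def)
      ultimately have "card (down (Suc m)) = Suc (card (down m))" using fin by simp
      moreover have "length (g m) = Suc (length (g (Suc m)))"
        using True ne[of m] Suc.prems by (cases "g m") auto
      ultimately show ?thesis using IH by simp
    next
      case False
      then have "down (Suc m) = down m" by (auto simp: down_def less_Suc_eq)
      moreover have "tl (g (Suc m)) = g m" using False assms(1)[of m] Suc.prems by auto
      then have "length (g (Suc m)) = Suc (length (g m))"
        using ne[of "Suc m"] Suc.prems by (cases "g (Suc m)") auto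
      ultimately show ?thesis using IH by simp
    qed
  qed
  from this[of L] have "2 * card (down L) \<le> D" using grow by simp
  moreover have "{t. Suc t < L \<and> hd (g t) = hd (g (Suc (Suc t)))} \<subseteq> down L \<union> {t. Suc t \<in> down L}"
  proof
    fix t assume "t \<in> {t. Suc t < L \<and> hd (g t) = hd (g (Suc (Suc t)))}"
    then have t: "Suc t < L" "hd (g t) = hd (g (Suc (Suc t)))" by auto
    show "t \<in> down L \<union> {t. Suc t \<in> down L}"
    proof (rule ccontr)
      assume "t \<notin> down L \<union> {t. Suc t \<in> down L}"
      then have "tl (g (Suc t)) = g t" "tl (g (Suc (Suc t))) = g (Suc t)"
        using t(1) assms(1)[of t] assms(1)[of "Suc t"] by (auto simp: down_def)
      then obtain a b r where "g (Suc (Suc t)) = a # b # g t" "g (Suc t) = b # g t"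
        using ne[of "Suc t"] ne[of "Suc (Suc t)"] t(1) by (cases "g (Suc t)"; cases "g (Suc (Suc t))") auto
      moreover obtain c r where "g t = c # r" using ne[of t] t(1) by (cases "g t") auto
      ultimately have "\<not> reduced_walk (g (Suc (Suc t)))"
        using t(2) by (auto simp: reduced_walk_def intro!: exI[of _ 0])
      then show False using red[of "Suc (Suc t)"] t(1) by simp
    qed
  qed
  moreover have "card {t. Suc t \<in> down L} \<le> card (down L)"
    by (rule card_inj_on_le[of Suc]) (auto simp: fin)
  moreover have "finite {t. Suc t \<in> down L}"
    by (rule finite_subset[of _ "{..<L}"]) (auto simp: down_def)
  ultimately show ?thesis
    using card_mono[of "down L \<union> {t. Suc t \<in> down L}"] card_Un_le[of "down L" "{t. Suc t \<in> down L}"] fin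
    by (smt (verit) finite_UnI le_trans mult_2 add_le_mono le_refl)
qed

end

section \<open>Replaceable and frozen sites\<close>

definition agrees_near :: "nat \<Rightarrow> int ^ 'd \<Rightarrow> (int ^ 'd \<Rightarrow> 'a) \<Rightarrow> (int ^ 'd \<Rightarrow> 'a) \<Rightarrow> bool" where
  "agrees_near k c x z \<longleftrightarrow> (\<forall>j. l1norm j \<le> k \<longrightarrow> x (c + j) = z j)"

text \<open>Only values of \<open>x\<close> occur, no lift, because the coding below works with
  values. Equality at distance two is the visible trace of a step of the lift towards the root. All
  rows at offset below \<open>R\<close> along \<open>l\<close> are included so that one frozen site
  serves a whole block.\<close>

definition frozen ::
    "nat \<Rightarrow> nat \<Rightarrow> nat \<Rightarrow> (int ^ 'd \<Rightarrow> 'a) \<Rightarrow> int ^ 'd \<Rightarrow> 'd \<Rightarrow> int \<Rightarrow> 'd \<Rightarrow> bool" where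
  "frozen L R D x c k s l \<longleftrightarrow> (\<forall>r. \<bar>r\<bar> < int R \<longrightarrow>
     card {t. Suc t < L \<and> x (c + axis l r + axis k (s * int t)) =
                          x (c + axis l r + axis k (s * int (t + 2)))} \<le> D)"

context hom_graph
begin

text \<open>\<open>Z\<close> is a set for reasons of parity: it will consist of \<open>z\<close> and
  a unit translate of \<open>z\<close>.\<close>

definition replaceable ::
    "nat \<Rightarrow> nat \<Rightarrow> (int ^ 'd \<Rightarrow> 'a) set \<Rightarrow> (int ^ 'd \<Rightarrow> 'a) \<Rightarrow> int ^ 'd \<Rightarrow> bool" where
  "replaceable M k Z x c \<longleftrightarrow>
     (\<exists>z\<in>Z. \<exists>x'\<in>homs. (\<forall>j. M \<le> l1norm (j - c) \<longrightarrow> x' j = x j) \<and> agrees_near k c x' z)"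

text \<open>
  Moving inwards from the sphere of radius \<open>M\<close>, the lift \<open>f\<close> is contracted to its root \<open>u\<close>, then
  the values follow a walk from \<open>u\<close> to \<open>z 0\<close>, and finally the lift of \<open>z\<close> is expanded from its root.
\<close>

lemma replacement:
  fixes x z :: "int ^ 'd \<Rightarrow> 'a"
  assumes x: "x \<in> homs" and f: "is_lift x u f" and z: "z \<in> homs" and k: "1 \<le> k"
    and bound: "\<And>j. l1norm (j - c) = M \<Longrightarrow> length (f j) \<le> Suc r"
    and rM: "r \<le> M" "2 * k \<le> M - r"
    and parity: "even (length (f c) - 1) = even (M - r)"
    and walk: "(E ^^ (M - r - 2 * k)) (z 0) u"
  obtains x' where "x' \<in> homs" "\<And>j. M \<le> l1norm (j - c) \<Longrightarrow> x' j = x j" "agrees_near k c x' z"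
proof -
  obtain g where g: "is_lift z (z 0) g" "g 0 = [z 0]" using ex_lift[OF z] .
  obtain p where p: "p 0 = z 0" "p (M - r - 2 * k) = u"
    "\<And>i. i < M - r - 2 * k \<Longrightarrow> E (p i) (p (Suc i))"
    using walk unfolding relpowp_fun_conv by blast
  \<comment> \<open>\<open>A\<close> cuts the lift \<open>f\<close> to depth
    \<open>n - (M - r)\<close> and \<open>C\<close> cuts the lift \<open>g\<close> of the translated
    \<open>z\<close> to depth \<open>2 * k - n\<close>.\<close>
  define A where "A n j = f j ! (length (f j) - 1 - (n - (M - r)))" for n j
  define B where "B n = p (n - 2 * k)" for n
  define C where "C n j = g (j - c) ! (length (g (j - c)) - 1 - (2 * k - n))" for n j
  define x' where "x' j = (let n = l1norm (j - c) in
     if M \<le> n then x j else if M - r \<le> n then A n j else if 2 * k \<le> n then B n else C n j)" for j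
  \<comment> \<open>Where two layers meet both formulas give the same value, so the two ends of an
    edge can always be described by one formula.\<close>
  have AM: "A M j = x j" if "l1norm (j - c) = M" for j
    using bound[OF that] rM(1) is_liftD(2,4)[OF f, of j] by (simp add: A_def hd_conv_nth)
  have AB: "A (M - r) j = B (M - r)" for j
    using is_liftD(3,4)[OF f, of j] p(2) by (simp add: A_def B_def last_conv_nth)
  have BC: "B (2 * k) = C (2 * k) j" for j
    using is_liftD(3,4)[OF g(1), of "j - c"] p(1) by (simp add: B_def C_def last_conv_nth)
  have eqx: "x' j = x j" if "M \<le> l1norm (j - c)" for j using that by (simp add: x'_def)
  have eqA: "x' j = A (l1norm (j - c)) j" if "M - r \<le> l1norm (j - c)" "l1norm (j - c) \<le> M" for j
    using that AM[of j] by (auto simp: x'_def Let_def)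
  have eqB: "x' j = B (l1norm (j - c))" if "2 * k \<le> l1norm (j - c)" "l1norm (j - c) \<le> M - r" for j
    using that eqA[of j] AB[of j] rM(1) by (cases "l1norm (j - c) = M - r") (auto simp: x'_def Let_def)
  have eqC: "x' j = C (l1norm (j - c)) j" if "l1norm (j - c) \<le> 2 * k" for j
    using that eqB[of j] BC[of j] rM by (cases "l1norm (j - c) = 2 * k") (auto simp: x'_def Let_def)
  have parf: "even (length (f j) - 1) = even (l1norm (j - c) - (M - r))" if "M - r \<le> l1norm (j - c)" for j
  proof -
    have "even (length (f j) + l1norm (j - c)) = even (length (f c))"
      using is_lift_parity[OF f, of j c c] by simp
    then show ?thesis
      using parity that is_liftD(4)[OF f, of j] is_liftD(4)[OF f, of c] by auto
  qed
  have parg: "even (length (g (j - c)) - 1) = even (2 * k - l1norm (j - c))"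
    if "l1norm (j - c) \<le> 2 * k" for j
  proof -
    have "even (length (g (j - c)) + l1norm (j - c)) = even (length (g 0))"
      using is_lift_parity[OF g(1), of "j - c" 0 0] by simp
    then show ?thesis
      using that g(2) is_liftD(4)[OF g(1), of "j - c"] by auto
  qed
  have outward: "E (x' i) (x' j)"
    if adj: "lattice_adj i j" and n: "l1norm (j - c) = Suc (l1norm (i - c))" for i j
  proof -
    define n where "n = l1norm (i - c)"
    have nj: "l1norm (j - c) = Suc n" using n n_def by simp
    consider "M \<le> n" | "M - r \<le> n" "n < M" | "2 * k \<le> n" "n < M - r" | "n < 2 * k" by linarith
    then show ?thesis
    proof cases
      case 1
      then show ?thesis using eqx[of i] eqx[of j] homsD[OF x adj] nj n_def by simp
    next
      case 2
      have "Suc n - (M - r) = Suc (n - (M - r))" using 2 by simp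
      then have "E (A n i) (A (Suc n) j)"
        unfolding A_def using 2 parf[of i] n_def by (intro is_lift_truncation_adj[OF f adj]) auto
      then show ?thesis using eqA[of i] eqA[of j] 2 nj n_def by simp
    next
      case 3
      have "E (B n) (B (Suc n))"
        unfolding B_def using 3 p(3)[of "n - 2 * k"] by (simp add: Suc_diff_le)
      then show ?thesis using eqB[of i] eqB[of j] 3 nj n_def by simp
    next
      case 4
      have "E (C n i) (C (Suc n) j)"
        unfolding C_def using 4 parg[of i] n_def adj
        by (intro is_lift_truncation_adj[OF g(1)]) auto
      then show ?thesis using eqC[of i] eqC[of j] 4 nj n_def by simp
    qed
  qed
  have "x' \<in> homs"
    unfolding homs_def using outward lattice_adj_l1norm_diff sym lattice_adj_sym by blast
  moreover have "agrees_near k c x' z"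
    unfolding agrees_near_def
  proof (intro allI impI)
    fix j :: "int ^ 'd" assume j: "l1norm j \<le> k"
    \<comment> \<open>The depth is at most \<open>l1norm j \<le> k \<le> 2 * k - l1norm j\<close>,
      so nothing is cut off here. This is why the expansion of \<open>z\<close> starts at distance
      \<open>2 * k\<close>.\<close>
    have "length (g j) \<le> Suc (l1norm j)"
      using is_lift_lipschitz[OF g(1), of j 0] g(2) by simp
    then have "C (l1norm j) (c + j) = z j"
      using j is_liftD(2,4)[OF g(1), of j] by (simp add: C_def hd_conv_nth)
    then show "x' (c + j) = z j" using eqC[of "c + j"] j by simp
  qed
  ultimately show ?thesis using that eqx by blast
qed

text \<open>Since \<open>M\<close> is at least \<open>CARD('d) * L\<close>, some coordinate of
  \<open>j - c\<close> has absolute value at least \<open>L\<close>. The site \<open>c'\<close>,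
  \<open>L\<close> steps from \<open>c\<close> along this axis, lies on a shortest path to
  \<open>j\<close>, so the Lipschitz bound makes the lift almost \<open>L\<close> deeper at
  \<open>c'\<close> than at \<open>c\<close>. Passing to a parallel row changes both depths by less
  than \<open>R\<close>.\<close>

lemma frozen_if_deep:
  fixes x :: "int ^ 'd \<Rightarrow> 'a"
  assumes f: "is_lift x u f" and L: "1 \<le> L" "CARD('d) * L \<le> M"
    and j: "l1norm (j - c) = M" "length (f j) = Suc r" "M < r + R0" "length (f c) \<le> Suc R0"
  obtains k s where "\<bar>s\<bar> = 1" "\<And>l. frozen L R (2 * R0 + 2 * R) x c k s l"
proof -
  have "\<exists>k. int L \<le> \<bar>(j - c) $ k\<bar>"
  proof (rule ccontr)
    assume *: "\<not> (\<exists>k. int L \<le> \<bar>(j - c) $ k\<bar>)"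
    have "\<bar>(j - c) $ k\<bar> \<le> int (L - 1)" for k
    proof -
      have "\<not> int L \<le> \<bar>(j - c) $ k\<bar>" using * by blast
      then show ?thesis using L(1) by (simp add: of_nat_diff)
    qed
    then have "M \<le> CARD('d) * (L - 1)" using l1norm_le_CARD[of "j - c" "L - 1"] j(1) by simp
    then have "CARD('d) * L \<le> CARD('d) * (L - 1)" using L(2) by linarith
    then show False using L(1) by simp
  qed
  then obtain k where k: "int L \<le> \<bar>(j - c) $ k\<bar>" ..
  define s where "s = sgn ((j - c) $ k)"
  have s: "\<bar>s\<bar> = 1" using k L(1) by (simp add: s_def abs_sgn_eq)
  define c' where "c' = c + axis k (s * int L)"
  have eq: "j - c' = (j - c) + axis k (- (s * int L))"
    by (simp add: c'_def vec_eq_iff axis_def)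
  have "\<bar>(j - c) $ k + - (s * int L)\<bar> = \<bar>(j - c) $ k\<bar> - int L"
    using k L(1) unfolding s_def by (auto simp: sgn_if abs_if)
  then have "int (l1norm (j - c')) = int M - int L"
    unfolding eq l1norm_add_axis[of "j - c"] using j(1) by simp
  then have c': "int (length (f c')) \<ge> int L + 2 - int R0"
    using is_lift_lipschitz[OF f, of j c'] j(2,3) by linarith
  have "frozen L R (2 * R0 + 2 * R) x c k s l" for l
    unfolding frozen_def
  proof (intro allI impI)
    fix r' :: int assume r': "\<bar>r'\<bar> < int R"
    define g where "g t = f (c + axis l r' + axis k (s * int t))" for t
    have step: "lattice_adj (c + axis l r' + axis k (s * int t)) (c + axis l r' + axis k (s * int (Suc t)))" for t
    proof -
      have "c + axis l r' + axis k (s * int (Suc t)) = (c + axis l r' + axis k (s * int t)) + axis k s"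
        by (simp add: vec_eq_iff axis_def algebra_simps)
      then show ?thesis using s by (metis lattice_adj_add_axis)
    qed
    have axis_0: "axis k 0 = (0 :: int ^ 'd)" by simp
    have "int (length (g 0)) \<le> int R0 + 1 + int R"
      using is_lift_lipschitz[OF f, of "c + axis l r'" c] j(4) r'
      by (simp add: g_def axis_0)
    moreover have "int (length (g L)) \<ge> int L + 2 - int R0 - int R"
      using is_lift_lipschitz[OF f, of "c + axis l r' + axis k (s * int L)" c'] c' r'
      by (simp add: g_def c'_def)
    ultimately have "length (g 0) + L \<le> length (g L) + (2 * R0 + 2 * R)" by linarith
    then have "card {t. Suc t < L \<and> hd (g t) = hd (g (Suc (Suc t)))} \<le> 2 * R0 + 2 * R"
      using is_liftD[OF f] step unfolding g_def by (intro card_backtracks) blast+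
    then show "card {t. Suc t < L \<and> x (c + axis l r' + axis k (s * int t)) =
                 x (c + axis l r' + axis k (s * int (t + 2)))} \<le> 2 * R0 + 2 * R"
      using is_liftD(2)[OF f] by (simp add: g_def)
  qed
  then show ?thesis using that s by blast
qed

text \<open>
  A lift whose depth on the sphere of radius \<open>M\<close> is as small as possible either is shallow enough to
  be contracted, or it reaches its maximal depth in two different branches at the root, which forces
  the centre to lie close to the root.
\<close>

lemma replaceable_or_frozen:
  fixes x :: "int ^ 'd \<Rightarrow> 'a"
  assumes x: "x \<in> homs" and Z: "Z \<subseteq> homs" and k: "1 \<le> k"
    and walks: "\<And>u v n. E u v \<Longrightarrow> N \<le> n \<Longrightarrow> \<exists>z\<in>Z. (E ^^ n) (z 0) u"
    and L: "1 \<le> L" "CARD('d) * L \<le> M"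
  shows "replaceable M k Z x c \<or>
    (\<exists>k' s. \<bar>s\<bar> = 1 \<and> (\<forall>l. frozen L R (2 * (2 * k + N) + 2 * R) x c k' s l))"
proof -
  define sphere where "sphere = {j :: int ^ 'd. l1norm (j - c) = M}"
  \<comment> \<open>An edge at the root is carried along because \<open>walks\<close> asks for one;
    after rerooting, the old root provides it.\<close>
  define P where "P r \<longleftrightarrow> (\<exists>u f v. is_lift x u f \<and> E u v \<and> (\<forall>j\<in>sphere. length (f j) \<le> Suc r))" for r
  have "finite sphere"
    by (rule finite_subset[OF _ finite_l1norm_le[of c M]]) (auto simp: sphere_def)
  obtain f0 where f0: "is_lift x (x 0) f0" using ex_lift[OF x] by blast
  obtain v0 where v0: "E (x 0) v0" using homsD[OF x lattice_adj_add_axis[of 1 0]] by fastforce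
  have "P (Max (insert 0 ((\<lambda>j. length (f0 j)) ` sphere)))"
    unfolding P_def using f0 v0 \<open>finite sphere\<close>
    by (intro exI[of _ "x 0"] exI[of _ f0] exI[of _ v0]) (auto intro!: le_SucI Max_ge)
  then have "\<exists>r. P r" by blast
  define r where "r = (LEAST r. P r)"
  have "P r" unfolding r_def using \<open>\<exists>r. P r\<close> by (rule LeastI_ex)
  have minimal: "r \<le> r'" if "P r'" for r' unfolding r_def using that by (rule Least_le)
  obtain u f v where f: "is_lift x u f" and uv: "E u v" and bound: "\<And>j. j \<in> sphere \<Longrightarrow> length (f j) \<le> Suc r"
    using \<open>P r\<close> by (auto simp: P_def)
  have pos: "0 < length (f j)" for j using is_liftD(4)[OF f] by simp
  have par: "even (length (f j)) = even (length (f j'))" if "j \<in> sphere" "j' \<in> sphere" for j j'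
    using is_lift_parity[OF f, of j c j'] that by (auto simp: sphere_def)
  define top where "top = c + axis (undefined :: 'd) (int M)"
  have top: "top \<in> sphere" by (simp add: sphere_def top_def)
  \<comment> \<open>That the bound is attained fixes the parity of the depth at \<open>c\<close>,
    which the contraction requires.\<close>
  obtain j0 where j0: "j0 \<in> sphere" "length (f j0) = Suc r"
  proof (cases "r = 0")
    case True
    then show ?thesis using that[OF top] bound[OF top] pos[of top] by simp
  next
    case False
    then obtain r' where r': "r = Suc r'" by (cases r) auto
    have "\<not> P r'" using minimal[of r'] r' by auto
    then obtain j where "j \<in> sphere" "\<not> length (f j) \<le> Suc r'" using f uv by (auto simp: P_def)
    then show ?thesis using that[of j] bound[of j] r' by simp
  qed
  show ?thesis
  proof (cases "r + (2 * k + N) \<le> M")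
    case True
    then have *: "r \<le> M" "2 * k \<le> M - r" "N \<le> M - r - 2 * k" by auto
    obtain z where z: "z \<in> Z" "(E ^^ (M - r - 2 * k)) (z 0) u"
      using walks[OF uv *(3)] by blast
    have "even (length (f j0) + l1norm (j0 - c)) = even (length (f c))"
      using is_lift_parity[OF f, of j0 c c] by simp
    then have parc: "even (length (f c) - 1) = even (M - r)"
      using j0 *(1) pos[of c] by (auto simp: sphere_def)
    have zh: "z \<in> homs" using z(1) Z by blast
    have "length (f j) \<le> Suc r" if "l1norm (j - c) = M" for j
      using bound[of j] that by (simp add: sphere_def)
    from replacement[OF x f zh k this *(1,2) parc z(2)]
    obtain x' where "x' \<in> homs" "\<And>j. M \<le> l1norm (j - c) \<Longrightarrow> x' j = x j" "agrees_near k c x' z"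
      by blast
    then show ?thesis using z(1) by (auto simp: replaceable_def)
  next
    case False
    have "length (f c) \<le> Suc (2 * k + N)"
    proof (cases "r = 0 \<or> length (f c) < 2")
      case True
      then show ?thesis
      proof
        assume "r = 0"
        then have "length (f c) \<le> Suc M"
          using is_lift_lipschitz[OF f, of c j0] j0 by (simp add: sphere_def l1norm_minus_commute)
        then show ?thesis using False \<open>r = 0\<close> by simp
      qed simp
    next
      case c: False
      then obtain r' where r': "r = Suc r'" by (cases r) auto
      define b where "b j = f j ! (length (f j) - 2)" for j
      have "E u (b j0)"
      proof -
        have "E (f j0 ! (length (f j0) - 2)) (f j0 ! Suc (length (f j0) - 2))"
          using is_liftD(1)[OF f, of j0] j0(2) r' by (simp add: reduced_walk_def)
        moreover have "f j0 ! Suc (length (f j0) - 2) = u"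
          using is_liftD(3,4)[OF f, of j0] j0(2) r' by (simp add: last_conv_nth)
        ultimately show ?thesis using sym by (simp add: b_def)
      qed
      have "\<exists>j\<in>sphere. length (f j) = Suc r \<and> b j \<noteq> b j0"
      proof (rule ccontr)
        assume "\<not> ?thesis"
        then have same: "\<And>j. j \<in> sphere \<Longrightarrow> length (f j) = Suc r \<Longrightarrow> b j = b j0" by blast
        \<comment> \<open>Rerooting into the common branch lowers the maximal depth \<open>r\<close>
          by one. Elsewhere it adds at most one, but there the depth is at most \<open>r - 2\<close>
          by parity. So \<open>r\<close> would not be minimal.\<close>
        have "length (reroot (b j0) (f j)) \<le> Suc r'" if "j \<in> sphere" for j
        proof (cases "length (f j) = Suc r")
          case True
          then show ?thesis using same[OF that True] r' by (simp add: reroot_def b_def)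
        next
          case False
          then have "length (f j) < Suc r" using bound[OF that] by simp
          moreover have "even (length (f j)) = even (Suc r)" using par[OF that j0(1)] j0(2) by simp
          ultimately have "length (f j) < r" by (metis even_Suc less_Suc_eq)
          then show ?thesis using r' by (auto simp: reroot_def)
        qed
        then have "P r'"
          unfolding P_def using is_lift_reroot[OF f \<open>E u (b j0)\<close>] sym[OF \<open>E u (b j0)\<close>] by blast
        then show False using minimal[of r'] r' by simp
      qed
      then obtain j1 where j1: "j1 \<in> sphere" "length (f j1) = Suc r" "b j1 \<noteq> b j0" by blast
      then obtain j where j: "j \<in> sphere" "length (f j) = Suc r" "b j \<noteq> b c" using j0 by metis
      have "length (f c) + length (f j) \<le> l1norm (c - j) + 2"
        using is_lift_separation[OF f, of j c] j c r' by (simp add: b_def)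
      then show ?thesis
        using j False by (simp add: sphere_def l1norm_minus_commute)
    qed
    then show ?thesis
      using frozen_if_deep[OF f L, of j0 c r "2 * k + N" R] j0 False
      unfolding sphere_def by (metis (mono_tags, lifting) mem_Collect_eq not_le)
  qed
qed

end

section \<open>Counting configurations with few replaceable sites\<close>

lemma sum_power_card_Pow:
  assumes "finite U"
  shows "(\<Sum>S\<in>Pow U. q ^ card S) = (1 + q :: real) ^ card U"
  using prod_add[OF assms, of "\<lambda>_. q" "\<lambda>_. 1"] by (simp add: add.commute)

text \<open>Exponential Markov bound: every counted set has weight \<open>q ^ card S\<close> at
  least \<open>q powr \<theta>\<close>, and the weights of all subsets add up to
  \<open>(1 + q) ^ card U\<close>.\<close>

lemma card_small_subsets:
  fixes q \<theta> :: real
  assumes "finite U" "0 < q" "q \<le> 1"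
  shows "real (card {S. S \<subseteq> U \<and> real (card S) \<le> \<theta>}) \<le> (1 + q) ^ card U * q powr (- \<theta>)"
proof -
  let ?F = "{S. S \<subseteq> U \<and> real (card S) \<le> \<theta>}"
  have "real (card ?F) * q powr \<theta> = (\<Sum>S\<in>?F. q powr \<theta>)" by simp
  also have "\<dots> \<le> (\<Sum>S\<in>?F. q ^ card S)"
  proof (rule sum_mono)
    fix S assume "S \<in> ?F"
    then have "q powr \<theta> \<le> q powr (real (card S))" using assms by (intro powr_mono') auto
    then show "q powr \<theta> \<le> q ^ card S" using assms(2) by (simp add: powr_realpow)
  qed
  also have "\<dots> \<le> (\<Sum>S\<in>Pow U. q ^ card S)"
    using assms by (intro sum_mono2) auto
  finally have "real (card ?F) * q powr \<theta> \<le> (1 + q) ^ card U"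
    by (simp add: sum_power_card_Pow assms(1))
  then show ?thesis using assms(2) by (simp add: powr_minus field_simps)
qed

section \<open>Residue classes and blocks in a cube\<close>

lemma int_div_less_iff:
  fixes a n :: int
  assumes "0 < L"
  shows "a div int L < n \<longleftrightarrow> a < int L * n"
proof -
  have "n \<le> a div int L \<longleftrightarrow> int L * n \<le> a"
  proof
    assume "n \<le> a div int L"
    then have "int L * n \<le> int L * (a div int L)" by (intro mult_left_mono) auto
    moreover have "0 \<le> a mod int L" using assms by simp
    ultimately show "int L * n \<le> a" using mult_div_mod_eq[of "int L" a] by linarith
  next
    assume "int L * n \<le> a"
    then show "n \<le> a div int L" using zdiv_mono1[of "int L * n" a "int L"] assms by simp
  qed
  then show ?thesis by linarith
qed

lemma card_multiples:
  assumes "L dvd m" "0 < L" "a < L"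
  shows "card {j \<in> {0..<int m}. j mod int L = int a} * L = m"
proof -
  obtain n where m: "m = L * n" using assms(1) by blast
  have "{j \<in> {0..<int m}. j mod int L = int a} = (\<lambda>q. int L * int q + int a) ` {..<n}"
  proof (intro equalityI subsetI)
    fix j assume j: "j \<in> {j \<in> {0..<int m}. j mod int L = int a}"
    then have "0 \<le> j div int L" "j div int L < int n"
      using assms(2) m by (auto simp: pos_imp_zdiv_nonneg_iff int_div_less_iff)
    moreover have "j = int L * (j div int L) + int a" using j by (metis (mono_tags, lifting) mem_Collect_eq mult_div_mod_eq)
    ultimately show "j \<in> (\<lambda>q. int L * int q + int a) ` {..<n}"
      by (intro image_eqI[of _ _ "nat (j div int L)"]) auto
  next
    fix j assume "j \<in> (\<lambda>q. int L * int q + int a) ` {..<n}"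
    then obtain q where q: "q < n" "j = int L * int q + int a" by blast
    have "L * q + a < L * Suc q" using assms(3) by simp
    also have "\<dots> \<le> m" unfolding m using q(1) by (intro mult_le_mono2) simp
    finally have "int (L * q + a) < int m" by (simp only: of_nat_less_iff)
    then show "j \<in> {j \<in> {0..<int m}. j mod int L = int a}" using q(2) assms(3) by auto
  qed
  moreover have "inj_on (\<lambda>q. int L * int q + int a) {..<n}"
    using assms(2) by (auto simp: inj_on_def)
  ultimately show ?thesis by (simp add: card_image m)
qed

lemma card_cube_residue:
  assumes "L dvd m" "0 < L" "a < L"
  shows "card {i \<in> (cube m :: (int ^ 'd) set). i $ k mod int L = int a} * L = m ^ CARD('d)"
proof -
  define F where "F k' = {j \<in> {0..<int m}. k' = k \<longrightarrow> j mod int L = int a}" for k'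
  have "{i \<in> (cube m :: (int ^ 'd) set). i $ k mod int L = int a} = vec_box F"
    by (auto simp: mem_cube vec_box_def F_def)
  then have "card {i \<in> (cube m :: (int ^ 'd) set). i $ k mod int L = int a} = (\<Prod>k'\<in>UNIV. card (F k'))"
    by (simp add: card_vec_box)
  also have "\<dots> = card (F k) * (\<Prod>k'\<in>UNIV - {k}. card (F k'))"
    by (rule prod.remove) auto
  also have "(\<Prod>k'\<in>UNIV - {k}. card (F k')) = (\<Prod>k'\<in>UNIV - {k}. m)"
  proof (rule prod.cong)
    fix k' assume "k' \<in> UNIV - {k}"
    then have "F k' = {0..<int m}" by (auto simp: F_def)
    then show "card (F k') = m" by simp
  qed simp
  also have "\<dots> = m ^ (CARD('d) - 1)" by simp
  finally have "card {i \<in> (cube m :: (int ^ 'd) set). i $ k mod int L = int a} * L =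
      (card (F k) * L) * m ^ (CARD('d) - 1)" by simp
  also have "card (F k) * L = m" using card_multiples[OF assms] by (simp add: F_def)
  also have "m * m ^ (CARD('d) - 1) = m ^ CARD('d)" by (simp flip: power_Suc)
  finally show ?thesis .
qed

text \<open>For different axes \<open>k\<close> and \<open>l\<close>, blocks are two-dimensional
  rectangles with all other coordinates fixed; they tile a cube whose side is a multiple of
  \<open>L\<close> and of \<open>R\<close>.\<close>

definition same_block :: "nat \<Rightarrow> nat \<Rightarrow> 'd \<Rightarrow> 'd \<Rightarrow> int ^ 'd \<Rightarrow> int ^ 'd \<Rightarrow> bool" where
  "same_block L R k l i j \<longleftrightarrow> i $ k div int L = j $ k div int L \<and> i $ l div int R = j $ l div int R \<and>
     (\<forall>m. m \<noteq> k \<longrightarrow> m \<noteq> l \<longrightarrow> i $ m = j $ m)"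

lemma same_block_refl [simp]: "same_block L R k l i i"
  by (simp add: same_block_def)

lemma same_block_sym: "same_block L R k l i j \<Longrightarrow> same_block L R k l j i"
  by (simp add: same_block_def)

lemma same_block_trans: "same_block L R k l i j \<Longrightarrow> same_block L R k l j h \<Longrightarrow> same_block L R k l i h"
  by (simp add: same_block_def)

lemma div_eq_bounds:
  fixes a b :: int
  assumes "a div int L = b div int L" "L dvd m" "0 < L" "0 \<le> a" "a < int m"
  shows "0 \<le> b" "b < int m"
proof -
  obtain n where m: "m = L * n" using assms(2) by blast
  have "0 \<le> b div int L" using assms by (metis of_nat_0_less_iff pos_imp_zdiv_nonneg_iff)
  then show "0 \<le> b" using assms(3) by (simp add: pos_imp_zdiv_nonneg_iff)
  have "a div int L < int n" using assms(3,5) m by (simp add: int_div_less_iff)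
  then show "b < int m" using assms(1,3) m by (simp add: int_div_less_iff)
qed

lemma same_block_cube:
  assumes "same_block L R k l i j" "L dvd m" "R dvd m" "0 < L" "0 < R" "i \<in> cube m"
  shows "j \<in> cube m"
  unfolding mem_cube
proof
  fix h
  have i: "0 \<le> i $ h" "i $ h < int m" using assms(6) by (auto simp: mem_cube)
  consider "h = k" | "h = l" | "h \<noteq> k" "h \<noteq> l" by blast
  then show "0 \<le> j $ h \<and> j $ h < int m"
  proof cases
    case 1
    then have "i $ h div int L = j $ h div int L" using assms(1) by (simp add: same_block_def)
    from div_eq_bounds[OF this assms(2,4) i] show ?thesis by simp
  next
    case 2
    then have "i $ h div int R = j $ h div int R" using assms(1) by (simp add: same_block_def)
    from div_eq_bounds[OF this assms(3,5) i] show ?thesis by simp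
  next
    case 3
    then show ?thesis using assms(1) i by (simp add: same_block_def)
  qed
qed

lemma div_eq_diff_less:
  fixes a b :: int
  assumes "a div int L = b div int L" "0 < L"
  shows "\<bar>a - b\<bar> < int L"
proof -
  have "a - b = a mod int L - b mod int L"
    using assms(1) by (metis add_diff_cancel_left mult_div_mod_eq)
  moreover have "0 \<le> a mod int L" "a mod int L < int L" "0 \<le> b mod int L" "b mod int L < int L"
    using assms(2) by auto
  ultimately show ?thesis by linarith
qed

lemma div_shift_eq:
  fixes a s :: int
  assumes "0 < L" "\<bar>s\<bar> = 1" "a mod int L \<noteq> 0" "a mod int L \<noteq> int L - 1"
  shows "(a + s) div int L = a div int L"
proof -
  have m: "0 \<le> a mod int L" "a mod int L < int L" using assms(1) by auto
  have "a + s = (a mod int L + s) + int L * (a div int L)" by simp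
  also have "\<dots> div int L = (a mod int L + s) div int L + a div int L"
    using assms(1) by (subst div_mult_self2) auto
  also have "(a mod int L + s) div int L = 0"
    using m assms by (intro div_pos_pos_trivial) linarith+
  finally show ?thesis by simp
qed

lemma div_pred_eq:
  fixes a :: int
  assumes "0 < R" "a mod int R \<noteq> 0"
  shows "(a - 1) div int R = a div int R" "(a - 1) mod int R = a mod int R - 1"
proof -
  have m: "0 \<le> a mod int R" "a mod int R < int R" using assms(1) by auto
  have eq: "a - 1 = (a mod int R - 1) + int R * (a div int R)" by simp
  have "(a - 1) div int R = (a mod int R - 1) div int R + a div int R"
    by (subst eq, subst div_mult_self2) (use assms(1) in auto)
  moreover have "(a mod int R - 1) div int R = 0"
    using m assms by (intro div_pos_pos_trivial) linarith+
  ultimately show 1: "(a - 1) div int R = a div int R" by simp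
  show "(a - 1) mod int R = a mod int R - 1"
    using 1 by (simp add: minus_div_mult_eq_mod[symmetric])
qed

text \<open>
  In a block, the sites beyond a frozen site in direction \<open>s\<close> of axis \<open>k\<close> are covered. By
  \<open>square\<close>, every unit square between two adjacent rows is of one of two types; along a row the
  type changes only where one of the two rows backtracks. So a value at a covered site is
  determined by the preceding row except at the exceptional sites, which are recorded.
\<close>

locale block_coding = hom_graph E for E :: "'a \<Rightarrow> 'a \<Rightarrow> bool" +
  fixes L R D m :: nat and oth :: "'d::finite \<Rightarrow> 'd"
  assumes LR: "0 < L" "0 < R" "L dvd m" "R dvd m" and oth: "oth k \<noteq> k"
begin

definition covered :: "(int ^ 'd \<Rightarrow> 'a) \<Rightarrow> 'd \<Rightarrow> int \<Rightarrow> int ^ 'd \<Rightarrow> bool" where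
  "covered x k s i \<longleftrightarrow> (\<exists>c. same_block L R k (oth k) c i \<and> s * c $ k \<le> s * i $ k \<and> frozen L R D x c k s (oth k))"

text \<open>The first three alternatives are the sides of the block, the fourth is the start of the
  covered part of a row, and the last two are backtracks centred at the column of \<open>i\<close>,
  in its own row and in the preceding one.\<close>

definition exceptional :: "(int ^ 'd \<Rightarrow> 'a) \<Rightarrow> 'd \<Rightarrow> int \<Rightarrow> int ^ 'd \<Rightarrow> bool" where
  "exceptional x k s i \<longleftrightarrow> covered x k s i \<and>
     (i $ oth k mod int R = 0 \<or> i $ k mod int L = 0 \<or> i $ k mod int L = int L - 1 \<or>
      \<not> covered x k s (i + axis k (- s)) \<or>
      x (i + axis k (- s)) = x (i + axis k s) \<or>
      x (i + axis (oth k) (- 1) + axis k (- s)) = x (i + axis (oth k) (- 1) + axis k s))"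

text \<open>In each unit square at least one diagonal joins equal values; the type records whether
  the diagonal avoiding \<open>i\<close> does.\<close>

definition sq_type :: "(int ^ 'd \<Rightarrow> 'a) \<Rightarrow> 'd \<Rightarrow> int \<Rightarrow> int ^ 'd \<Rightarrow> bool" where
  "sq_type x k s i \<longleftrightarrow> x (i + axis k s) = x (i + axis (oth k) (- 1))"

text \<open>The tag \<open>Some (k, s)\<close> lets the exceptional set of each direction be read
  off separately; \<open>None\<close> marks sites covered in no direction, whose values are stored
  outright.\<close>

definition code :: "(int ^ 'd \<Rightarrow> 'a) \<Rightarrow> ((int ^ 'd) \<times> ('d \<times> int) option \<times> 'a \<times> bool) set" where
  "code x =
     {(i, Some (k, s), x i, sq_type x k s i) | i k s. i \<in> cube m \<and> \<bar>s\<bar> = 1 \<and> exceptional x k s i} \<union>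
     {(i, None, x i, False) | i. i \<in> cube m \<and> (\<forall>k s. \<bar>s\<bar> = 1 \<longrightarrow> \<not> covered x k s i)}"

lemma covered_mono:
  "covered x k s i \<Longrightarrow> same_block L R k (oth k) i j \<Longrightarrow> s * i $ k \<le> s * j $ k \<Longrightarrow> covered x k s j"
  unfolding covered_def by (meson order_trans same_block_trans)

lemma code_eq_SomeD:
  assumes "code x = code y" "i \<in> cube m" "\<bar>s\<bar> = 1" "exceptional x k s i"
  shows "exceptional y k s i" "x i = y i" "sq_type x k s i = sq_type y k s i"
proof -
  have "(i, Some (k, s), x i, sq_type x k s i) \<in> code y"
    using assms unfolding assms(1)[symmetric] by (auto simp: code_def)
  then show "exceptional y k s i" "x i = y i" "sq_type x k s i = sq_type y k s i"
    by (auto simp: code_def)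
qed

lemma same_block_axis:
  assumes "\<bar>s\<bar> = 1" "i $ k mod int L \<noteq> 0" "i $ k mod int L \<noteq> int L - 1"
  shows "same_block L R k (oth k) i (i + axis k s)"
  using div_shift_eq[OF LR(1) assms] oth[of k] by (auto simp: same_block_def axis_def)

lemma same_block_oth:
  assumes "i $ oth k mod int R \<noteq> 0"
  shows "same_block L R k (oth k) i (i + axis (oth k) (- 1))"
  using div_pred_eq(1)[OF LR(2) assms] oth[of k] by (auto simp: same_block_def axis_def)

text \<open>The distance from the side of the block where a row in direction \<open>s\<close>
  begins, used as an induction measure.\<close>

definition pos :: "'d \<Rightarrow> int \<Rightarrow> int ^ 'd \<Rightarrow> nat" where
  "pos k s i = nat (if s = 1 then i $ k mod int L else int L - 1 - i $ k mod int L)"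

lemma pos_less: "pos k s i < L"
proof -
  have "0 \<le> i $ k mod int L" "i $ k mod int L < int L" using LR(1) by auto
  then show ?thesis by (auto simp: pos_def)
qed

lemma pos_pred:
  assumes "\<bar>s\<bar> = 1" "i $ k mod int L \<noteq> 0" "i $ k mod int L \<noteq> int L - 1"
  shows "pos k s (i + axis k (- s)) < pos k s i"
proof -
  have m: "0 \<le> i $ k mod int L" "i $ k mod int L < int L" using LR(1) by auto
  have d: "(i $ k + - s) div int L = i $ k div int L" using div_shift_eq[OF LR(1), of "- s"] assms by simp
  then have "(i $ k + - s) mod int L = i $ k mod int L - s"
    by (simp add: minus_div_mult_eq_mod[symmetric])
  then show ?thesis using m assms by (auto simp: pos_def axis_def abs_if split: if_splits)
qed

text \<open>A covered site is either exceptional, which the code shows, or has a covered predecessor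
  in its block. Hence \<open>sq_type_step\<close> applies to both configurations at the same
  sites.\<close>

lemma covered_transfer:
  assumes "code x = code y" "i \<in> cube m" "\<bar>s\<bar> = 1" "covered x k s i"
  shows "covered y k s i"
  using assms(2,4)
proof (induction "pos k s i" arbitrary: i rule: less_induct)
  case less
  show ?case
  proof (cases "exceptional x k s i")
    case True
    then show ?thesis using code_eq_SomeD(1)[OF assms(1) less.prems(1) assms(3)] by (simp add: exceptional_def)
  next
    case False
    then have ik: "i $ k mod int L \<noteq> 0" "i $ k mod int L \<noteq> int L - 1" "covered x k s (i + axis k (- s))"
      using less.prems(2) by (auto simp: exceptional_def)
    have sb: "same_block L R k (oth k) i (i + axis k (- s))"
      using same_block_axis[of "- s"] ik assms(3) by simp
    then have "covered y k s (i + axis k (- s))"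
      using less.hyps[OF pos_pred[OF assms(3) ik(1,2)] same_block_cube[OF sb] ik(3)] LR less.prems(1) by simp
    then show ?thesis
      using same_block_sym[OF sb] assms(3) by (elim covered_mono) (auto simp: axis_def algebra_simps abs_if split: if_splits)
  qed
qed

text \<open>Neither row backtracks at this column, so the equalities on the diagonals of the squares
  behind and ahead of \<open>i\<close> cannot be mixed. Locally, the row of \<open>i\<close> is the
  preceding row shifted by one step, forwards or backwards according to the type.\<close>

lemma sq_type_step:
  assumes x: "x \<in> homs" and s: "\<bar>s\<bar> = 1" and i: "covered x k s i" "\<not> exceptional x k s i"
  defines "b \<equiv> i + axis (oth k) (- 1)"
  shows "sq_type x k s i = sq_type x k s (i + axis k (- s))"
    and "x i = (if sq_type x k s (i + axis k (- s)) then x (b + axis k (- s)) else x (b + axis k s))"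
proof -
  define j where "j = i + axis k (- s)"
  have ji: "j + axis k s = i" "j + axis (oth k) (- 1) = b + axis k (- s)" "b + axis k (- s) + axis k s = b"
    by (simp_all add: j_def b_def vec_eq_iff axis_def)
  have bi: "b + axis (oth k) 1 = i" by (simp add: b_def vec_eq_iff axis_def)
  have ne: "x j \<noteq> x (i + axis k s)" "x (b + axis k (- s)) \<noteq> x (b + axis k s)"
    using i by (auto simp: exceptional_def j_def b_def)
  have adj: "lattice_adj p (p + axis k s)" "lattice_adj p (p + axis (oth k) (- 1))" for p
    using s by auto
  have sq: "x p = x (p + axis (oth k) (- 1) + axis k s) \<or> x (p + axis k s) = x (p + axis (oth k) (- 1))" for p
  proof (rule square)
    show "E (x p) (x (p + axis k s))" using homsD[OF x adj(1)] .
    have swap: "p + axis (oth k) (- 1) + axis k s = p + axis k s + axis (oth k) (- 1)"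
      by (simp add: add.assoc add.commute)
    show "E (x (p + axis k s)) (x (p + axis (oth k) (- 1) + axis k s))"
      unfolding swap using homsD[OF x adj(2)] .
    show "E (x (p + axis (oth k) (- 1) + axis k s)) (x (p + axis (oth k) (- 1)))"
      using sym[OF homsD[OF x adj(1)]] .
    show "E (x (p + axis (oth k) (- 1))) (x p)" using sym[OF homsD[OF x adj(2)]] .
  qed
  have tj: "sq_type x k s j \<longleftrightarrow> x i = x (b + axis k (- s))" by (simp add: sq_type_def ji)
  have ti: "sq_type x k s i \<longleftrightarrow> x (i + axis k s) = x b" by (simp add: sq_type_def b_def)
  have sqi: "x i = x (b + axis k s) \<or> x (i + axis k s) = x b" using sq[of i] by (simp add: b_def)
  have sqj: "x j = x b \<or> x i = x (b + axis k (- s))" using sq[of j] by (simp add: ji)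
  show "sq_type x k s i = sq_type x k s (i + axis k (- s))"
    using ne sqi sqj ti tj unfolding j_def[symmetric] by metis
  then show "x i = (if sq_type x k s (i + axis k (- s)) then x (b + axis k (- s)) else x (b + axis k s))"
    using ne sqi sqj ti tj unfolding j_def[symmetric] by metis
qed

text \<open>Lexicographic induction on the row within the block and then on \<open>pos\<close>,
  which is below \<open>L\<close>. The site \<open>b + axis k s\<close> lies ahead of
  \<open>i\<close> but in an earlier row, so its value is already known.\<close>

lemma covered_determined:
  assumes x: "x \<in> homs" and y: "y \<in> homs" and eq: "code x = code y" and s: "\<bar>s\<bar> = 1"
    and "i \<in> cube m" "covered x k s i"
  shows "x i = y i \<and> sq_type x k s i = sq_type y k s i"
  using assms(5,6)
proof (induction "nat (i $ oth k mod int R) * L + pos k s i" arbitrary: i rule: less_induct)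
  case less
  show ?case
  proof (cases "exceptional x k s i")
    case True
    then show ?thesis using code_eq_SomeD[OF eq less.prems(1) s] by simp
  next
    case False
    have y_cov: "covered y k s i" using covered_transfer[OF eq less.prems(1) s less.prems(2)] .
    have y_exc: "\<not> exceptional y k s i" using code_eq_SomeD(1)[OF eq[symmetric] less.prems(1) s] False by blast
    define b where "b = i + axis (oth k) (- 1)"
    define j where "j = i + axis k (- s)"
    have ik: "i $ oth k mod int R \<noteq> 0" "i $ k mod int L \<noteq> 0" "i $ k mod int L \<noteq> int L - 1" "covered x k s j"
      using less.prems(2) False by (auto simp: exceptional_def j_def)
    have sbj: "same_block L R k (oth k) i j"
      unfolding j_def using same_block_axis[of "- s"] ik s by simp
    have sbb: "same_block L R k (oth k) i b"
      unfolding b_def using same_block_oth ik by simp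
    have bk: "b $ k = i $ k" using oth[of k] by (simp add: b_def axis_def)
    have sbb': "same_block L R k (oth k) i (b + axis k s')" if "\<bar>s'\<bar> = 1" for s'
      using same_block_axis[OF that, of b k] sbb bk ik same_block_trans by metis
    have oth_j: "j $ oth k = i $ oth k" using oth[of k] by (simp add: j_def axis_def)
    have "pos k s j < pos k s i" unfolding j_def using pos_pred[OF s] ik by simp
    then have "nat (j $ oth k mod int R) * L + pos k s j < nat (i $ oth k mod int R) * L + pos k s i"
      by (simp add: oth_j)
    from less.hyps[OF this same_block_cube[OF sbj] ik(4)]
    have IHj: "sq_type x k s j = sq_type y k s j" using LR less.prems(1) by simp
    have row: "nat ((b + axis k s') $ oth k mod int R) * L + pos k s (b + axis k s') <
        nat (i $ oth k mod int R) * L + pos k s i" for s'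
    proof -
      have "(b + axis k s') $ oth k = i $ oth k - 1" using oth[of k] by (simp add: b_def axis_def)
      then have "(b + axis k s') $ oth k mod int R = i $ oth k mod int R - 1"
        using div_pred_eq(2)[OF LR(2) ik(1)] by simp
      moreover have "0 \<le> i $ oth k mod int R" using LR(2) by simp
      ultimately have "nat (i $ oth k mod int R) = Suc (nat ((b + axis k s') $ oth k mod int R))"
        using ik(1) by linarith
      then show ?thesis using pos_less[of k s "b + axis k s'"] by simp
    qed
    have IHb: "x (b + axis k s') = y (b + axis k s')" if "s' = s \<or> s' = - s" for s'
    proof -
      have s': "\<bar>s'\<bar> = 1" using that s by auto
      \<comment> \<open>Being covered passes to all rows of the block and forwards along
        \<open>s\<close>, hence from \<open>j\<close> to both sites of the preceding row.\<close>
      have "s * j $ k \<le> s * (b + axis k s') $ k"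
        using that s bk by (auto simp: j_def axis_def algebra_simps abs_if split: if_splits)
      then have "covered x k s (b + axis k s')"
        using covered_mono[OF ik(4) same_block_trans[OF same_block_sym[OF sbj] sbb'[OF s']]] by simp
      then show ?thesis using less.hyps[OF row same_block_cube[OF sbb'[OF s']]] LR less.prems(1) by simp
    qed
    show ?thesis
      using sq_type_step[OF x s less.prems(2) False] sq_type_step[OF y s y_cov y_exc] IHj IHb
      unfolding b_def[symmetric] j_def[symmetric] by simp
  qed
qed

lemma code_determines:
  assumes x: "x \<in> homs" and y: "y \<in> homs" and eq: "code x = code y" and i: "i \<in> cube m"
  shows "x i = y i"
proof (cases "\<exists>k s. \<bar>s\<bar> = 1 \<and> covered x k s i")
  case True
  then show ?thesis using covered_determined[OF x y eq _ i] by blast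
next
  case False
  then have "(i, None, x i, False) \<in> code y"
    unfolding eq[symmetric] using i by (auto simp: code_def)
  then show ?thesis by (auto simp: code_def)
qed

text \<open>Let a frozen site \<open>c\<close> cover the first covered site of the row starting at
  \<open>b\<close>. No covered site of the row lies behind \<open>c\<close>, so only the site level
  with \<open>c\<close> can have an uncovered predecessor; the others come from backtracks in two
  rows, at most \<open>D\<close> in each.\<close>

lemma card_segment:
  assumes s: "\<bar>s\<bar> = 1"
  shows "card {i. i - axis k (i $ k mod int L) = b \<and> covered x k s i \<and> i $ oth k mod int R \<noteq> 0 \<and>
      (\<not> covered x k s (i + axis k (- s)) \<or> x (i + axis k (- s)) = x (i + axis k s) \<or>
       x (i + axis (oth k) (- 1) + axis k (- s)) = x (i + axis (oth k) (- 1) + axis k s))} \<le> 1 + 2 * D"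
    (is "card ?S \<le> _")
proof (cases "?S = {}")
  case True
  then show ?thesis by (metis card.empty le0)
next
  case False
  define I where "I = {i. i - axis k (i $ k mod int L) = b \<and> covered x k s i}"
  have "\<exists>i. i \<in> I" using False by (auto simp: I_def)
  then obtain i0 where i0: "i0 \<in> I" "\<And>i. i \<in> I \<Longrightarrow> pos k s i0 \<le> pos k s i"
    using ex_has_least_nat[of "\<lambda>i. i \<in> I" _ "pos k s"] by blast
  obtain c where c: "same_block L R k (oth k) c i0" "s * c $ k \<le> s * i0 $ k" "frozen L R D x c k s (oth k)"
    using i0(1) by (auto simp: I_def covered_def)
  define r where "r = b $ oth k - c $ oth k"
  define \<phi> where "\<phi> r t = c + axis (oth k) r + axis k (s * int t)" for r t
  define T where "T r = {t. Suc t < L \<and> x (\<phi> r t) = x (\<phi> r (t + 2))}" for r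
  have cardT: "card (T r') \<le> D" if "\<bar>r'\<bar> < int R" for r'
    using c(3) that unfolding frozen_def T_def \<phi>_def by blast
  have finT: "finite (T r')" for r'
    by (rule finite_subset[of _ "{..<L}"]) (auto simp: T_def)
  have same: "same_block L R k (oth k) c i" "i $ k div int L = c $ k div int L" "s * c $ k \<le> s * i $ k"
    "\<forall>h. h \<noteq> k \<longrightarrow> i $ h = b $ h"
    if "i \<in> I" for i
  proof -
    have base: "i $ h - (if h = k then i $ k mod int L else 0) = b $ h" if "i \<in> I" for h i
      using that by (auto simp: I_def axis_def)
    have ne: "i $ h = b $ h" if "h \<noteq> k" "i \<in> I" for h i using base[OF that(2), of h] that(1) by simp
    then show "\<forall>h. h \<noteq> k \<longrightarrow> i $ h = b $ h" using that by blast
    have bk: "i $ k - i $ k mod int L = b $ k" if "i \<in> I" for i using base[OF that, of k] by simp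
    then have "int L * (i $ k div int L) = b $ k" if "i \<in> I" for i
      using that by (simp add: minus_mod_eq_mult_div)
    then have "int L * (i $ k div int L) = int L * (i0 $ k div int L)" using that i0(1) by metis
    then have dk: "i $ k div int L = i0 $ k div int L" using LR(1) by simp
    have sb: "same_block L R k (oth k) i0 i"
      unfolding same_block_def using ne[OF _ that] ne[OF _ i0(1)] dk oth[of k] by simp
    then show "same_block L R k (oth k) c i" using c(1) same_block_trans by blast
    then show "i $ k div int L = c $ k div int L" by (simp add: same_block_def)
    define p where "p = i $ k mod int L"
    define p0 where "p0 = i0 $ k mod int L"
    have m: "0 \<le> p" "p < int L" "0 \<le> p0" "p0 < int L" using LR(1) by (auto simp: p_def p0_def)
    have diff: "i $ k - p = i0 $ k - p0"
      using bk[OF that] bk[OF i0(1)] by (simp add: p_def p0_def)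
    have "pos k s i0 \<le> pos k s i" using i0(2)[OF that] .
    then have "(if s = 1 then p0 \<le> p else p \<le> p0)"
      using m by (auto simp: pos_def simp flip: p_def p0_def)
    then have "s * i0 $ k \<le> s * i $ k"
      using s diff by (auto simp: abs_if split: if_splits)
    then show "s * c $ k \<le> s * i $ k" using c(2) by simp
  qed
  have SI: "?S \<subseteq> I" by (auto simp: I_def)
  obtain i1 where i1: "i1 \<in> ?S" using False by blast
  \<comment> \<open>As \<open>i1\<close> is not in the first row of its block, the preceding row
    also lies in the block, and \<open>frozen\<close> controls both.\<close>
  have r: "\<bar>r\<bar> < int R" "\<bar>r - 1\<bar> < int R"
  proof -
    have i1I: "i1 \<in> I" using i1 SI by (rule rev_subsetD)
    have i1k: "i1 $ oth k = b $ oth k" using same(4)[OF i1I] oth[of k] by blast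
    have "c $ oth k div int R = i1 $ oth k div int R"
      using same(1)[OF i1I] unfolding same_block_def by (elim conjE)
    then have d: "b $ oth k div int R = c $ oth k div int R" by (simp only: i1k)
    then show "\<bar>r\<bar> < int R" unfolding r_def using div_eq_diff_less LR(2) by blast
    have "i1 $ oth k mod int R \<noteq> 0" using i1 by (simp only: mem_Collect_eq not_False_eq_True)
    then have "b $ oth k mod int R \<noteq> 0" by (simp only: i1k not_False_eq_True)
    then have "(b $ oth k - 1) div int R = c $ oth k div int R" using div_pred_eq(1) LR(2) d by simp
    then have "\<bar>(b $ oth k - 1) - c $ oth k\<bar> < int R" using div_eq_diff_less LR(2) by blast
    then show "\<bar>r - 1\<bar> < int R" by (simp add: r_def algebra_simps)
  qed
  have "?S \<subseteq> \<phi> r ` (insert 0 (Suc ` T r \<union> Suc ` T (r - 1)))"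
  proof
    fix i assume i: "i \<in> ?S"
    then have iI: "i \<in> I" using SI by blast
    note sm = same[OF iI]
    define t where "t = nat (s * (i $ k - c $ k))"
    have t: "int t = s * (i $ k - c $ k)" using sm(3) by (simp add: t_def right_diff_distrib)
    have ss: "s * s = 1" using s by (auto simp: abs_if split: if_splits)
    then have st: "s * int t = i $ k - c $ k" by (simp add: t mult.assoc[symmetric])
    have "i = \<phi> r t"
      unfolding \<phi>_def vec_eq_iff
    proof
      fix h
      have "i $ h = c $ h" if "h \<noteq> k" "h \<noteq> oth k" using sm(1) that by (auto simp: same_block_def)
      then show "i $ h = (c + axis (oth k) r + axis k (s * int t)) $ h"
        using st sm(4) oth[of k] by (auto simp: axis_def r_def)
    qed
    have "\<bar>i $ k - c $ k\<bar> < int L" using div_eq_diff_less[OF sm(2) LR(1)] .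
    then have tL: "t < L" using t s by (auto simp: abs_if split: if_splits)
    have "t \<in> insert 0 (Suc ` T r \<union> Suc ` T (r - 1))"
    proof (cases t)
      case (Suc t')
      have shift: "\<phi> r t + axis k (- s) = \<phi> r t'" "\<phi> r t + axis k s = \<phi> r (t' + 2)"
        "\<phi> r t + axis (oth k) (- 1) + axis k (- s) = \<phi> (r - 1) t'"
        "\<phi> r t + axis (oth k) (- 1) + axis k s = \<phi> (r - 1) (t' + 2)"
        using Suc by (auto simp: \<phi>_def vec_eq_iff axis_def algebra_simps)
      have "covered x k s (i + axis k (- s))"
      proof -
        have "s * c $ k \<le> s * (i + axis k (- s)) $ k"
          using t Suc ss by (simp add: axis_def algebra_simps)
        moreover have "i + axis k (- s) = \<phi> r t'" using shift(1) \<open>i = \<phi> r t\<close> by simp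
        moreover have "same_block L R k (oth k) c (\<phi> r t')"
        proof -
          have k': "\<phi> r t' $ k = c $ k + s * int t'" using oth[of k] by (simp add: \<phi>_def axis_def)
          have tt: "int t = int t' + 1" using Suc by simp
          have "\<phi> r t' $ k div int L = c $ k div int L"
          proof (cases "s = 1")
            case True
            then have "c $ k \<le> \<phi> r t' $ k" "\<phi> r t' $ k \<le> i $ k" using k' st tt by auto
            then show ?thesis using zdiv_mono1[of _ _ "int L"] sm(2) LR(1) by (metis of_nat_0_less_iff order_antisym)
          next
            case False
            then have "\<phi> r t' $ k \<le> c $ k" "i $ k \<le> \<phi> r t' $ k" using s k' st tt by (auto simp: abs_if split: if_splits)
            then show ?thesis using zdiv_mono1[of _ _ "int L"] sm(2) LR(1) by (metis of_nat_0_less_iff order_antisym)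
          qed
          moreover have "\<phi> r t' $ h = i $ h" if "h \<noteq> k" for h
            using that unfolding \<open>i = \<phi> r t\<close> by (simp add: \<phi>_def axis_def)
          ultimately show ?thesis using sm(1) oth[of k] by (simp add: same_block_def)
        qed
        ultimately show ?thesis using c(3) by (auto simp: covered_def)
      qed
      then have "x (\<phi> r t') = x (\<phi> r (t' + 2)) \<or> x (\<phi> (r - 1) t') = x (\<phi> (r - 1) (t' + 2))"
        using i unfolding \<open>i = \<phi> r t\<close> mem_Collect_eq shift by blast
      then have "t' \<in> T r \<or> t' \<in> T (r - 1)" using tL Suc by (auto simp: T_def)
      then show ?thesis using Suc by blast
    qed simp
    then show "i \<in> \<phi> r ` (insert 0 (Suc ` T r \<union> Suc ` T (r - 1)))"
      using \<open>i = \<phi> r t\<close> by blast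
  qed
  then have "card ?S \<le> card (insert 0 (Suc ` T r \<union> Suc ` T (r - 1)))"
    using finT by (intro surj_card_le) auto
  also have "\<dots> \<le> Suc (card (Suc ` T r \<union> Suc ` T (r - 1)))"
    using finT by (intro card_insert_le_m1) auto
  also have "card (Suc ` T r \<union> Suc ` T (r - 1)) \<le> card (T r) + card (T (r - 1))"
    by (metis card_Un_le card_image inj_Suc inj_on_subset subset_UNIV)
  also have "\<dots> \<le> 2 * D" using cardT r by (simp add: add_mono mult_2)
  finally show ?thesis by simp
qed

text \<open>The share \<open>1 / R\<close> is due to the first rows of blocks, \<open>2 / L\<close>
  to first and last columns, and \<open>(1 + 2 * D) / L\<close> to \<open>card_segment\<close> on
  each row segment of length \<open>L\<close>.\<close>

lemma card_exceptional:
  assumes s: "\<bar>s\<bar> = 1"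
  shows "real (card {i \<in> cube m. exceptional x k s i}) \<le>
    (1 / real R + (3 + 2 * real D) / real L) * real (m ^ CARD('d))"
proof -
  define A where "A k a b = {i \<in> (cube m :: (int ^ 'd) set). i $ k mod int b = int a}" for k a b
  define S where "S = {i \<in> cube m. covered x k s i \<and> i $ oth k mod int R \<noteq> 0 \<and>
      (\<not> covered x k s (i + axis k (- s)) \<or> x (i + axis k (- s)) = x (i + axis k s) \<or>
       x (i + axis (oth k) (- 1) + axis k (- s)) = x (i + axis (oth k) (- 1) + axis k s))}"
  have cA: "real (card (A k a b)) = real (m ^ CARD('d)) / real b" if "b dvd m" "a < b" for k a b
  proof -
    have "card (A k a b) * b = m ^ CARD('d)"
      unfolding A_def using that by (intro card_cube_residue) auto
    then have "real (card (A k a b)) * real b = real (m ^ CARD('d))" by (metis of_nat_mult)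
    then show ?thesis using that by (simp add: field_simps)
  qed
  have fin: "finite (A k a b)" for k a b by (simp add: A_def)
  have "S \<subseteq> (\<Union>b\<in>A k 0 L. {i. i - axis k (i $ k mod int L) = b \<and> covered x k s i \<and> i $ oth k mod int R \<noteq> 0 \<and>
      (\<not> covered x k s (i + axis k (- s)) \<or> x (i + axis k (- s)) = x (i + axis k s) \<or>
       x (i + axis (oth k) (- 1) + axis k (- s)) = x (i + axis (oth k) (- 1) + axis k s))} \<inter> cube m)"
    (is "_ \<subseteq> (\<Union>b\<in>_. ?T b \<inter> _)")
  proof
    fix i assume i: "i \<in> S"
    have m: "0 \<le> i $ k mod int L" "i $ k mod int L < int L" using LR(1) by auto
    have eq: "i $ k - i $ k mod int L = int L * (i $ k div int L)" by (simp add: minus_mod_eq_mult_div)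
    have "i \<in> cube m" using i by (simp add: S_def)
    moreover have "same_block L R k (oth k) i (i - axis k (i $ k mod int L))"
      using oth[of k] eq LR(1) by (auto simp: same_block_def axis_def)
    ultimately have "i - axis k (i $ k mod int L) \<in> cube m" using same_block_cube LR by blast
    then have "i - axis k (i $ k mod int L) \<in> A k 0 L"
      using eq by (simp add: A_def axis_def)
    moreover have "i \<in> ?T (i - axis k (i $ k mod int L)) \<inter> cube m" using i by (simp add: S_def)
    ultimately show "i \<in> (\<Union>b\<in>A k 0 L. ?T b \<inter> cube m)" by blast
  qed
  then have "card S \<le> card (\<Union>b\<in>A k 0 L. ?T b \<inter> cube m)"
    using fin by (intro card_mono finite_UN_I) auto
  also have "\<dots> \<le> (\<Sum>b\<in>A k 0 L. card (?T b \<inter> cube m))" using fin by (rule card_UN_le)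
  also have "\<dots> \<le> (\<Sum>b\<in>A k 0 L. 1 + 2 * D)"
  proof (rule sum_mono)
    fix b
    have "?T b \<subseteq> (\<lambda>t. b + axis k t) ` {0..<int L}"
      using LR(1) by (auto intro!: image_eqI)
    then have "finite (?T b)" by (rule finite_subset) simp
    then have "card (?T b \<inter> cube m) \<le> card (?T b)" by (intro card_mono) auto
    then show "card (?T b \<inter> cube m) \<le> 1 + 2 * D" using card_segment[OF s, of k b x] by linarith
  qed
  finally have "card S \<le> card (A k 0 L) * (1 + 2 * D)" by simp
  then have "real (card S) \<le> real (card (A k 0 L) * (1 + 2 * D))" by (simp only: of_nat_le_iff)
  then have "real (card S) \<le> real (card (A k 0 L)) * (1 + 2 * real D)"
    by (simp add: distrib_left)
  then have cS: "real (card S) \<le> real (m ^ CARD('d)) / real L * (1 + 2 * real D)"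
    using cA[of L 0 k] LR by simp
  have "{i \<in> cube m. exceptional x k s i} \<subseteq> A (oth k) 0 R \<union> (A k 0 L \<union> (A k (L - 1) L \<union> S))"
    using LR(1) by (auto simp: exceptional_def A_def S_def of_nat_diff)
  then have "card {i \<in> cube m. exceptional x k s i} \<le> card (A (oth k) 0 R \<union> (A k 0 L \<union> (A k (L - 1) L \<union> S)))"
    using fin by (intro card_mono) (auto simp: S_def)
  then have "card {i \<in> cube m. exceptional x k s i} \<le> card (A (oth k) 0 R) + (card (A k 0 L) + (card (A k (L - 1) L) + card S))"
    by (meson card_Un_le add_left_mono order_trans)
  then have "real (card {i \<in> cube m. exceptional x k s i}) \<le>
      real (card (A (oth k) 0 R)) + (real (card (A k 0 L)) + (real (card (A k (L - 1) L)) + real (card S)))"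
    by (simp flip: of_nat_add)
  also have "\<dots> \<le> real (m ^ CARD('d)) / real R + (real (m ^ CARD('d)) / real L + (real (m ^ CARD('d)) / real L +
      real (m ^ CARD('d)) / real L * (1 + 2 * real D)))"
    using cA[of R 0 "oth k"] cA[of L 0 k] cA[of L "L - 1" k] LR cS by (intro add_mono) auto
  also have "\<dots> = (1 / real R + (3 + 2 * real D) / real L) * real (m ^ CARD('d))"
    by (simp add: add_divide_distrib algebra_simps)
  finally show ?thesis .
qed

text \<open>There are \<open>2 * CARD('d)\<close> directions. A frozen site covers itself, so a site
  covered in no direction is counted in the last term.\<close>

lemma card_code:
  "real (card (code x)) \<le>
     2 * real CARD('d) * (1 / real R + (3 + 2 * real D) / real L) * real (m ^ CARD('d)) +
     real (card {i \<in> cube m. \<forall>k s. \<bar>s\<bar> = 1 \<longrightarrow> \<not> frozen L R D x i k s (oth k)})"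
proof -
  let ?N = "{i \<in> cube m. \<forall>k s. \<bar>s\<bar> = 1 \<longrightarrow> \<not> frozen L R D x i k s (oth k)}"
  let ?X = "\<lambda>p. {i \<in> cube m. exceptional x (fst p) (snd p) i}"
  let ?P = "(UNIV :: 'd set) \<times> {1, - 1 :: int}"
  have s: "\<bar>s\<bar> = 1 \<longleftrightarrow> s = 1 \<or> s = - 1" for s :: int by linarith
  have "code x \<subseteq> (\<Union>p\<in>?P. (\<lambda>i. (i, Some p, x i, sq_type x (fst p) (snd p) i)) ` ?X p) \<union>
      (\<lambda>i. (i, None, x i, False)) ` ?N" (is "_ \<subseteq> (\<Union>p\<in>?P. ?f p ` ?X p) \<union> ?g ` ?N")
  proof
    fix a assume "a \<in> code x"
    then consider i k s where "a = (i, Some (k, s), x i, sq_type x k s i)" "i \<in> cube m" "\<bar>s\<bar> = 1" "exceptional x k s i"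
      | i where "a = (i, None, x i, False)" "i \<in> cube m" "\<forall>k s. \<bar>s\<bar> = 1 \<longrightarrow> \<not> covered x k s i"
      unfolding code_def by blast
    then show "a \<in> (\<Union>p\<in>?P. ?f p ` ?X p) \<union> ?g ` ?N"
    proof cases
      case (1 i k s)
      then have "(k, s) \<in> ?P" "i \<in> ?X (k, s)" "a = ?f (k, s) i" using s by auto
      then show ?thesis by blast
    next
      case (2 i)
      have "i \<in> ?N" using 2 same_block_refl unfolding covered_def by blast
      then show ?thesis using 2(1) by blast
    qed
  qed
  then have "card (code x) \<le> card ((\<Union>p\<in>?P. ?f p ` ?X p) \<union> ?g ` ?N)"
    by (intro card_mono finite_UnI finite_UN_I finite_imageI) auto
  also have "\<dots> \<le> card (\<Union>p\<in>?P. ?f p ` ?X p) + card (?g ` ?N)" by (rule card_Un_le)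
  also have "\<dots> \<le> (\<Sum>p\<in>?P. card (?f p ` ?X p)) + card ?N"
    by (intro add_mono card_UN_le card_image_le) auto
  also have "(\<Sum>p\<in>?P. card (?f p ` ?X p)) \<le> (\<Sum>p\<in>?P. card (?X p))"
    by (intro sum_mono card_image_le) auto
  finally have "real (card (code x)) \<le> (\<Sum>p\<in>?P. real (card (?X p))) + real (card ?N)"
    by (simp flip: of_nat_sum of_nat_add)
  also have "(\<Sum>p\<in>?P. real (card (?X p))) \<le>
      (\<Sum>p\<in>?P. (1 / real R + (3 + 2 * real D) / real L) * real (m ^ CARD('d)))"
    by (intro sum_mono card_exceptional) auto
  also have "\<dots> = 2 * real CARD('d) * (1 / real R + (3 + 2 * real D) / real L) * real (m ^ CARD('d))"
    by (simp add: card_cartesian_product)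
  finally show ?thesis by simp
qed

text \<open>Patterns are determined by codes, and a code is a small subset of the set of all
  entries: a site, one of \<open>2 * CARD('d) + 1\<close> tags, a letter and a bit.
  \<open>card_small_subsets\<close> counts these.\<close>

lemma card_language_few_unfrozen:
  assumes W: "W \<subseteq> homs" and A: "finite A" "\<And>x i. x \<in> W \<Longrightarrow> x i \<in> A"
    and few: "\<And>x. x \<in> W \<Longrightarrow>
      real (card {i \<in> cube m. \<forall>k s. \<bar>s\<bar> = 1 \<longrightarrow> \<not> frozen L R D x i k s (oth k)}) \<le> \<epsilon> * real (m ^ CARD('d))"
    and \<theta>: "2 * real CARD('d) * (1 / real R + (3 + 2 * real D) / real L) + \<epsilon> \<le> \<theta>"
    and q: "0 < q" "q \<le> 1"
  shows "real (card (language (cube m) W)) \<le>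
    (1 + q) ^ (2 * (2 * CARD('d) + 1) * card A * m ^ CARD('d)) * q powr (- (\<theta> * real (m ^ CARD('d))))"
proof -
  define tags where "tags = insert None (Some ` ((UNIV :: 'd set) \<times> {1, - 1 :: int}))"
  define U where "U = (cube m :: (int ^ 'd) set) \<times> tags \<times> A \<times> (UNIV :: bool set)"
  define \<S> where "\<S> = {S. S \<subseteq> U \<and> real (card S) \<le> \<theta> * real (m ^ CARD('d))}"
  have tags: "finite tags" "card tags = 2 * CARD('d) + 1"
    by (auto simp: tags_def card_image card_cartesian_product)
  have U: "finite U" "card U = 2 * (2 * CARD('d) + 1) * card A * m ^ CARD('d)"
    using tags A by (auto simp: U_def card_cartesian_product card_cube)
  have "\<bar>s\<bar> = 1 \<longleftrightarrow> s = 1 \<or> s = - 1" for s :: int by linarith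
  then have sub: "code x \<subseteq> U" if "x \<in> W" for x
    using A(2)[OF that] by (auto simp: code_def U_def tags_def)
  have small: "code x \<in> \<S>" if "x \<in> W" for x
  proof -
    have "real (card (code x)) \<le>
        (2 * real CARD('d) * (1 / real R + (3 + 2 * real D) / real L) + \<epsilon>) * real (m ^ CARD('d))"
      using card_code[of x] few[OF that] by (simp only: distrib_right)
    also have "\<dots> \<le> \<theta> * real (m ^ CARD('d))" using \<theta> by (intro mult_right_mono) auto
    finally show ?thesis using sub[OF that] by (simp add: \<S>_def)
  qed
  have "language (cube m) W \<subseteq> (\<lambda>S. restrict (SOME x. x \<in> W \<and> code x = S) (cube m)) ` \<S>"
  proof
    fix w assume "w \<in> language (cube m) W"
    then obtain x where x: "x \<in> W" "w = restrict x (cube m)" by (auto simp: language_def)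
    define y where "y = (SOME y. y \<in> W \<and> code y = code x)"
    have y: "y \<in> W" "code y = code x"
      using someI[of "\<lambda>y. y \<in> W \<and> code y = code x" x] x(1) by (auto simp: y_def)
    have "w = restrict y (cube m)"
      unfolding x(2) using code_determines[of x y] x(1) y W by (intro restrict_ext) auto
    then show "w \<in> (\<lambda>S. restrict (SOME x. x \<in> W \<and> code x = S) (cube m)) ` \<S>"
      using small[OF x(1)] by (auto simp: y_def)
  qed
  moreover have "finite \<S>" using U(1) by (auto simp: \<S>_def)
  ultimately have "card (language (cube m) W) \<le> card \<S>" by (intro surj_card_le) auto
  then have "real (card (language (cube m) W)) \<le> real (card \<S>)" by simp
  also have "\<dots> \<le> (1 + q) ^ card U * q powr (- (\<theta> * real (m ^ CARD('d))))"
    unfolding \<S>_def using U(1) q by (rule card_small_subsets)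
  finally show ?thesis unfolding U(2) .
qed

end

section \<open>Languages and entropy\<close>

lemma language_subset_PiE:
  "X \<subseteq> UNIV \<rightarrow> A \<Longrightarrow> language B X \<subseteq> PiE B (\<lambda>_. A)"
  by (fastforce simp: language_def)

lemma finite_language:
  assumes "finite A" "X \<subseteq> UNIV \<rightarrow> A" "finite B"
  shows "finite (language B X)"
  by (rule finite_subset[OF language_subset_PiE[OF assms(2)]]) (auto intro: finite_PiE assms)

lemma language_restrict: "B \<subseteq> C \<Longrightarrow> language B X = (\<lambda>w. restrict w B) ` language C X"
  by (force simp: language_def image_image Int_absorb1)

lemma card_language_mono:
  assumes "finite (language C X)" "B \<subseteq> C"
  shows "card (language B X) \<le> card (language C X)"
  unfolding language_restrict[OF assms(2)] using assms(1) by (rule card_image_le)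

lemma card_language_translate_le:
  fixes X :: "(int ^ 'd \<Rightarrow> 'a) set"
  assumes "\<And>i. shift i ` X \<subseteq> X" "finite (language B X)"
  shows "card (language ((+) t ` B) X) \<le> card (language B X)"
proof -
  define g where "g w = (\<lambda>j. if j \<in> (+) t ` B then w (j - t) else undefined)" for w :: "int ^ 'd \<Rightarrow> 'a"
  have "language ((+) t ` B) X \<subseteq> g ` language B X"
  proof
    fix w assume "w \<in> language ((+) t ` B) X"
    then obtain x where x: "x \<in> X" "w = restrict x ((+) t ` B)" by (auto simp: language_def)
    have "w = g (restrict (shift t x) B)" by (auto simp: x(2) g_def shift_def fun_eq_iff)
    moreover have "shift t x \<in> X" using assms(1) x(1) by blast
    ultimately show "w \<in> g ` language B X" by (auto simp: language_def)
  qed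
  then show ?thesis using assms(2) by (rule surj_card_le[rotated])
qed

lemma card_language_translate:
  assumes "\<And>i. shift i ` X \<subseteq> X" "finite A" "X \<subseteq> UNIV \<rightarrow> A" "finite B"
  shows "card (language ((+) t ` B) X) = card (language B X)"
proof (rule antisym)
  have B: "(+) (- t) ` (+) t ` B = B" by (simp add: image_image)
  show "card (language ((+) t ` B) X) \<le> card (language B X)"
    using assms by (intro card_language_translate_le finite_language)
  have "card (language ((+) (- t) ` (+) t ` B) X) \<le> card (language ((+) t ` B) X)"
    by (rule card_language_translate_le[OF assms(1)]) (use assms in \<open>auto intro: finite_language\<close>)
  then show "card (language B X) \<le> card (language ((+) t ` B) X)" unfolding B .
qed

lemma card_language_Un:
  assumes "finite (language B X)" "finite (language C X)"
  shows "card (language (B \<union> C) X) \<le> card (language B X) * card (language C X)"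
proof -
  let ?h = "\<lambda>w. (restrict w B, restrict w C)"
  have "inj_on ?h (language (B \<union> C) X)"
  proof (rule inj_onI)
    fix v w assume "v \<in> language (B \<union> C) X" "w \<in> language (B \<union> C) X" and eq: "?h v = ?h w"
    then have "v \<in> extensional (B \<union> C)" "w \<in> extensional (B \<union> C)" by (auto simp: language_def)
    then show "v = w"
    proof (rule extensionalityI)
      fix i assume "i \<in> B \<union> C"
      then show "v i = w i" using eq by (metis Pair_inject UnE restrict_apply')
    qed
  qed
  moreover have "?h ` language (B \<union> C) X \<subseteq> language B X \<times> language C X"
    by (auto simp: language_def Int_absorb1)
  ultimately have "card (language (B \<union> C) X) \<le> card (language B X \<times> language C X)"
    using assms by (intro card_inj_on_le) auto
  then show ?thesis by (simp add: card_cartesian_product)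
qed

lemma card_language_UN:
  assumes "finite I" "\<And>i. i \<in> I \<Longrightarrow> finite (B i)" "\<And>i. i \<in> I \<Longrightarrow> card (language (B i) X) \<le> N"
    and A: "finite A" "X \<subseteq> UNIV \<rightarrow> A"
  shows "card (language (\<Union>i\<in>I. B i) X) \<le> N ^ card I"
  using assms(1-3)
proof (induction I)
  case empty
  have "language {} X \<subseteq> {\<lambda>_. undefined}" by (auto simp: language_def)
  then have "card (language {} X) \<le> 1" using card_mono[of "{\<lambda>_. undefined}" "language {} X"] by simp
  then show ?case by simp
next
  case (insert a I)
  have "card (language (B a \<union> (\<Union>i\<in>I. B i)) X) \<le> card (language (B a) X) * card (language (\<Union>i\<in>I. B i) X)"
    using insert.hyps insert.prems by (intro card_language_Un finite_language[OF A]) auto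
  also have "\<dots> \<le> N * N ^ card I" using insert by (intro mult_le_mono) auto
  finally show ?case using insert.hyps by simp
qed

section \<open>Subadditivity over cubes and existence of the limit\<close>

lemma cube_cover:
  assumes "N \<le> q * m" "0 < m"
  shows "(cube N :: (int ^ 'd) set) \<subseteq> (\<Union>t\<in>cube q. (+) (\<chi> k. int m * t $ k) ` cube m)"
proof
  fix i :: "int ^ 'd" assume i: "i \<in> cube N"
  define t where "t = (\<chi> k. i $ k div int m)"
  have "t \<in> cube q"
    unfolding mem_cube
  proof
    fix k
    have "0 \<le> i $ k" "i $ k < int N" using i by (auto simp: mem_cube)
    moreover have "int N \<le> int m * int q" using assms(1) by (metis mult.commute of_nat_le_iff of_nat_mult)
    ultimately show "0 \<le> t $ k \<and> t $ k < int q"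
      using assms(2) by (simp add: t_def pos_imp_zdiv_nonneg_iff int_div_less_iff)
  qed
  moreover have "(\<chi> k. i $ k mod int m) \<in> cube m" using assms(2) by (simp add: mem_cube)
  moreover have "i = (\<chi> k. int m * t $ k) + (\<chi> k. i $ k mod int m)"
    by (simp add: t_def vec_eq_iff)
  ultimately show "i \<in> (\<Union>t\<in>cube q. (+) (\<chi> k. int m * t $ k) ` cube m)" by blast
qed

lemma card_language_cube_le:
  fixes X :: "(int ^ 'd \<Rightarrow> 'a) set"
  assumes "\<And>i. shift i ` X \<subseteq> X" "finite A" "X \<subseteq> UNIV \<rightarrow> A" "N \<le> q * m" "0 < m"
  shows "card (language (cube N) X) \<le> card (language (cube m) X) ^ (q ^ CARD('d))"
proof -
  let ?U = "\<Union>t\<in>(cube q :: (int ^ 'd) set). (+) (\<chi> k. int m * t $ k) ` cube m"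
  have "card (language (cube N) X) \<le> card (language ?U X)"
    using assms cube_cover[OF assms(4,5)] by (intro card_language_mono finite_language) auto
  also have "\<dots> \<le> card (language (cube m) X) ^ card (cube q :: (int ^ 'd) set)"
    using assms by (intro card_language_UN) (auto simp: card_language_translate[OF assms(1-3)])
  finally show ?thesis by (simp add: card_cube)
qed

text \<open>Fekete's argument: the limit is the infimum, because a large cube is covered by few
  cubes of a nearly optimal side \<open>m\<close>, with \<open>q * m \<le> N + m\<close>. The bound
  at every finite \<open>m\<close> later yields the lower estimate for the language of
  \<open>Y\<close>.\<close>

lemma cube_subadditive_limit:
  fixes b :: "nat \<Rightarrow> real"
  assumes nonneg: "\<And>m. 0 \<le> b m" and sub: "\<And>N q m. N \<le> q * m \<Longrightarrow> 0 < m \<Longrightarrow> b N \<le> real (q ^ d) * b m"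
  obtains h where "(\<lambda>m. b m / real (m ^ d)) \<longlonglongrightarrow> h" "\<And>m. 0 < m \<Longrightarrow> h \<le> b m / real (m ^ d)"
proof -
  define h where "h = (INF m\<in>{0<..}. b m / real (m ^ d))"
  have bdd: "bdd_below ((\<lambda>m. b m / real (m ^ d)) ` {0<..})"
    using nonneg by (intro bdd_belowI[of _ 0]) auto
  have h: "h \<le> b m / real (m ^ d)" if "0 < m" for m
    unfolding h_def using bdd that by (intro cINF_lower) auto
  have "(\<lambda>m. b m / real (m ^ d)) \<longlonglongrightarrow> h"
  proof (rule order_tendstoI)
    fix a assume "a < h"
    show "\<forall>\<^sub>F m in sequentially. a < b m / real (m ^ d)"
      using eventually_gt_at_top[of "0 :: nat"]
    proof (rule eventually_mono)
      fix m :: nat assume "0 < m"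
      from less_le_trans[OF \<open>a < h\<close> h[OF this]] show "a < b m / real (m ^ d)" .
    qed
  next
    fix a assume "h < a"
    then obtain m where m: "0 < m" "b m / real (m ^ d) < a"
      unfolding h_def using cINF_less_iff[OF _ bdd, of a] by auto
    have "(\<lambda>N. (1 + real m / real N) ^ d * (b m / real (m ^ d))) \<longlonglongrightarrow> (1 + 0) ^ d * (b m / real (m ^ d))"
      by (intro tendsto_intros lim_const_over_n)
    then have "\<forall>\<^sub>F N in sequentially. (1 + real m / real N) ^ d * (b m / real (m ^ d)) < a"
      using m(2) by (intro order_tendstoD(2)) auto
    then show "\<forall>\<^sub>F N in sequentially. b N / real (N ^ d) < a"
      using eventually_gt_at_top[of 0]
    proof eventually_elim
      case (elim N)
      define q where "q = Suc (N div m)"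
      have "N = N div m * m + N mod m" "N mod m < m" using m(1) by auto
      moreover have "q * m = N div m * m + m" by (simp add: q_def)
      ultimately have q: "N \<le> q * m" "q * m \<le> N + m" by linarith+
      have "b N / real (N ^ d) \<le> real (q ^ d) * b m / real (N ^ d)"
        using sub[OF q(1) m(1)] by (intro divide_right_mono) auto
      also have "\<dots> = (real (q * m) / real N) ^ d * (b m / real (m ^ d))"
        using m(1) by (simp add: power_mult_distrib power_divide)
      also have "\<dots> \<le> (real (N + m) / real N) ^ d * (b m / real (m ^ d))"
      proof -
        have "real (q * m) \<le> real (N + m)" using q(2) by (simp only: of_nat_le_iff)
        then show ?thesis using nonneg[of m] by (intro mult_right_mono power_mono divide_right_mono) auto
      qed
      also have "real (N + m) / real N = 1 + real m / real N" using elim(2) by (simp add: add_divide_distrib)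
      finally show ?case using elim(1) by simp
    qed
  qed
  then show ?thesis using that h by blast
qed

lemma lattice_box_eq: "lattice_box n = (+) (\<chi> k. - int n) ` cube (2 * n + 1)"
proof (intro equalityI subsetI)
  fix i :: "int ^ 'd" assume "i \<in> lattice_box n"
  then have "- int n \<le> i $ k \<and> i $ k \<le> int n" for k by (simp add: lattice_box_def abs_le_iff minus_le_iff)
  then have "i - (\<chi> k. - int n) \<in> cube (2 * n + 1)" unfolding mem_cube by (auto simp: algebra_simps) (smt (verit))+
  then show "i \<in> (+) (\<chi> k. - int n) ` cube (2 * n + 1)" by (intro image_eqI[of _ _ "i - (\<chi> k. - int n)"]) auto
next
  fix i :: "int ^ 'd" assume "i \<in> (+) (\<chi> k. - int n) ` cube (2 * n + 1)"
  then obtain j where j: "i = (\<chi> k. - int n) + j" "\<And>k. 0 \<le> j $ k \<and> j $ k < int (2 * n + 1)" by (auto simp: mem_cube)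
  have "\<bar>i $ k\<bar> \<le> int n" for k using j(2)[of k] by (simp add: j(1) abs_le_iff)
  then show "i \<in> lattice_box n" by (simp add: lattice_box_def)
qed

lemma shift_spaceD:
  assumes "shift_space A X"
  shows "finite A" "X \<subseteq> UNIV \<rightarrow> A" "\<And>i. shift i ` X \<subseteq> X"
proof -
  show "finite A" "\<And>i. shift i ` X \<subseteq> X" using assms by (auto simp: shift_space_def)
  have "X \<subseteq> topspace (full_shift_topology A)"
    using assms closedin_subset by (auto simp: shift_space_def)
  then show "X \<subseteq> UNIV \<rightarrow> A" by (auto simp: full_shift_topology_def PiE_def Pi_def)
qed

lemma topological_entropy_empty: "topological_entropy ({} :: (int ^ 'd \<Rightarrow> 'a) set) = - \<infinity>"
proof -
  have "card (lattice_box n :: (int ^ 'd) set) > 0" for n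
    unfolding lattice_box_eq by (simp add: card_image card_cube)
  then have "topological_entropy ({} :: (int ^ 'd \<Rightarrow> 'a) set) = lim (\<lambda>_ :: nat. - \<infinity> :: ereal)"
    by (simp add: topological_entropy_def language_def log_nat_def)
  also have "\<dots> = - \<infinity>" by (rule limI) simp
  finally show ?thesis .
qed

lemma topological_entropy_limit:
  fixes X :: "(int ^ 'd \<Rightarrow> 'a) set"
  assumes X: "\<And>i. shift i ` X \<subseteq> X" "finite A" "X \<subseteq> UNIV \<rightarrow> A" "X \<noteq> {}"
  obtains h where "topological_entropy X = ereal h"
    "(\<lambda>m. ln (real (card (language (cube m) X))) / real (m ^ CARD('d))) \<longlonglongrightarrow> h"
    "\<And>m. 0 < m \<Longrightarrow> h \<le> ln (real (card (language (cube m) X))) / real (m ^ CARD('d))"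
proof -
  define p where "p m = card (language (cube m) X)" for m
  have pos: "0 < p m" for m
    unfolding p_def card_gt_0_iff using X(4) finite_language[OF X(2,3)] by (auto simp: language_def)
  have "ln (real (p N)) \<le> real (q ^ CARD('d)) * ln (real (p m))" if "N \<le> q * m" "0 < m" for N q m
  proof -
    have "p N \<le> p m ^ (q ^ CARD('d))"
      unfolding p_def using card_language_cube_le[OF X(1-3) that] by simp
    then have "ln (real (p N)) \<le> ln (real (p m ^ (q ^ CARD('d))))"
      using pos[of N] by (intro ln_mono) (auto simp flip: of_nat_power)
    also have "\<dots> = real (q ^ CARD('d)) * ln (real (p m))"
      using pos[of m] by (simp add: ln_realpow)
    finally show ?thesis .
  qed
  moreover have "0 \<le> ln (real (p m))" for m using pos[of m] by simp
  ultimately obtain h where h: "(\<lambda>m. ln (real (p m)) / real (m ^ CARD('d))) \<longlonglongrightarrow> h"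
    "\<And>m. 0 < m \<Longrightarrow> h \<le> ln (real (p m)) / real (m ^ CARD('d))"
    using cube_subadditive_limit[of "\<lambda>m. ln (real (p m))"] by blast
  have "card (language (lattice_box n) X) = p (2 * n + 1)" for n
    unfolding lattice_box_eq p_def using card_language_translate[OF X(1-3) finite_cube] by simp
  moreover have "card (lattice_box n :: (int ^ 'd) set) = (2 * n + 1) ^ CARD('d)" for n
    unfolding lattice_box_eq by (simp add: card_image card_cube)
  ultimately have "log_nat (card (language (lattice_box n) X)) / ereal (real (card (lattice_box n :: (int ^ 'd) set))) =
      ereal (ln (real (p (2 * n + 1))) / real ((2 * n + 1) ^ CARD('d)))" for n
    unfolding log_nat_def using pos[of "2 * n + 1"] by auto
  then have "topological_entropy X =
      lim (\<lambda>n. ereal (ln (real (p (2 * n + 1))) / real ((2 * n + 1) ^ CARD('d))))"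
    by (simp only: topological_entropy_def)
  also have "\<dots> = ereal h"
  proof (rule limI, rule tendsto_ereal)
    have "filterlim (\<lambda>n :: nat. 2 * n + 1) at_top sequentially"
      by (rule filterlim_subseq) (auto simp: strict_mono_def)
    from filterlim_compose[OF h(1) this]
    show "(\<lambda>n. ln (real (p (2 * n + 1))) / real ((2 * n + 1) ^ CARD('d))) \<longlonglongrightarrow> h" .
  qed
  finally show ?thesis using that h by (simp add: p_def)
qed

section \<open>Counting configurations with many replaceable sites\<close>

lemma card_l1ball: "card {j :: int ^ 'd. l1norm (j - c) < M} = card {j :: int ^ 'd. l1norm j < M}"
proof -
  have "{j. l1norm (j - c) < M} = (+) c ` {j. l1norm j < M}"
  proof (intro equalityI subsetI)
    fix j assume "j \<in> {j. l1norm (j - c) < M}"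
    then show "j \<in> (+) c ` {j. l1norm j < M}" by (intro image_eqI[of _ _ "j - c"]) auto
  qed auto
  then show ?thesis by (simp add: card_image)
qed

lemma finite_l1ball: "finite {j :: int ^ 'd. l1norm (j - c) < M}"
  by (rule finite_subset[OF _ finite_l1norm_le[of c M]]) auto

lemma l1norm_diff_triangle: "l1norm (a - b) \<le> l1norm (j - a) + l1norm (j - b)"
  using l1norm_triangle[of "a - j" "j - b"] by (simp add: l1norm_minus_commute)

context hom_graph
begin

section \<open>Simultaneous replacement in disjoint balls\<close>

definition replacement_at ::
    "nat \<Rightarrow> nat \<Rightarrow> (int ^ 'd \<Rightarrow> 'a) set \<Rightarrow> (int ^ 'd \<Rightarrow> 'a) \<Rightarrow> int ^ 'd \<Rightarrow> int ^ 'd \<Rightarrow> 'a" where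
  "replacement_at M k Z x c = (SOME x'. x' \<in> homs \<and> (\<forall>j. M \<le> l1norm (j - c) \<longrightarrow> x' j = x j) \<and>
     (\<exists>z\<in>Z. agrees_near k c x' z))"

lemma replacement_at:
  assumes "replaceable M k Z x c"
  shows "replacement_at M k Z x c \<in> homs"
    "M \<le> l1norm (j - c) \<Longrightarrow> replacement_at M k Z x c j = x j"
    "\<exists>z\<in>Z. agrees_near k c (replacement_at M k Z x c) z"
proof -
  have "\<exists>x'. x' \<in> homs \<and> (\<forall>j. M \<le> l1norm (j - c) \<longrightarrow> x' j = x j) \<and> (\<exists>z\<in>Z. agrees_near k c x' z)"
    using assms by (auto simp: replaceable_def)
  from someI_ex[OF this]
  show "replacement_at M k Z x c \<in> homs"
    "M \<le> l1norm (j - c) \<Longrightarrow> replacement_at M k Z x c j = x j"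
    "\<exists>z\<in>Z. agrees_near k c (replacement_at M k Z x c) z"
    unfolding replacement_at_def by blast+
qed

definition patch ::
    "nat \<Rightarrow> nat \<Rightarrow> (int ^ 'd \<Rightarrow> 'a) set \<Rightarrow> (int ^ 'd \<Rightarrow> 'a) \<Rightarrow> (int ^ 'd) set \<Rightarrow> int ^ 'd \<Rightarrow> 'a" where
  "patch M k Z x S j = (if \<exists>c\<in>S. l1norm (j - c) < M
     then replacement_at M k Z x (SOME c. c \<in> S \<and> l1norm (j - c) < M) j else x j)"

lemma patch_outside: "(\<And>c. c \<in> S \<Longrightarrow> M \<le> l1norm (j - c)) \<Longrightarrow> patch M k Z x S j = x j"
  unfolding patch_def by (metis not_less)

context
  fixes M k :: nat and Z :: "(int ^ 'd \<Rightarrow> 'a) set" and x :: "int ^ 'd \<Rightarrow> 'a" and S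
  assumes sep: "\<And>c c'. c \<in> S \<Longrightarrow> c' \<in> S \<Longrightarrow> c \<noteq> c' \<Longrightarrow> 2 * M \<le> l1norm (c - c')"
    and repl: "\<And>c. c \<in> S \<Longrightarrow> replaceable M k Z x c"
begin

text \<open>On the boundary sphere the replacement agrees with \<open>x\<close>, and no other open
  ball reaches it. Thus each edge meeting an open ball lies in a closed ball where one replacement
  alone is in force.\<close>

lemma patch_near:
  assumes c: "c \<in> S" and j: "l1norm (j - c) \<le> M"
  shows "patch M k Z x S j = replacement_at M k Z x c j"
proof -
  have other: "M \<le> l1norm (j - c')" if "c' \<in> S" "c' \<noteq> c" for c'
    using sep[OF c that(1)] that(2) l1norm_diff_triangle[of c c' j] j by fastforce
  show ?thesis
  proof (cases "l1norm (j - c) < M")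
    case True
    have "(SOME c. c \<in> S \<and> l1norm (j - c) < M) = c"
      using c True other by (intro some_equality) (auto simp: not_less[symmetric])
    then show ?thesis using c True by (auto simp: patch_def)
  next
    case False
    then have "M \<le> l1norm (j - c')" if "c' \<in> S" for c' using other[OF that] by (cases "c' = c") auto
    then show ?thesis using patch_outside[of S M j] replacement_at(2)[OF repl[OF c]] c by simp
  qed
qed

lemma patch_in_homs:
  assumes x: "x \<in> homs"
  shows "patch M k Z x S \<in> homs"
proof -
  have near: "E (patch M k Z x S i) (patch M k Z x S j)"
    if "lattice_adj i j" "c \<in> S" "l1norm (i - c) < M" for i j c
  proof -
    have "l1norm (j - c) \<le> M" using lattice_adj_l1norm_diff[OF that(1), of c] that(3) by linarith
    then show ?thesis
      using patch_near[OF that(2), of i] patch_near[OF that(2), of j] that(3)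
        homsD[OF replacement_at(1)[OF repl[OF that(2)]] that(1)] by simp
  qed
  have "E (patch M k Z x S i) (patch M k Z x S j)" if adj: "lattice_adj i j" for i j
  proof (cases "\<exists>c\<in>S. l1norm (i - c) < M \<or> l1norm (j - c) < M")
    case True
    then show ?thesis using near[OF adj] near[of j i] adj sym by (auto simp: lattice_adj_sym)
  next
    case False
    then have "\<And>c. c \<in> S \<Longrightarrow> M \<le> l1norm (i - c)" "\<And>c. c \<in> S \<Longrightarrow> M \<le> l1norm (j - c)"
      by (auto simp: not_less)
    then show ?thesis
      using patch_outside[of S M i] patch_outside[of S M j] homsD[OF x adj] by simp
  qed
  then show ?thesis by (simp add: homs_def)
qed

text \<open>The set \<open>S\<close> can be read off: at its sites a pattern of \<open>Z\<close> was
  inserted, while around a site at distance \<open>2 * M\<close> from \<open>S\<close> the ball of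
  radius \<open>k\<close> is untouched and \<open>x\<close> avoids the patterns.\<close>

lemma agrees_near_patch:
  assumes kM: "k < M" and avoid: "\<And>z. z \<in> Z \<Longrightarrow> \<not> agrees_near k c x z"
    and c: "\<And>c'. c' \<in> S \<Longrightarrow> c' \<noteq> c \<Longrightarrow> 2 * M \<le> l1norm (c - c')"
  shows "(\<exists>z\<in>Z. agrees_near k c (patch M k Z x S) z) \<longleftrightarrow> c \<in> S"
proof
  assume "c \<in> S"
  then have "patch M k Z x S (c + j) = replacement_at M k Z x c (c + j)" if "l1norm j \<le> k" for j
    using patch_near[of c "c + j"] that kM by simp
  then show "\<exists>z\<in>Z. agrees_near k c (patch M k Z x S) z"
    using replacement_at(3)[OF repl[OF \<open>c \<in> S\<close>]] by (simp add: agrees_near_def)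
next
  assume ag: "\<exists>z\<in>Z. agrees_near k c (patch M k Z x S) z"
  show "c \<in> S"
  proof (rule ccontr)
    assume "c \<notin> S"
    have "patch M k Z x S (c + j) = x (c + j)" if "l1norm j \<le> k" for j
    proof (rule patch_outside)
      fix c' assume "c' \<in> S"
      then have "2 * M \<le> l1norm (c - c')" using c[of c'] \<open>c \<notin> S\<close> by blast
      then show "M \<le> l1norm (c + j - c')" using l1norm_diff_triangle[of c c' "c + j"] that kM by simp
    qed
    then show False using ag avoid by (auto simp: agrees_near_def)
  qed
qed

end

text \<open>Give a pattern \<open>w\<close> with a set \<open>S\<close> of its replaceable sites the
  weight \<open>t ^ card S\<close>, where \<open>1 / t\<close> is the number of fillings of a ball.
  For fixed \<open>w\<close> the weights sum to \<open>1 + t\<close> to the power of the number of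
  these sites. A result determines \<open>S\<close>, and \<open>w\<close> off the balls, so it
  arises from at most \<open>(1 / t) ^ card S\<close> pairs, of total weight at most one.\<close>

lemma card_language_many_replaceable:
  fixes W Z :: "(int ^ 'd \<Rightarrow> 'a) set"
  assumes A: "finite A" "homs \<subseteq> (UNIV :: (int ^ 'd) set) \<rightarrow> A" and W: "W \<subseteq> homs"
    and avoid: "\<And>x c z. x \<in> W \<Longrightarrow> z \<in> Z \<Longrightarrow> \<not> agrees_near k c x z"
    and kM: "k < M" and \<Gamma>: "\<Gamma> \<subseteq> cube m"
    and sep: "\<And>c c'. c \<in> \<Gamma> \<Longrightarrow> c' \<in> \<Gamma> \<Longrightarrow> c \<noteq> c' \<Longrightarrow> 2 * M \<le> l1norm (c - c')"
    and many: "\<And>x. x \<in> W \<Longrightarrow> g \<le> real (card {c \<in> \<Gamma>. replaceable M k Z x c})"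
  shows "real (card (language (cube m) W)) *
      (1 + 1 / real (card A) ^ card {j :: int ^ 'd. l1norm j < M}) powr g
    \<le> real (card (language ((+) (\<chi> k. - int M) ` cube (m + 2 * M)) (homs :: (int ^ 'd \<Rightarrow> 'a) set)))"
proof -
  define \<beta> where "\<beta> = card {j :: int ^ 'd. l1norm j < M}"
  define a where "a = card A"
  define t where "t = 1 / real a ^ \<beta>"
  \<comment> \<open>The margin \<open>M\<close> makes inserted patterns visible even at the boundary
    of the cube.\<close>
  define B where "B = (+) (\<chi> k. - int M) ` (cube (m + 2 * M) :: (int ^ 'd) set)"
  define L where "L = language (cube m) W"
  define rep where "rep w = (SOME x. x \<in> W \<and> restrict x (cube m) = w)" for w
  define G where "G x = {c \<in> \<Gamma>. replaceable M k Z x c}" for x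
  define F where "F p = restrict (patch M k Z (rep (fst p)) (snd p)) B" for p
  define \<Omega> where "\<Omega> = Sigma L (\<lambda>w. Pow (G (rep w)))"
  have rep: "rep w \<in> W" "restrict (rep w) (cube m) = w" if "w \<in> L" for w
    using someI_ex[of "\<lambda>x. x \<in> W \<and> restrict x (cube m) = w"] that
    unfolding rep_def L_def language_def by blast+
  have finL: "finite L" unfolding L_def using A W by (intro finite_language) auto
  have fin\<Gamma>: "finite \<Gamma>" using finite_subset[OF \<Gamma> finite_cube] .
  then have finG: "finite (G x)" for x by (simp add: G_def)
  have fin\<Omega>: "finite \<Omega>" unfolding \<Omega>_def using finL finG by auto
  have ball_B: "c + j \<in> B" if "c \<in> cube m" "l1norm j \<le> M" for c j
  proof -
    have "c + j - (\<chi> k. - int M) \<in> cube (m + 2 * M)"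
      unfolding mem_cube
    proof
      fix h
      have "0 \<le> c $ h" "c $ h < int m" "\<bar>j $ h\<bar> \<le> int M"
        using that(1) abs_component_le_l1norm[of j h] that(2) by (auto simp: mem_cube)
      then have "0 \<le> c $ h + j $ h + int M" "c $ h + j $ h + int M < int m + 2 * int M" by linarith+
      then show "0 \<le> (c + j - (\<chi> k. - int M)) $ h \<and> (c + j - (\<chi> k. - int M)) $ h < int (m + 2 * M)"
        by simp
    qed
    then show ?thesis unfolding B_def by (intro image_eqI[of _ _ "c + j - (\<chi> k. - int M)"]) auto
  qed
  have F_patch: "F p i = patch M k Z (rep (fst p)) (snd p) i" if "i \<in> B" for p i
    using that by (simp add: F_def)
  have \<Omega>D: "w \<in> L" "S \<subseteq> \<Gamma>" "\<And>c. c \<in> S \<Longrightarrow> replaceable M k Z (rep w) c"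
    "\<And>c c'. c \<in> S \<Longrightarrow> c' \<in> S \<Longrightarrow> c \<noteq> c' \<Longrightarrow> 2 * M \<le> l1norm (c - c')" if "(w, S) \<in> \<Omega>" for w S
    using that sep by (auto simp: \<Omega>_def G_def)
  have F_hom: "F p \<in> language B homs" if "p \<in> \<Omega>" for p
  proof -
    obtain w S where p: "p = (w, S)" by (cases p)
    note D = \<Omega>D[OF that[unfolded p]]
    have "patch M k Z (rep w) S \<in> homs"
      by (rule patch_in_homs) (use D rep(1)[OF D(1)] W in auto)
    then show ?thesis by (auto simp: F_def language_def p)
  qed
  have snd_F: "S = {c \<in> \<Gamma>. \<exists>z\<in>Z. \<forall>j. l1norm j \<le> k \<longrightarrow> F (w, S) (c + j) = z j}" if p: "(w, S) \<in> \<Omega>" for w S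
  proof -
    note D = \<Omega>D[OF p]
    have "(\<exists>z\<in>Z. \<forall>j. l1norm j \<le> k \<longrightarrow> F (w, S) (c + j) = z j) \<longleftrightarrow> c \<in> S" if c: "c \<in> \<Gamma>" for c
    proof -
      have "(\<exists>z\<in>Z. agrees_near k c (patch M k Z (rep w) S) z) \<longleftrightarrow> c \<in> S"
        by (rule agrees_near_patch) (use D kM avoid rep(1)[OF D(1)] sep c in auto)
      moreover have "F (w, S) (c + j) = patch M k Z (rep w) S (c + j)" if "l1norm j \<le> k" for j
        using F_patch[OF ball_B[of c j]] c \<Gamma> that kM by auto
      ultimately show ?thesis by (auto simp: agrees_near_def)
    qed
    then show ?thesis using D(2) by blast
  qed
  have fibre: "(\<Sum>p\<in>{p \<in> \<Omega>. F p = e}. t ^ card (snd p)) \<le> 1" if e: "e \<in> F ` \<Omega>" for e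
  proof -
    define S where "S = {c \<in> \<Gamma>. \<exists>z\<in>Z. \<forall>j. l1norm j \<le> k \<longrightarrow> e (c + j) = z j}"
    define C where "C = (\<Union>c\<in>S. {j. l1norm (j - c) < M})"
    define \<Phi> where "\<Phi> = {p \<in> \<Omega>. F p = e}"
    have \<Phi>: "p \<in> \<Omega>" "snd p = S" "F p = e" if "p \<in> \<Phi>" for p
    proof -
      show "p \<in> \<Omega>" "F p = e" using that by (auto simp: \<Phi>_def)
      then show "snd p = S" using snd_F[of "fst p" "snd p"] by (simp add: S_def)
    qed
    have finS: "finite S" using fin\<Gamma> by (simp add: S_def)
    have finC: "finite C" unfolding C_def using finS finite_l1ball by blast
    have "card C \<le> (\<Sum>c\<in>S. card {j. l1norm (j - c) < M})" unfolding C_def by (rule card_UN_le[OF finS])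
    then have cardC: "card C \<le> \<beta> * card S" by (simp add: card_l1ball \<beta>_def mult.commute)
    have homA: "y i \<in> A" if "y \<in> W" for y i using that W A(2) by auto
    obtain w S' where "(w, S') \<in> \<Omega>" using e by auto
    then have "rep w 0 \<in> A" using homA rep(1) \<Omega>D(1) by blast
    then have "A \<noteq> {}" by blast
    then have a: "1 \<le> a" unfolding a_def using A(1) by (simp add: Suc_leI card_gt_0_iff)
    have inj: "inj_on (\<lambda>p. restrict (rep (fst p)) C) \<Phi>"
    proof (rule inj_onI)
      fix p p' assume p: "p \<in> \<Phi>" "p' \<in> \<Phi>" and eq: "restrict (rep (fst p)) C = restrict (rep (fst p')) C"
      have out: "rep (fst q) i = e i" if "q \<in> \<Phi>" "i \<in> cube m" "i \<notin> C" for q i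
      proof -
        have "i \<in> B" using ball_B[OF that(2), of 0] by simp
        then have "e i = patch M k Z (rep (fst q)) S i"
          using F_patch[of i q] \<Phi>[OF that(1)] by simp
        also have "\<dots> = rep (fst q) i"
          using that(3) by (intro patch_outside) (auto simp: C_def not_less)
        finally show ?thesis by simp
      qed
      have "rep (fst p) i = rep (fst p') i" if "i \<in> cube m" for i
        using out[OF p(1) that] out[OF p(2) that] fun_cong[OF eq, of i] by (cases "i \<in> C") auto
      then have "restrict (rep (fst p)) (cube m) = restrict (rep (fst p')) (cube m)"
        by (rule restrict_ext)
      then have "fst p = fst p'"
        using rep(2)[OF \<Omega>D(1)] \<Phi>(1)[OF p(1)] \<Phi>(1)[OF p(2)] by (metis prod.collapse)
      then show "p = p'" using \<Phi>(2)[OF p(1)] \<Phi>(2)[OF p(2)] by (simp add: prod_eq_iff)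
    qed
    have "(\<lambda>p. restrict (rep (fst p)) C) ` \<Phi> \<subseteq> PiE C (\<lambda>_. A)"
    proof
      fix v assume "v \<in> (\<lambda>p. restrict (rep (fst p)) C) ` \<Phi>"
      then obtain p where p: "p \<in> \<Phi>" "v = restrict (rep (fst p)) C" by blast
      have "rep (fst p) \<in> W" using rep(1)[OF \<Omega>D(1)] \<Phi>(1)[OF p(1)] by (metis prod.collapse)
      then show "v \<in> PiE C (\<lambda>_. A)" using homA p(2) by auto
    qed
    then have "card \<Phi> \<le> card (PiE C (\<lambda>_. A))"
      using inj finC A(1) by (intro card_inj_on_le finite_PiE) auto
    also have "\<dots> = a ^ card C" using finC by (simp add: card_PiE a_def)
    also have "\<dots> \<le> a ^ (\<beta> * card S)" using cardC a by (intro power_increasing) auto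
    finally have card\<Phi>: "real (card \<Phi>) \<le> real a ^ (\<beta> * card S)" by (metis of_nat_le_iff of_nat_power)
    have "(\<Sum>p\<in>\<Phi>. t ^ card (snd p)) = real (card \<Phi>) * t ^ card S"
      using \<Phi>(2) by simp
    also have "\<dots> \<le> real a ^ (\<beta> * card S) * t ^ card S"
      using card\<Phi> by (intro mult_right_mono) (auto simp: t_def)
    also have "\<dots> = 1" using a by (simp add: t_def power_mult power_divide)
    finally show ?thesis unfolding \<Phi>_def .
  qed
  have "real (card L) * (1 + t) powr g = (\<Sum>w\<in>L. (1 + t) powr g)" by simp
  also have "\<dots> \<le> (\<Sum>w\<in>L. (1 + t) ^ card (G (rep w)))"
  proof (rule sum_mono)
    fix w assume "w \<in> L"
    then have "(1 + t) powr g \<le> (1 + t) powr real (card (G (rep w)))"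
      using many[OF rep(1)] by (intro powr_mono) (auto simp: t_def G_def)
    moreover have "0 < 1 + t" by (simp add: t_def add_pos_nonneg)
    ultimately show "(1 + t) powr g \<le> (1 + t) ^ card (G (rep w))" by (simp add: powr_realpow)
  qed
  also have "\<dots> = (\<Sum>w\<in>L. \<Sum>S\<in>Pow (G (rep w)). t ^ card S)"
    using finG by (simp add: sum_power_card_Pow)
  also have "\<dots> = (\<Sum>p\<in>\<Omega>. t ^ card (snd p))"
    unfolding \<Omega>_def using finL finG by (subst sum.Sigma) (auto simp: case_prod_beta)
  also have "\<dots> = (\<Sum>e\<in>F ` \<Omega>. \<Sum>p\<in>{p \<in> \<Omega>. F p = e}. t ^ card (snd p))"
    using fin\<Omega> by (rule sum.image_gen)
  also have "\<dots> \<le> (\<Sum>e\<in>F ` \<Omega>. 1)" by (rule sum_mono) (rule fibre)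
  also have "\<dots> = real (card (F ` \<Omega>))" by simp
  also have "\<dots> \<le> real (card (language B (homs :: (int ^ 'd \<Rightarrow> 'a) set)))"
    using F_hom A by (intro of_nat_mono card_mono finite_language) (auto simp: B_def)
  finally show ?thesis unfolding L_def B_def t_def a_def \<beta>_def .
qed

end

section \<open>Comparison of entropies\<close>

text \<open>A basic neighbourhood of \<open>z\<close> disjoint from \<open>Y\<close> restricts
  finitely many sites. The radius exceeds theirs by one, so the ball also contains their unit
  translates.\<close>

lemma avoided_pattern:
  assumes Y: "shift_space A Y" and z: "z \<notin> Y" "\<And>i. z i \<in> A"
  obtains k where "1 \<le> k" "\<And>y c. y \<in> Y \<Longrightarrow> \<not> agrees_near k c y z"
    "\<And>y c s. y \<in> Y \<Longrightarrow> l1norm s = 1 \<Longrightarrow> \<not> agrees_near k c y (shift s z)"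
proof -
  let ?T = "full_shift_topology A :: (int ^ 'd \<Rightarrow> 'a) topology"
  have top: "topspace ?T = PiE UNIV (\<lambda>_. A)" by (simp add: full_shift_topology_def)
  have op: "openin ?T (topspace ?T - Y)" using Y by (auto simp: shift_space_def)
  have zT: "z \<in> topspace ?T - Y" using z by (auto simp: top)
  obtain U where U: "finite {i. U i \<noteq> A}" "z \<in> PiE UNIV U" "PiE UNIV U \<subseteq> topspace ?T - Y"
    using bspec[OF op[unfolded full_shift_topology_def openin_product_topology_alt]
        zT[unfolded full_shift_topology_def]]
    unfolding full_shift_topology_def by (elim exE conjE) (simp only: topspace_discrete_topology UNIV_I simp_thms)
  define J where "J = {i. U i \<noteq> A}"
  obtain b where b: "\<And>i. i \<in> J \<Longrightarrow> l1norm i \<le> b"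
    using finite_nat_set_iff_bounded_le[of "l1norm ` J"] U(1) by (auto simp: J_def)
  have no: "\<not> (\<forall>i\<in>J. y i = z i)" if "y \<in> Y" for y
  proof
    assume eq: "\<forall>i\<in>J. y i = z i"
    have "y i \<in> U i" for i
    proof (cases "i \<in> J")
      case True
      then show ?thesis using eq U(2) by (metis PiE_E UNIV_I)
    next
      case False
      moreover have "y i \<in> A" using shift_spaceD(2)[OF Y] that by blast
      ultimately show ?thesis by (simp add: J_def)
    qed
    then have "y \<in> PiE UNIV U" by auto
    then show False using U(3) that by auto
  qed
  have shift_Y: "shift c y \<in> Y" if "y \<in> Y" for c y using shift_spaceD(3)[OF Y] that by blast
  have 1: "\<not> agrees_near (b + 1) c y z" if y: "y \<in> Y" for y c
  proof
    assume ag: "agrees_near (b + 1) c y z"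
    have "shift c y i = z i" if "i \<in> J" for i
      using ag b[OF that] by (auto simp: agrees_near_def shift_def)
    then show False using no[OF shift_Y[OF y]] by blast
  qed
  moreover have "\<not> agrees_near (b + 1) c y (shift s z)" if y: "y \<in> Y" and s: "l1norm s = 1" for y c s
  proof
    assume ag: "agrees_near (b + 1) c y (shift s z)"
    have "shift (c - s) y i = z i" if "i \<in> J" for i
    proof -
      have "l1norm (i - s) \<le> b + 1"
        using l1norm_triangle[of i "- s"] b[OF that] s by simp
      then have "y (c + (i - s)) = z (s + (i - s))" using ag by (auto simp: agrees_near_def shift_def)
      moreover have "c - s + i = c + (i - s)" "s + (i - s) = i" by simp_all
      ultimately show ?thesis by (simp only: shift_def)
    qed
    then show False using no[OF shift_Y[OF y]] by blast
  qed
  ultimately show ?thesis using that[of "b + 1"] by simp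
qed

text \<open>First \<open>q\<close> makes \<open>K * q\<close> small, then \<theta> is chosen against
  \<open>- ln q\<close>; the denominator uses \<open>1 - ln q\<close> to stay positive when
  \<open>q = 1\<close>.\<close>

lemma small_code_rate:
  fixes K :: nat and \<eta> :: real
  assumes "0 < \<eta>"
  obtains q \<theta> where "0 < q" "q \<le> 1" "0 < \<theta>"
    "\<And>V. (1 + q) ^ (K * V) * q powr (- (\<theta> * real V)) \<le> exp (\<eta> * real V)"
proof -
  define q where "q = min 1 (\<eta> / (2 * real K + 1))"
  have q: "0 < q" "q \<le> 1" using assms by (auto simp: q_def)
  have Kq: "real K * q \<le> \<eta> / 2"
  proof -
    have "real K * q \<le> real K * (\<eta> / (2 * real K + 1))" by (intro mult_left_mono) (auto simp: q_def)
    also have "\<dots> \<le> \<eta> / 2" using assms by (simp add: field_simps)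
    finally show ?thesis .
  qed
  define \<theta> where "\<theta> = \<eta> / (2 * (1 - ln q))"
  have lnq: "ln q \<le> 0" using q by simp
  then have \<theta>: "0 < \<theta>" using assms by (simp add: \<theta>_def)
  have "\<theta> * (- ln q) \<le> \<theta> * (1 - ln q)" using \<theta> by (intro mult_left_mono) auto
  also have "\<dots> = \<eta> / 2" using lnq by (simp add: \<theta>_def field_simps)
  finally have \<theta>q: "\<theta> * (- ln q) \<le> \<eta> / 2" .
  have "(1 + q) ^ (K * V) * q powr (- (\<theta> * real V)) \<le> exp (\<eta> * real V)" for V
  proof -
    have "(1 + q) ^ (K * V) \<le> exp q ^ (K * V)" using q by (intro power_mono exp_ge_add_one_self) auto
    also have "\<dots> = exp (real K * q * real V)" by (simp add: exp_of_nat_mult[symmetric] mult_ac)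
    also have "\<dots> \<le> exp (\<eta> / 2 * real V)" unfolding exp_le_cancel_iff by (rule mult_right_mono[OF Kq]) simp
    finally have 1: "(1 + q) ^ (K * V) \<le> exp (\<eta> / 2 * real V)" .
    have "q powr (- (\<theta> * real V)) = exp (\<theta> * (- ln q) * real V)" using q by (simp add: powr_def mult_ac)
    also have "\<dots> \<le> exp (\<eta> / 2 * real V)" unfolding exp_le_cancel_iff by (rule mult_right_mono[OF \<theta>q]) simp
    finally have "(1 + q) ^ (K * V) * q powr (- (\<theta> * real V)) \<le> exp (\<eta> / 2 * real V) * exp (\<eta> / 2 * real V)"
      using 1 by (intro mult_mono) auto
    also have "\<dots> = exp (\<eta> * real V)" by (simp add: exp_add[symmetric] field_simps)
    finally show ?thesis .
  qed
  then show ?thesis using that q \<theta> by blast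
qed

text \<open>If \<open>h' \<le> h\<close>, dividing the bound by \<open>exp (h' * V)\<close> gives a
  contradiction. The first term decays as \<open>\<eta> < h'\<close>. The larger box has volume
  asymptotic to \<open>V\<close>, so its language costs at most \<open>c / 2\<close> in the
  exponent, and half of the gain \<open>c\<close> survives.\<close>

lemma exponential_gap:
  fixes a b :: "nat \<Rightarrow> real"
  assumes lower: "\<And>m. 0 < m \<Longrightarrow> exp (h * real (m ^ d)) \<le> a m"
    and b: "\<And>m. 0 < b m" "(\<lambda>m. ln (b m) / real (m ^ d)) \<longlonglongrightarrow> h'"
    and bound: "\<And>n. 0 < n \<Longrightarrow>
      a (L * n) \<le> exp (\<eta> * real ((L * n) ^ d)) + C * exp (- c * real ((L * n) ^ d)) * b (L * n + M)"
    and pos: "\<eta> < h'" "0 < c" "0 \<le> C" "0 < L" "0 < d"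
  shows "h < h'"
proof (rule ccontr)
  assume "\<not> h < h'"
  then have h: "h' \<le> h" by simp
  define V where "V n = real ((L * n) ^ d)" for n
  have subseq: "filterlim (\<lambda>n. L * n) at_top sequentially"
    using pos(4) by (intro filterlim_subseq) (auto simp: strict_mono_def)
  have V: "filterlim V at_top sequentially"
    unfolding V_def
    by (intro filterlim_compose[OF filterlim_real_sequentially] filterlim_compose[OF _ subseq]
        filterlim_subseq) (use pos(5) in \<open>auto simp: strict_mono_def power_strict_mono\<close>)
  have "filterlim (\<lambda>n. L * n + M) at_top sequentially"
    using pos(4) by (intro filterlim_subseq) (auto simp: strict_mono_def)
  from filterlim_compose[OF b(2) this]
  have 1: "(\<lambda>n. ln (b (L * n + M)) / real ((L * n + M) ^ d)) \<longlonglongrightarrow> h'" .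
  have "(\<lambda>n. (1 + real M / real (L * n)) ^ d) \<longlonglongrightarrow> (1 + 0) ^ d"
    by (intro tendsto_intros filterlim_compose[OF lim_const_over_n subseq])
  then have "(\<lambda>n. ln (b (L * n + M)) / real ((L * n + M) ^ d) * (1 + real M / real (L * n)) ^ d) \<longlonglongrightarrow> h' * (1 + 0) ^ d"
    by (intro tendsto_mult 1)
  then have "\<forall>\<^sub>F n in sequentially.
      ln (b (L * n + M)) / real ((L * n + M) ^ d) * (1 + real M / real (L * n)) ^ d < h' + c / 2"
    using pos(2) by (intro order_tendstoD(2)) auto
  then have ev1: "\<forall>\<^sub>F n in sequentially. b (L * n + M) \<le> exp ((h' + c / 2) * V n)"
    using eventually_gt_at_top[of 0]
  proof eventually_elim
    case (elim n)
    have n: "0 < L * n" using elim(2) pos(4) by simp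
    define P where "P = real ((L * n + M) ^ d)"
    have "0 < L * n + M" using n by simp
    then have P: "P \<noteq> 0" unfolding P_def by (metis of_nat_eq_0_iff power_not_zero less_irrefl)
    have "(1 + real M / real (L * n)) ^ d = P / V n"
    proof -
      have "1 + real M / real (L * n) = real (L * n + M) / real (L * n)" using n by (simp add: field_simps)
      then show ?thesis by (simp only: V_def P_def power_divide of_nat_power)
    qed
    then have "ln (b (L * n + M)) / P * (P / V n) < h' + c / 2" using elim(1) by (simp only: P_def)
    then have "ln (b (L * n + M)) / V n < h' + c / 2" using P by simp
    moreover have "0 < V n" using n by (simp add: V_def)
    ultimately have "ln (b (L * n + M)) \<le> (h' + c / 2) * V n" by (simp add: field_simps)
    then show ?case using b(1) by (metis exp_le_cancel_iff exp_ln)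
  qed
  have exp_lim: "(\<lambda>n. exp (- r * V n)) \<longlonglongrightarrow> 0" if "0 < r" for r
    by (rule filterlim_compose[OF exp_at_bot])
      (use filterlim_tendsto_neg_mult_at_bot[OF tendsto_const _ V, of "- r"] that in simp)
  have "(\<lambda>n. exp (- (h' - \<eta>) * V n) + C * exp (- (c / 2) * V n)) \<longlonglongrightarrow> 0 + C * 0"
    using pos by (intro tendsto_intros exp_lim) auto
  then have "\<forall>\<^sub>F n in sequentially. exp (- (h' - \<eta>) * V n) + C * exp (- (c / 2) * V n) < 1"
    by (intro order_tendstoD(2)) auto
  then have "\<forall>\<^sub>F n in sequentially. False"
    using ev1 eventually_gt_at_top[of 0]
  proof eventually_elim
    case (elim n)
    have "exp (h' * V n) \<le> exp (h * V n)" using h by (simp add: V_def mult_right_mono)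
    also have "\<dots> \<le> a (L * n)" unfolding V_def using elim(3) pos(4) by (intro lower) simp
    also have "\<dots> \<le> exp (\<eta> * V n) + C * exp (- c * V n) * b (L * n + M)"
      unfolding V_def by (rule bound[OF elim(3)])
    also have "\<dots> \<le> exp (\<eta> * V n) + C * exp (- c * V n) * exp ((h' + c / 2) * V n)"
      using elim(2) pos(3) by (intro add_left_mono mult_left_mono) auto
    also have "\<dots> = exp (h' * V n) * (exp (- (h' - \<eta>) * V n) + C * exp (- (c / 2) * V n))"
      by (simp add: algebra_simps exp_add[symmetric])
    finally have "1 \<le> exp (- (h' - \<eta>) * V n) + C * exp (- (c / 2) * V n)" by simp
    then show ?case using elim(1) by linarith
  qed
  then show False by simp
qed

context hom_graph
begin

lemma shift_homs: "shift i ` homs \<subseteq> homs"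
  by (auto simp: homs_def shift_def)

section \<open>Walks of prescribed length, and positivity of the entropy\<close>

lemma relpowp_bounce:
  assumes "(E ^^ n) a u" "E u v"
  shows "(E ^^ (n + 2 * m)) a u"
proof (induction m)
  case (Suc m)
  have "(E ^^ Suc (Suc (n + 2 * m))) a u" using Suc assms(2) sym by (meson relpowp_Suc_I)
  then show ?case by simp
qed (use assms in simp)

text \<open>Going back and forth over an edge at \<open>u\<close> adds two to the length. The other
  parity is reached by prefixing the edge from \<open>z (axis k 1)\<close>, the value of the
  translate at the origin, to \<open>z 0\<close>.\<close>

lemma walks_of_length:
  fixes z :: "int ^ 'd \<Rightarrow> 'a"
  assumes A: "finite A" "\<And>u v. E u v \<Longrightarrow> u \<in> A" and conn: "\<And>u v. u \<in> A \<Longrightarrow> v \<in> A \<Longrightarrow> E\<^sup>*\<^sup>* u v"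
    and z: "z \<in> homs"
  obtains N where "\<And>u v n. E u v \<Longrightarrow> N \<le> n \<Longrightarrow> \<exists>y\<in>{z, shift (axis k 1) z}. (E ^^ n) (y 0) u"
proof -
  have edge: "E (z (axis k 1)) (z 0)" using homsD[OF z lattice_adj_add_axis[of 1 0 k]] sym by simp
  have "\<exists>l. (E ^^ l) (z 0) u" if "u \<in> A" for u
    using conn[of "z 0" u] A(2) sym edge that rtranclp_power by metis
  then obtain l where l: "\<And>u. u \<in> A \<Longrightarrow> (E ^^ l u) (z 0) u" by metis
  define N where "N = Suc (Max (l ` A))"
  have "\<exists>y\<in>{z, shift (axis k 1) z}. (E ^^ n) (y 0) u" if uv: "E u v" and n: "N \<le> n" for u v n
  proof -
    have u: "u \<in> A" using A(2) uv by blast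
    then have lu: "Suc (l u) \<le> n" using A(1) n by (auto simp: N_def intro: le_trans[rotated])
    show ?thesis
    proof (cases "even (n - l u)")
      case True
      then obtain m where "n - l u = 2 * m" by blast
      then have "n = l u + 2 * m" using lu by simp
      then show ?thesis using relpowp_bounce[OF l[OF u] uv, of m] by auto
    next
      case False
      then obtain m where "n - l u = 2 * m + 1" by (elim oddE)
      then have "n = Suc (l u) + 2 * m" using lu by simp
      moreover have "(E ^^ Suc (l u)) (z (axis k 1)) u" using relpowp_Suc_I2[OF edge l[OF u]] .
      ultimately show ?thesis using relpowp_bounce[OF _ uv, of "Suc (l u)" _ m] by (auto simp: shift_def)
    qed
  qed
  then show ?thesis using that by blast
qed

text \<open>A configuration is now determined by its value at the origin. Walks of even length
  return to their start, so \<open>y\<close> or its translate has the value \<open>z 0\<close> there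
  and is equal to \<open>z\<close>.\<close>

lemma homs_subset_if_unique_neighbours:
  fixes Y :: "(int ^ 'd \<Rightarrow> 'a) set"
  assumes A: "finite A" "\<And>u v. E u v \<Longrightarrow> u \<in> A" and conn: "\<And>u v. u \<in> A \<Longrightarrow> v \<in> A \<Longrightarrow> E\<^sup>*\<^sup>* u v"
    and uniq: "\<And>v a b. E v a \<Longrightarrow> E v b \<Longrightarrow> a = b"
    and Y: "Y \<subseteq> homs" "Y \<noteq> {}" "\<And>i. shift i ` Y \<subseteq> Y"
  shows "homs \<subseteq> Y"
proof
  fix z :: "int ^ 'd \<Rightarrow> 'a" assume z: "z \<in> homs"
  obtain y where y: "y \<in> Y" using Y(2) by blast
  obtain N where N: "\<And>u v n. E u v \<Longrightarrow> N \<le> n \<Longrightarrow> \<exists>y'\<in>{y, shift (axis undefined 1) y}. (E ^^ n) (y' 0) u"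
  proof -
    have yh: "y \<in> homs" using y Y(1) by blast
    show thesis
    proof (rule walks_of_length[where k = "undefined :: 'd"])
      show "finite A" "y \<in> homs" by (fact A(1), fact yh)
    qed (use A(2) conn that in blast)+
  qed
  have "E (z 0) (z (0 + axis undefined 1))" by (intro homsD[OF z] lattice_adj_add_axis) simp
  then obtain y' where y': "y' \<in> {y, shift (axis undefined 1) y}" "(E ^^ (2 * N)) (y' 0) (z 0)"
    using N[of "z 0" _ "2 * N"] by auto
  have "y' \<in> Y" using y' y Y(3) by blast
  have returns: "u = a" if "(E ^^ (2 * m)) a u" for m a u
    using that
  proof (induction m arbitrary: u)
    case (Suc m)
    then obtain b c where "(E ^^ (2 * m)) a b" "E b c" "E c u" by auto
    then show ?case using Suc.IH uniq sym by blast
  qed simp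
  have "y' i = z i" for i
  proof (induction "l1norm (i - 0)" arbitrary: i)
    case 0
    then show ?case using returns[OF y'(2)] by simp
  next
    case (Suc n)
    obtain j where j: "lattice_adj i j" "l1norm (j - 0) = n" using closer_neighbour[OF Suc.hyps(2)[symmetric]] .
    then have "y' j = z j" using Suc.hyps(1)[of j] by simp
    then show ?case
      using uniq sym homsD[OF z j(1)] homsD[of y' i j] \<open>y' \<in> Y\<close> Y(1) j(1) by (metis subsetD)
  qed
  then have "y' = z" by blast
  then show "z \<in> Y" using \<open>y' \<in> Y\<close> by simp
qed

text \<open>With \<open>v\<close> on all even sites, the odd sites carry \<open>a\<close> or
  \<open>b\<close> freely; \<open>e\<close> selects \<open>n ^ CARD('d)\<close> odd sites in the
  cube.\<close>

lemma card_language_homs_ge: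
  assumes A: "finite A" "homs \<subseteq> (UNIV :: (int ^ 'd) set) \<rightarrow> A" and ab: "E v a" "E v b" "a \<noteq> b"
  shows "2 ^ (n ^ CARD('d)) \<le> card (language (cube (2 * n)) (homs :: (int ^ 'd \<Rightarrow> 'a) set))"
proof -
  define e where "e t = t + t + axis undefined 1" for t :: "int ^ 'd"
  define x where "x T j = (if even (l1norm j) then v else if j \<in> e ` T then b else a)" for T and j :: "int ^ 'd"
  have inj_e: "inj e" by (auto simp: inj_def e_def vec_eq_iff)
  have e: "e t \<in> cube (2 * n)" "odd (l1norm (e t))" if "t \<in> cube n" for t
  proof -
    have t: "0 \<le> t $ h" "t $ h < int n" for h using that by (auto simp: mem_cube)
    show "e t \<in> cube (2 * n)" unfolding mem_cube
    proof
      fix h show "0 \<le> e t $ h \<and> e t $ h < int (2 * n)"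
        using t[of h] by (auto simp: e_def axis_def)
    qed
    have "int (l1norm (t + t)) = 2 * int (l1norm t)"
      unfolding int_l1norm sum_distrib_left by (rule sum.cong) auto
    then have "int (l1norm (e t)) = 2 * int (l1norm t) + 1"
      using l1norm_add_axis[of "t + t" undefined 1] t[of undefined] by (simp add: e_def)
    then have "l1norm (e t) = 2 * l1norm t + 1" by linarith
    then show "odd (l1norm (e t))" by simp
  qed
  have "x T \<in> homs" for T
    unfolding homs_def
  proof (intro CollectI allI impI)
    fix i j :: "int ^ 'd" assume "lattice_adj i j"
    then have "even (l1norm i) \<noteq> even (l1norm j)" using lattice_adj_l1norm by fastforce
    then show "E (x T i) (x T j)" using ab sym by (auto simp: x_def)
  qed
  then have sub: "(\<lambda>T. restrict (x T) (cube (2 * n))) ` Pow (cube n) \<subseteq> language (cube (2 * n)) homs"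
    by (auto simp: language_def)
  have "inj_on (\<lambda>T. restrict (x T) (cube (2 * n))) (Pow (cube n))"
  proof (rule inj_onI)
    fix S T assume ST: "S \<in> Pow (cube n)" "T \<in> Pow (cube n)"
      and eq: "restrict (x S) (cube (2 * n)) = restrict (x T) (cube (2 * n))"
    have "t \<in> S \<longleftrightarrow> t \<in> T" if "t \<in> cube n" for t
    proof -
      have "x S (e t) = x T (e t)" using fun_cong[OF eq, of "e t"] e(1)[OF that] by simp
      then show ?thesis
        using e(2)[OF that] ab(3) inj_image_mem_iff[OF inj_e, of t] by (auto simp: x_def split: if_splits)
    qed
    then show "S = T" using ST by blast
  qed
  then have "card (Pow (cube n :: (int ^ 'd) set)) \<le> card (language (cube (2 * n)) (homs :: (int ^ 'd \<Rightarrow> 'a) set))"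
    using sub A by (intro card_inj_on_le finite_language) auto
  then show ?thesis by (simp add: card_Pow card_cube)
qed

lemma card_language_homs_limit_pos:
  assumes A: "finite A" "homs \<subseteq> (UNIV :: (int ^ 'd) set) \<rightarrow> A" and ab: "E v a" "E v b" "a \<noteq> b"
    and lim: "(\<lambda>m. ln (real (card (language (cube m) (homs :: (int ^ 'd \<Rightarrow> 'a) set)))) / real (m ^ CARD('d))) \<longlonglongrightarrow> h"
  shows "0 < h"
proof -
  have "filterlim (\<lambda>n :: nat. 2 * n) at_top sequentially"
    by (rule filterlim_subseq) (auto simp: strict_mono_def)
  from filterlim_compose[OF lim this]
  have "(\<lambda>n. ln (real (card (language (cube (2 * n)) (homs :: (int ^ 'd \<Rightarrow> 'a) set)))) / real ((2 * n) ^ CARD('d))) \<longlonglongrightarrow> h" .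
  moreover have "ln 2 / 2 ^ CARD('d) \<le>
      ln (real (card (language (cube (2 * n)) (homs :: (int ^ 'd \<Rightarrow> 'a) set)))) / real ((2 * n) ^ CARD('d))"
    if "1 \<le> n" for n
  proof -
    let ?c = "card (language (cube (2 * n)) (homs :: (int ^ 'd \<Rightarrow> 'a) set))"
    have "real (2 ^ (n ^ CARD('d))) \<le> real ?c"
      using card_language_homs_ge[OF A ab, of n] by (simp only: of_nat_le_iff)
    then have "ln (real (2 ^ (n ^ CARD('d)))) \<le> ln (real ?c)" by (intro ln_mono) auto
    then have "real (n ^ CARD('d)) * ln 2 \<le> ln (real ?c)" by (simp add: ln_realpow)
    then show ?thesis using that by (simp add: field_simps power_mult_distrib)
  qed
  ultimately have "ln 2 / 2 ^ CARD('d) \<le> h" by (intro LIMSEQ_le_const) auto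
  then show ?thesis by (smt (verit) divide_pos_pos ln_gt_zero zero_less_power)
qed

text \<open>If replaceable sites have density above \<epsilon>, then by pigeonhole some residue
  class modulo \<open>2 * M\<close> contains at least its average share of them, and distinct sites
  of a class are \<open>2 * M\<close> apart as patching requires. All other configurations are
  counted by their codes.\<close>

lemma card_language_avoiding:
  fixes Y Z :: "(int ^ 'd \<Rightarrow> 'a) set" and oth :: "'d \<Rightarrow> 'd"
  assumes A: "finite A" "homs \<subseteq> (UNIV :: (int ^ 'd) set) \<rightarrow> A" and Y: "Y \<subseteq> homs" and Z: "Z \<subseteq> homs"
    and avoid: "\<And>x c z. x \<in> Y \<Longrightarrow> z \<in> Z \<Longrightarrow> \<not> agrees_near k c x z"
    and walks: "\<And>u v n. E u v \<Longrightarrow> N \<le> n \<Longrightarrow> \<exists>z\<in>Z. (E ^^ n) (z 0) u"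
    and k: "1 \<le> k" "k < M" "CARD('d) * L \<le> M"
    and LR: "0 < L" "0 < R" "L dvd m" "R dvd m" and oth: "\<And>k. oth k \<noteq> k"
    and \<theta>: "2 * real CARD('d) * (1 / real R + (3 + 2 * real (2 * (2 * k + N) + 2 * R)) / real L) + \<epsilon> \<le> \<theta>"
    and q: "0 < q" "q \<le> 1"
  shows "real (card (language (cube m) Y)) \<le>
    (1 + q) ^ (2 * (2 * CARD('d) + 1) * card A * m ^ CARD('d)) * q powr (- (\<theta> * real (m ^ CARD('d)))) +
    real ((2 * M) ^ CARD('d)) *
      (1 + 1 / real (card A) ^ card {j :: int ^ 'd. l1norm j < M}) powr
        (- (\<epsilon> / real ((2 * M) ^ CARD('d)) * real (m ^ CARD('d)))) *
      real (card (language ((+) (\<chi> k. - int M) ` cube (m + 2 * M)) (homs :: (int ^ 'd \<Rightarrow> 'a) set)))"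
    (is "_ \<le> ?few + _ * ?r powr (- ?g) * ?b")
proof -
  define D where "D = 2 * (2 * k + N) + 2 * R"
  interpret block_coding E L R D m oth
    by unfold_locales (use LR oth in auto)
  define \<Gamma> where "\<Gamma> \<tau> = {c \<in> cube m. \<forall>h. c $ h mod int (2 * M) = \<tau> $ h}" for \<tau> :: "int ^ 'd"
  define few where "few = {x \<in> Y. real (card {c \<in> cube m. replaceable M k Z x c}) \<le> \<epsilon> * real (m ^ CARD('d))}"
  define many where "many \<tau> = {x \<in> Y. ?g \<le> real (card {c \<in> \<Gamma> \<tau>. replaceable M k Z x c})}" for \<tau>
  have M: "0 < M" using k by simp
  have YA: "Y \<subseteq> UNIV \<rightarrow> A" using Y A(2) by blast
  have "Y \<subseteq> few \<union> (\<Union>\<tau>\<in>cube (2 * M). many \<tau>)"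
  proof (rule subsetI, rule ccontr)
    fix x assume x: "x \<in> Y" "x \<notin> few \<union> (\<Union>\<tau>\<in>cube (2 * M). many \<tau>)"
    let ?G = "\<lambda>C. {c \<in> C. replaceable M k Z x c}"
    have less: "real (card (?G (\<Gamma> \<tau>))) \<le> ?g" if "\<tau> \<in> cube (2 * M)" for \<tau>
      using x that by (auto simp: many_def)
    have "?G (cube m) \<subseteq> (\<Union>\<tau>\<in>cube (2 * M). ?G (\<Gamma> \<tau>))"
    proof
      fix c assume c: "c \<in> ?G (cube m)"
      then have "c \<in> ?G (\<Gamma> (\<chi> h. c $ h mod int (2 * M)))" by (simp add: \<Gamma>_def)
      moreover have "(\<chi> h. c $ h mod int (2 * M)) \<in> cube (2 * M)" using M by (simp add: mem_cube)
      ultimately show "c \<in> (\<Union>\<tau>\<in>cube (2 * M). ?G (\<Gamma> \<tau>))" by blast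
    qed
    then have "card (?G (cube m)) \<le> card (\<Union>\<tau>\<in>cube (2 * M). ?G (\<Gamma> \<tau>))"
      by (intro card_mono finite_UN_I) (auto simp: \<Gamma>_def)
    also have "\<dots> \<le> (\<Sum>\<tau>\<in>cube (2 * M). card (?G (\<Gamma> \<tau>)))" by (rule card_UN_le) simp
    finally have "real (card (?G (cube m))) \<le> (\<Sum>\<tau>\<in>cube (2 * M). real (card (?G (\<Gamma> \<tau>))))"
      by (simp flip: of_nat_sum)
    also have "\<dots> \<le> (\<Sum>\<tau>\<in>(cube (2 * M) :: (int ^ 'd) set). ?g)" by (rule sum_mono) (rule less)
    also have "\<dots> = \<epsilon> * real (m ^ CARD('d))" using M by (simp add: card_cube)
    finally show False using x by (simp add: few_def)
  qed
  then have "language (cube m) Y \<subseteq> language (cube m) few \<union> (\<Union>\<tau>\<in>cube (2 * M). language (cube m) (many \<tau>))"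
    unfolding language_def by blast
  moreover have fin: "finite (language (cube m) few)" "finite (language (cube m) (many \<tau>))" for \<tau>
    using YA A(1) by (auto intro!: finite_language simp: few_def many_def)
  ultimately have "card (language (cube m) Y) \<le>
      card (language (cube m) few \<union> (\<Union>\<tau>\<in>cube (2 * M). language (cube m) (many \<tau>)))"
    by (intro card_mono) auto
  also have "\<dots> \<le> card (language (cube m) few) + card (\<Union>\<tau>\<in>cube (2 * M). language (cube m) (many \<tau>))"
    by (rule card_Un_le)
  also have "card (\<Union>\<tau>\<in>cube (2 * M). language (cube m) (many \<tau>)) \<le>
      (\<Sum>\<tau>\<in>cube (2 * M). card (language (cube m) (many \<tau>)))" by (rule card_UN_le) simp
  finally have "real (card (language (cube m) Y)) \<le>
      real (card (language (cube m) few)) + (\<Sum>\<tau>\<in>cube (2 * M). real (card (language (cube m) (many \<tau>))))"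
    by (simp flip: of_nat_sum of_nat_add)
  also have "\<dots> \<le> ?few + (\<Sum>\<tau>\<in>(cube (2 * M) :: (int ^ 'd) set). ?r powr (- ?g) * ?b)"
  proof (intro add_mono sum_mono)
    show "real (card (language (cube m) few)) \<le> ?few"
    proof (rule card_language_few_unfrozen)
      fix x assume x: "x \<in> few"
      then have xY: "x \<in> homs" using Y by (auto simp: few_def)
      have L: "1 \<le> L" using LR(1) by simp
      have "{i \<in> cube m. \<forall>k s. \<bar>s\<bar> = 1 \<longrightarrow> \<not> frozen L R D x i k s (oth k)} \<subseteq>
          {c \<in> cube m. replaceable M k Z x c}"
      proof -
        have "replaceable M k Z x i \<or> (\<exists>k' s. \<bar>s\<bar> = 1 \<and> (\<forall>l. frozen L R D x i k' s l))" for i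
          unfolding D_def by (rule replaceable_or_frozen[OF xY Z k(1) _ L k(3)]) (rule walks)
        then show ?thesis by blast
      qed
      then have "card {i \<in> cube m. \<forall>k s. \<bar>s\<bar> = 1 \<longrightarrow> \<not> frozen L R D x i k s (oth k)} \<le>
          card {c \<in> cube m. replaceable M k Z x c}" by (intro card_mono) auto
      then show "real (card {i \<in> cube m. \<forall>k s. \<bar>s\<bar> = 1 \<longrightarrow> \<not> frozen L R D x i k s (oth k)}) \<le>
          \<epsilon> * real (m ^ CARD('d))" using x by (simp add: few_def)
    qed (use A(1) YA Y \<theta> q in \<open>auto simp: few_def D_def\<close>)
    fix \<tau> :: "int ^ 'd" assume "\<tau> \<in> cube (2 * M)"
    have "real (card (language (cube m) (many \<tau>))) * ?r powr ?g \<le> ?b"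
    proof (rule card_language_many_replaceable[where Z = Z, OF A _ _ k(2)])
      show "2 * M \<le> l1norm (c - c')" if cc: "c \<in> \<Gamma> \<tau>" "c' \<in> \<Gamma> \<tau>" "c \<noteq> c'" for c c'
      proof -
        obtain h where h: "c $ h \<noteq> c' $ h" using cc(3) by (auto simp: vec_eq_iff)
        have "c $ h mod int (2 * M) = c' $ h mod int (2 * M)" using cc by (auto simp: \<Gamma>_def)
        then have "int (2 * M) dvd (c - c') $ h" by (simp add: mod_eq_dvd_iff)
        then have "int (2 * M) \<le> \<bar>(c - c') $ h\<bar>" using h by (intro zdvd_imp_le) auto
        then show ?thesis using abs_component_le_l1norm[of "c - c'" h] by linarith
      qed
    qed (use Y avoid in \<open>auto simp: many_def \<Gamma>_def\<close>)
    moreover have "0 < ?r" by (simp add: add_pos_nonneg)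
    ultimately show "real (card (language (cube m) (many \<tau>))) \<le> ?r powr (- ?g) * ?b"
      by (simp add: powr_minus field_simps)
  qed
  finally show ?thesis by (simp add: card_cube mult_ac)
qed

end

context hom_graph
begin

lemma entropy_less:
  fixes Y :: "(int ^ 'd \<Rightarrow> 'a) set"
  assumes d: "2 \<le> CARD('d)" and A: "finite A" "\<And>u v. E u v \<Longrightarrow> u \<in> A"
    and conn: "\<And>u v. u \<in> A \<Longrightarrow> v \<in> A \<Longrightarrow> E\<^sup>*\<^sup>* u v"
    and two: "E v a" "E v b" "a \<noteq> b"
    and Y: "shift_space A Y" "Y \<noteq> {}" "Y \<subset> homs"
  shows "topological_entropy Y < topological_entropy (homs :: (int ^ 'd \<Rightarrow> 'a) set)"
proof -
  let ?X = "homs :: (int ^ 'd \<Rightarrow> 'a) set"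
  obtain z where z: "z \<in> ?X" "z \<notin> Y" using Y(3) by blast
  have XA: "?X \<subseteq> UNIV \<rightarrow> A"
    using A(2) homsD lattice_adj_add_axis[of 1] by fastforce
  have YX: "Y \<subseteq> ?X" using Y(3) by blast
  have Xne: "?X \<noteq> {}" using z(1) by blast
  note X = shift_homs A(1) XA
  obtain hY where hY: "topological_entropy Y = ereal hY"
    "\<And>m. 0 < m \<Longrightarrow> hY \<le> ln (real (card (language (cube m) Y))) / real (m ^ CARD('d))"
    by (rule topological_entropy_limit[OF shift_spaceD(3,1,2)[OF Y(1)] Y(2)]) blast
  obtain hX where hX: "topological_entropy ?X = ereal hX"
    "(\<lambda>m. ln (real (card (language (cube m) ?X))) / real (m ^ CARD('d))) \<longlonglongrightarrow> hX"
    by (rule topological_entropy_limit[OF X Xne]) blast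
  have hX_pos: "0 < hX" using card_language_homs_limit_pos[OF A(1) XA two hX(2)] .
  have zA: "z i \<in> A" for i using z(1) XA by blast
  obtain k where k: "1 \<le> k" "\<And>y c. y \<in> Y \<Longrightarrow> \<not> agrees_near k c y z"
    "\<And>y c s. y \<in> Y \<Longrightarrow> l1norm s = 1 \<Longrightarrow> \<not> agrees_near k c y (shift s z)"
    by (rule avoided_pattern[OF Y(1) z(2) zA]) blast
  define Z where "Z = {z, shift (axis undefined 1) z}"
  have Z: "Z \<subseteq> ?X" using z(1) shift_homs by (auto simp: Z_def)
  have avoid: "\<not> agrees_near k c x z'" if "x \<in> Y" "z' \<in> Z" for x c z'
    using k(2,3) that by (auto simp: Z_def)
  obtain N where N: "\<And>u v n. E u v \<Longrightarrow> N \<le> n \<Longrightarrow> \<exists>z'\<in>Z. (E ^^ n) (z' 0) u"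
  proof (rule walks_of_length[where k = "undefined :: 'd"])
    show "finite A" "z \<in> homs" by (fact A(1), fact z(1))
  qed (use A(2) conn Z_def that in blast)+
  define K where "K = 2 * (2 * CARD('d) + 1) * card A"
  obtain q \<theta> where q: "0 < q" "q \<le> 1" and \<theta>: "0 < \<theta>"
    and rate: "\<And>V. (1 + q) ^ (K * V) * q powr (- (\<theta> * real V)) \<le> exp (hX / 2 * real V)"
    using small_code_rate[of "hX / 2" K] hX_pos by (metis half_gt_zero)
  \<comment> \<open>Of the budget \<theta>, a quarter goes to the first rows of blocks, a quarter to
    the term with \<open>L\<close>, and the half \<epsilon> to replaceable sites.\<close>
  obtain R where R: "8 * real CARD('d) / \<theta> < real R" using reals_Archimedean2 by blast
  define D where "D = 2 * (2 * k + N) + 2 * R"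
  obtain L' where L': "8 * real CARD('d) * (3 + 2 * real D) / \<theta> < real L'" using reals_Archimedean2 by blast
  have "0 < 8 * real CARD('d) / \<theta>" using \<theta> by simp
  then have R0: "0 < R" using R by (metis less_trans of_nat_0_less_iff)
  have "0 < 8 * real CARD('d) * (3 + 2 * real D) / \<theta>" using \<theta> by simp
  then have L'0: "0 < L'" using L' by (metis less_trans of_nat_0_less_iff)
  \<comment> \<open>A multiple of \<open>R\<close>, so that both sides of a block divide
    \<open>L * n\<close>.\<close>
  define L where "L = R * L'"
  have L0: "0 < L" using R0 L'0 by (simp add: L_def)
  define M where "M = CARD('d) * L + k + 1"
  define \<epsilon> where "\<epsilon> = \<theta> / 2"
  have "2 * real CARD('d) * (1 / real R) \<le> \<theta> / 4"
    using R R0 \<theta> by (simp add: field_simps)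
  moreover have "2 * real CARD('d) * ((3 + 2 * real D) / real L) \<le> \<theta> / 4"
  proof -
    have "(3 + 2 * real D) / real L \<le> (3 + 2 * real D) / real L'"
      using R0 L'0 by (intro divide_left_mono) (auto simp: L_def)
    then have "2 * real CARD('d) * ((3 + 2 * real D) / real L) \<le> 2 * real CARD('d) * ((3 + 2 * real D) / real L')"
      by (intro mult_left_mono) auto
    also have "\<dots> \<le> \<theta> / 4" using L' L'0 \<theta> by (simp add: field_simps)
    finally show ?thesis .
  qed
  ultimately have \<theta>_bound: "2 * real CARD('d) * (1 / real R + (3 + 2 * real D) / real L) + \<epsilon> \<le> \<theta>"
    unfolding \<epsilon>_def distrib_left by linarith
  obtain oth :: "'d \<Rightarrow> 'd" where oth: "\<And>k. oth k \<noteq> k"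
  proof -
    have "\<exists>l. l \<noteq> k" for k :: 'd
    proof (rule ccontr)
      assume "\<nexists>l. l \<noteq> k"
      then have "(UNIV :: 'd set) = {k}" by blast
      then have "CARD('d) = 1" by (metis card.empty card.insert empty_iff finite.emptyI One_nat_def)
      then show False using d by simp
    qed
    then show thesis using that by metis
  qed
  define r where "r = 1 + 1 / real (card A) ^ card {j :: int ^ 'd. l1norm j < M}"
  have "A \<noteq> {}" using zA by blast
  then have "0 < card A" using A(1) by (simp add: card_gt_0_iff)
  then have r: "1 < r" by (simp add: r_def)
  define c where "c = \<epsilon> / real ((2 * M) ^ CARD('d)) * ln r"
  have M: "0 < M" "k < M" "CARD('d) * L \<le> M" by (auto simp: M_def)
  have c: "0 < c" using r \<theta> M(1) by (simp add: c_def \<epsilon>_def)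
  have pos: "0 < card (language (cube m) W)" if "W \<subseteq> ?X" "W \<noteq> {}" for W m
  proof -
    have "W \<subseteq> UNIV \<rightarrow> A" using that(1) XA by blast
    from finite_language[OF A(1) this finite_cube] show ?thesis
      using that(2) by (simp add: card_gt_0_iff language_def)
  qed
  have "hY < hX"
  proof (rule exponential_gap[where a = "\<lambda>m. real (card (language (cube m) Y))"
        and b = "\<lambda>m. real (card (language (cube m) ?X))" and d = "CARD('d)" and L = L and M = "2 * M"
        and C = "real ((2 * M) ^ CARD('d))" and c = c and \<eta> = "hX / 2"])
    fix m :: nat assume m: "0 < m"
    have "hY * real (m ^ CARD('d)) \<le> ln (real (card (language (cube m) Y)))"
      using hY(2)[OF m] m by (simp add: field_simps)
    then have "exp (hY * real (m ^ CARD('d))) \<le> exp (ln (real (card (language (cube m) Y))))"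
      by (simp only: exp_le_cancel_iff)
    then show "exp (hY * real (m ^ CARD('d))) \<le> real (card (language (cube m) Y))"
      using pos[OF YX Y(2), of m] by simp
  next
    fix n :: nat assume "0 < n"
    define V where "V = (L * n) ^ CARD('d)"
    have "real (card (language (cube (L * n)) Y)) \<le>
      (1 + q) ^ (2 * (2 * CARD('d) + 1) * card A * (L * n) ^ CARD('d)) * q powr (- (\<theta> * real ((L * n) ^ CARD('d)))) +
      real ((2 * M) ^ CARD('d)) *
        (1 + 1 / real (card A) ^ card {j :: int ^ 'd. l1norm j < M}) powr
          (- (\<epsilon> / real ((2 * M) ^ CARD('d)) * real ((L * n) ^ CARD('d)))) *
        real (card (language ((+) (\<chi> k. - int M) ` cube (L * n + 2 * M)) ?X))"
      by (rule card_language_avoiding[OF A(1) XA YX Z avoid N k(1) M(2,3) L0 R0 _ _ oth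
            \<theta>_bound[unfolded D_def] q]) (auto simp: L_def)
    also have "card (language ((+) (\<chi> k. - int M) ` cube (L * n + 2 * M)) ?X) =
        card (language (cube (L * n + 2 * M)) ?X)"
      by (rule card_language_translate[OF X]) simp
    also have "(1 + 1 / real (card A) ^ card {j :: int ^ 'd. l1norm j < M}) powr
          (- (\<epsilon> / real ((2 * M) ^ CARD('d)) * real ((L * n) ^ CARD('d)))) = exp (- c * real ((L * n) ^ CARD('d)))"
      unfolding r_def[symmetric] using r by (simp add: powr_def c_def)
    also have "(1 + q) ^ (2 * (2 * CARD('d) + 1) * card A * (L * n) ^ CARD('d)) * q powr (- (\<theta> * real ((L * n) ^ CARD('d))))
        \<le> exp (hX / 2 * real ((L * n) ^ CARD('d)))"
      using rate[of "(L * n) ^ CARD('d)"] unfolding K_def .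
    finally show "real (card (language (cube (L * n)) Y)) \<le> exp (hX / 2 * real ((L * n) ^ CARD('d))) +
        real ((2 * M) ^ CARD('d)) * exp (- c * real ((L * n) ^ CARD('d))) * real (card (language (cube (L * n + 2 * M)) ?X))"
      by simp
  qed (use hX(2) hX_pos c L0 pos[OF subset_refl Xne] in auto)
  then show ?thesis by (simp add: hY(1) hX(1))
qed

end

theorem theorem2p2:
  fixes H :: "'a pair_pre_digraph"
  assumes "CARD('d::finite) \<ge> 2"
    and "undirected_graph H"
    and "Digraph_Component.connected H"
    and "four_cycle_free H"
  shows "entropy_minimal (pverts H) (hom_shift H :: (int ^ 'd \<Rightarrow> 'a) set)"
proof -
  define E where "E u v \<longleftrightarrow> (u, v) \<in> parcs H" for u v
  interpret sym_H: pair_sym_digraph H using assms(2) by (simp add: undirected_graph_def)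
  have verts: "u \<in> pverts H" "v \<in> pverts H" if "E u v" for u v
    using that sym_H.in_arcsD1 sym_H.in_arcsD2 by (auto simp: E_def)
  have sym: "E v u" if "E u v" for u v
    using that sym_H.sym_arcs by (auto simp: E_def symmetric_def dest: symD)
  have irrefl: "u \<noteq> v" if "E u v" for u v
    using that verts[OF that] assms(4) by (auto simp: E_def four_cycle_free_def)
  interpret hom_graph E
  proof
    fix a b c d assume *: "E a b" "E b c" "E c d" "E d a"
    show "a = c \<or> b = d"
    proof (rule ccontr)
      assume "\<not> (a = c \<or> b = d)"
      then have "distinct [a, b, c, d]" using irrefl[OF *(1)] irrefl[OF *(2)] irrefl[OF *(3)] irrefl[OF *(4)] by auto
      then have "contains_C4 H" unfolding contains_C4_def using * by (auto simp: E_def)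
      then show False using assms(4) by (simp add: four_cycle_free_def)
    qed
  qed (rule sym)
  have X: "hom_shift H = (homs :: (int ^ 'd \<Rightarrow> 'a) set)"
  proof -
    have "x i \<in> pverts H" if "x \<in> homs" for x and i :: "int ^ 'd"
      using verts homsD[OF that lattice_adj_add_axis[of 1 i undefined]] by simp
    then show ?thesis by (auto simp: hom_shift_def homs_def E_def)
  qed
  have A: "finite (pverts H)" "\<And>u v. E u v \<Longrightarrow> u \<in> pverts H"
    using assms(4) verts by (auto simp: four_cycle_free_def)
  have conn: "E\<^sup>*\<^sup>* u v" if "u \<in> pverts H" "v \<in> pverts H" for u v
  proof -
    have "u \<rightarrow>\<^sup>*\<^bsub>mk_symmetric H\<^esub> v"
      using assms(3) that by (auto simp: connected_def strongly_connected_def)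
    then have "(u, v) \<in> (parcs (mk_symmetric H))\<^sup>*" using reachable_rtranclI by fastforce
    moreover have "parcs (mk_symmetric H) = {(u, v). E u v}"
      using sym by (auto simp: parcs_mk_symmetric E_def)
    ultimately show ?thesis by (simp add: rtranclp_rtrancl_eq)
  qed
  have "topological_entropy Y < topological_entropy (homs :: (int ^ 'd \<Rightarrow> 'a) set)"
    if Y: "shift_space (pverts H) Y" "Y \<subset> homs" for Y :: "(int ^ 'd \<Rightarrow> 'a) set"
  \<comment> \<open>The empty shift has entropy \<open>- \<infinity>\<close>, whereas that of a
    nonempty one is finite.\<close>
  proof (cases "Y = {}")
    case True
    have "homs \<subseteq> (UNIV :: (int ^ 'd) set) \<rightarrow> pverts H"
      using A(2) homsD lattice_adj_add_axis[of 1] by fastforce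
    moreover have "(homs :: (int ^ 'd \<Rightarrow> 'a) set) \<noteq> {}" using Y(2) by blast
    ultimately obtain h where "topological_entropy (homs :: (int ^ 'd \<Rightarrow> 'a) set) = ereal h"
      using topological_entropy_limit[OF shift_homs A(1)] by metis
    then show ?thesis by (simp add: True topological_entropy_empty)
  next
    case False
    show ?thesis
    proof (cases "\<exists>v a b. E v a \<and> E v b \<and> a \<noteq> b")
      case True
      then obtain v a b where vab: "E v a" "E v b" "a \<noteq> b" by blast
      show ?thesis
      proof (rule entropy_less[OF assms(1) A(1) _ _ vab Y(1) False Y(2)])
        show "u \<in> pverts H" if "E u v" for u v using A(2)[OF that] .
        show "E\<^sup>*\<^sup>* u v" if "u \<in> pverts H" "v \<in> pverts H" for u v using conn[OF that] .
      qed
    next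
      case no: False
      have "homs \<subseteq> Y"
      proof (rule homs_subset_if_unique_neighbours[where A = "pverts H"])
        show "finite (pverts H)" by (rule A(1))
        show "u \<in> pverts H" if "E u v" for u v using A(2)[OF that] .
        show "E\<^sup>*\<^sup>* u v" if "u \<in> pverts H" "v \<in> pverts H" for u v using conn[OF that] .
        show "a = b" if "E v a" "E v b" for v a b using no that by blast
      qed (use Y False shift_spaceD(3)[OF Y(1)] in auto)
      then show ?thesis using Y(2) by blast
    qed
  qed
  then show ?thesis by (simp add: entropy_minimal_def X)
qed

end
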